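(* Let $\rho,\tau\in\mathbb{Z}_{\ge 1}$ and $r>0$ be fixed, and consider the two-color competition dynamics on $\mathbb{Z}^2$ with red neighborhood $\mathcal{R}=\{0\}\times([-\rho,\rho]\cap\mathbb{Z})$, blue neighborhood $\mathcal{B}=([-\tau,\tau]\cap\mathbb{Z})\times\{0\}$, red update interval $r$, and initial densities $p$ of blue and $q$ of red. Let $\gamma=\frac1\tau+\frac{\rho}{\rho+1}$ and $\gamma'=\frac1\rho+\frac{\tau}{\tau+1}$. Then $\gamma\gamma'>1$, and, as $p,q\to0$: \begin{itemize} \item if $q\ll p^{\gamma}$, then $\mathbb{P}(0\text{ is eventually blue})\to1$; \item if $p^{\gamma}\ll q\ll p^{1/\gamma'}$, then $\mathbb{P}(0\text{ remains empty for all time})\to1$; \item if $p^{1/\gamma'}\ll q$, then $\mathbb{P}(0\text{ is eventually red})\to1$. \end{itemize}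
   Context: Two-color competition dynamics on $\mathbb{Z}^2$. Initially each vertex of $\mathbb{Z}^2$ is independently blue with probability $p$, red with probability $q$, and empty with probability $1-p-q$. Let $\mathcal{B}\subset\mathbb{Z}\times\{0\}$ and $\mathcal{R}\subset\mathbb{Z}^2$ be finite sets and $r>0$. At times $t\in\{1,2,3,\dots\}$, every empty vertex $x$ that has a blue vertex in $x+\mathcal{B}$ becomes blue. At times $t\in\{r,2r,3r,\dots\}$, every empty vertex $x$ that has a red vertex in $x+\mathcal{R}$ becomes red. If a vertex is due to become both blue and red at the same time, its color is decided by an independent fair coin flip. Colored vertices never change color again. Hence every vertex changes state at most once and has a final state; "$0$ is eventually blue (red)" means that the final state of the origin is blue (red), and "$0$ remains empty for all time" means its final state is empty. Asymptotic notation: $p,q>0$ vary together with $p\to0$ and $q\to0$, and $u\ll v$ means $u/v\to0$. *)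

theory Defs
  imports "HOL-Probability.Probability"
begin

datatype color = Empty | Blue | Red

type_synonym vertex = "int \<times> int"

definition blue_time :: "real \<Rightarrow> bool" where
  "blue_time t \<longleftrightarrow> (\<exists>k::nat. k \<ge> 1 \<and> t = real k)"

definition red_time :: "real \<Rightarrow> real \<Rightarrow> bool" where
  "red_time r t \<longleftrightarrow> (\<exists>k::nat. k \<ge> 1 \<and> t = real k * r)"

text \<open>
  The times at which anything happens are \<open>0\<close> (initial state) followed by the elements of
  \<open>{1, 2, 3, \<dots>} \<union> {r, 2r, 3r, \<dots>}\<close>, listed in increasing order without repetition.
  For \<open>r > 0\<close> this set is locally finite, so the infimum below is a minimum.
\<close>
primrec update_time :: "real \<Rightarrow> nat \<Rightarrow> real" where
  "update_time r 0 = 0"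
| "update_time r (Suc n) = Inf {t. update_time r n < t \<and> (blue_time t \<or> red_time r t)}"

lemma update_time_Suc:
  assumes "r > 0"
  shows "update_time r n < update_time r (Suc n)"
    and "blue_time (update_time r (Suc n)) \<or> red_time r (update_time r (Suc n))"
    and "\<And>t. update_time r n < t \<Longrightarrow> blue_time t \<or> red_time r t \<Longrightarrow> update_time r (Suc n) \<le> t"
proof -
  let ?s = "update_time r n"
  let ?T = "{t. ?s < t \<and> (blue_time t \<or> red_time r t)}"
  obtain N :: nat where N: "?s < real N" "N \<ge> 1"
    by (metis One_nat_def Suc_leI lessI less_trans not_less_eq of_nat_less_iff reals_Archimedean2
        zero_less_Suc gr0I not_less0 less_Suc_eq)
  obtain K :: nat where K: "real N < real K * r"
    using assms reals_Archimedean3 by blast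
  let ?F = "?T \<inter> {..real N}"
  have "?F \<subseteq> real ` {..N} \<union> (\<lambda>k. real k * r) ` {..K}"
  proof
    fix t assume t: "t \<in> ?F"
    then consider k :: nat where "t = real k" | k :: nat where "t = real k * r"
      by (auto simp: blue_time_def red_time_def)
    then show "t \<in> real ` {..N} \<union> (\<lambda>k. real k * r) ` {..K}"
    proof cases
      case 1
      then show ?thesis using t by auto
    next
      case 2
      then have "real k * r < real K * r" using t K by auto
      then have "k \<le> K" using assms by simp
      then show ?thesis using 2 by auto
    qed
  qed
  then have fin: "finite ?F" by (rule finite_subset) auto
  have NF: "real N \<in> ?F" using N by (auto simp: blue_time_def)
  define m where "m = Min ?F"
  have mF: "m \<in> ?F" unfolding m_def using fin NF by (intro Min_in) auto
  have least: "m \<le> t" if "t \<in> ?T" for t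
  proof (cases "t \<le> real N")
    case True
    then show ?thesis unfolding m_def using that fin by (intro Min_le) auto
  next
    case False
    then show ?thesis using mF by auto
  qed
  have "Inf ?T = m" using mF least by (intro cInf_eq_minimum) auto
  then have eq: "update_time r (Suc n) = m" by simp
  show "update_time r n < update_time r (Suc n)"
    and "blue_time (update_time r (Suc n)) \<or> red_time r (update_time r (Suc n))"
    using mF unfolding eq by auto
  show "update_time r (Suc n) \<le> t"
    if "update_time r n < t" "blue_time t \<or> red_time r t" for t
    using least that unfolding eq by auto
qed

text \<open>
  One update at time \<open>t\<close>, from the configuration \<open>\<xi>\<close> just before \<open>t\<close>. Since a vertex changes its
  state at most once, it uses at most one coin flip, so one fair coin per vertex suffices; the
  coin value \<open>True\<close> resolves a tie in favour of blue.
\<close>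
definition update ::
  "vertex set \<Rightarrow> vertex set \<Rightarrow> real \<Rightarrow> (vertex \<Rightarrow> bool) \<Rightarrow> real \<Rightarrow> (vertex \<Rightarrow> color) \<Rightarrow> vertex \<Rightarrow> color"
where
  "update B R r coin t \<xi> x =
    (if \<xi> x \<noteq> Empty then \<xi> x
     else
       let to_blue = (blue_time t \<and> (\<exists>b\<in>B. \<xi> (x + b) = Blue));
           to_red = (red_time r t \<and> (\<exists>b\<in>R. \<xi> (x + b) = Red))
       in if to_blue \<and> to_red then (if coin x then Blue else Red)
          else if to_blue then Blue
          else if to_red then Red
          else Empty)"

text \<open>
  A sample point assigns to each vertex its initial state and its coin;
  \<open>state B R r \<omega> n\<close> is the configuration right after the updates at time \<open>update_time r n\<close>.
\<close>
primrec state ::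
  "vertex set \<Rightarrow> vertex set \<Rightarrow> real \<Rightarrow> (vertex \<Rightarrow> color \<times> bool) \<Rightarrow> nat \<Rightarrow> vertex \<Rightarrow> color"
where
  "state B R r \<omega> 0 = (\<lambda>x. fst (\<omega> x))"
| "state B R r \<omega> (Suc n) =
     update B R r (\<lambda>x. snd (\<omega> x)) (update_time r (Suc n)) (state B R r \<omega> n)"

definition has_final_state ::
  "vertex set \<Rightarrow> vertex set \<Rightarrow> real \<Rightarrow> (vertex \<Rightarrow> color \<times> bool) \<Rightarrow> vertex \<Rightarrow> color \<Rightarrow> bool"
where
  "has_final_state B R r \<omega> x c \<longleftrightarrow> (\<forall>\<^sub>F n in sequentially. state B R r \<omega> n x = c)"

lemma state_stable:
  assumes "state B R r \<omega> m x \<noteq> Empty" "m \<le> n"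
  shows "state B R r \<omega> n x = state B R r \<omega> m x"
  using assms(2) by (induction n rule: dec_induct) (simp_all add: update_def assms(1))

lemma ex1_final_state: "\<exists>!c. has_final_state B R r \<omega> x c"
proof -
  have ex: "\<exists>c. has_final_state B R r \<omega> x c"
  proof (cases "\<exists>m. state B R r \<omega> m x \<noteq> Empty")
    case True
    then obtain m where m: "state B R r \<omega> m x \<noteq> Empty" by blast
    have "has_final_state B R r \<omega> x (state B R r \<omega> m x)"
      unfolding has_final_state_def eventually_sequentially
      by (intro exI[of _ m] allI impI state_stable[OF m])
    then show ?thesis ..
  next
    case False
    then have "has_final_state B R r \<omega> x Empty"
      by (simp add: has_final_state_def)
    then show ?thesis ..
  qed
  moreover have "c = d" if "has_final_state B R r \<omega> x c" "has_final_state B R r \<omega> x d" for c d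
    using that unfolding has_final_state_def eventually_sequentially by (metis nat_le_linear)
  ultimately show ?thesis by blast
qed

lemma has_final_state_Empty_iff:
  "has_final_state B R r \<omega> x Empty \<longleftrightarrow> (\<forall>n. state B R r \<omega> n x = Empty)"
  unfolding has_final_state_def eventually_sequentially
  by (metis nat_le_linear state_stable)

lemma has_final_state_colored_iff:
  assumes "c \<noteq> Empty"
  shows "has_final_state B R r \<omega> x c \<longleftrightarrow> (\<exists>n. state B R r \<omega> n x = c)"
  unfolding has_final_state_def eventually_sequentially
  using assms by (metis order_refl state_stable)

text \<open>Meaningful only for \<open>p, q \<ge> 0\<close> with \<open>p + q \<le> 1\<close>.\<close>
definition initial_pmf :: "real \<Rightarrow> real \<Rightarrow> color pmf" where
  "initial_pmf p q =
    embed_pmf (\<lambda>c. case c of Blue \<Rightarrow> p | Red \<Rightarrow> q | Empty \<Rightarrow> 1 - p - q)"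

lemma pmf_initial_pmf:
  assumes "p \<ge> 0" "q \<ge> 0" "p + q \<le> 1"
  shows "pmf (initial_pmf p q) Blue = p"
    and "pmf (initial_pmf p q) Red = q"
    and "pmf (initial_pmf p q) Empty = 1 - p - q"
proof -
  let ?f = "\<lambda>c. case c of Blue \<Rightarrow> p | Red \<Rightarrow> q | Empty \<Rightarrow> 1 - p - q"
  have U: "(UNIV :: color set) = {Empty, Blue, Red}"
    using color.exhaust by auto
  have nn: "\<And>c. 0 \<le> ?f c" using assms by (auto split: color.split)
  have "(\<integral>\<^sup>+c. ennreal (?f c) \<partial>count_space UNIV) = (\<Sum>c\<in>UNIV. ennreal (?f c))"
    by (rule nn_integral_count_space_finite) (simp add: U)
  also have "\<dots> = ennreal (\<Sum>c\<in>UNIV. ?f c)" using nn by (intro sum_ennreal) auto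
  also have "\<dots> = 1" by (simp add: U)
  finally have "pmf (initial_pmf p q) c = ?f c" for c
    unfolding initial_pmf_def using nn by (intro pmf_embed_pmf) auto
  then show "pmf (initial_pmf p q) Blue = p" "pmf (initial_pmf p q) Red = q"
    "pmf (initial_pmf p q) Empty = 1 - p - q" by auto
qed

definition sample_space :: "real \<Rightarrow> real \<Rightarrow> (vertex \<Rightarrow> color \<times> bool) measure" where
  "sample_space p q =
    (\<Pi>\<^sub>M x\<in>UNIV. measure_pmf (pair_pmf (initial_pmf p q) (bernoulli_pmf (1/2))))"

definition final_state_prob ::
  "vertex set \<Rightarrow> vertex set \<Rightarrow> real \<Rightarrow> real \<Rightarrow> real \<Rightarrow> color \<Rightarrow> real"
where
  "final_state_prob B R r p q c =
    \<P>(\<omega> in sample_space p q. has_final_state B R r \<omega> (0, 0) c)"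

end

theory Submission
  imports Defs "HOL-Real_Asymp.Real_Asymp"
begin

text \<open>
  Let \<open>p\<close> be the density of blue and \<open>d = p powr (- \<rho> / (\<rho> + 1))\<close>. By time \<open>t\<close> a vertex is blue with
  probability of order \<open>p t\<close>, so a red column of length \<open>t\<close>, which needs time of order \<open>t\<close> to grow, meets
  \<open>\<rho>\<close> consecutive blue vertices with probability of order \<open>t (p t) ^ \<rho>\<close>: red typically spreads
  over the distance \<open>d\<close>. Hence \<open>\<tau>\<close> consecutive vertices of a row all become red with
  probability of order \<open>(q d) ^ \<tau>\<close>, while the nearest blue vertex in the row of the origin is at
  distance of order \<open>1 / p\<close>. It is stopped by such a red barrier before it reaches the origin if
  \<open>(q d) ^ \<tau> / p\<close> is large, and not if it is small; that ratio is \<open>(q / p powr \<gamma>) ^ \<tau>\<close>.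
  Exchanging the colours, the axes and the time scale gives the corresponding statements for red.

  For the upper bound on red barriers, the rows are cut into independent slabs of height of order
  \<open>d\<close>; in each of them blue blocks the columns with probability bounded below, so the distance that
  red covers has a geometric tail on the scale \<open>d\<close>. For the lower bound, a barrier is chosen
  as a function of the initially red vertices only, and the blue vertices near it remain conditionally
  independent.
\<close>

section \<open>Events determined by finitely many coordinates of an i.i.d. family\<close>

text \<open>Whether a vertex is ever red depends on all initial states and on the whole history of
  both colours. The proof never follows that history. Each colour travels at bounded speed along one
  axis, so up to a given time it is excluded by the initial states on a bounded segment; and a
  vertex within reach of a coloured one cannot stay empty, so where one colour is excluded the other
  has to come. Both barrier bounds thus concern the initial configuration only. In the upper bound,
  the probabilities that slabs fail and that the columns of a barrier contain red must multiply.
  Therefore the slabs use only columns on one side of the barrier. Failure of a single slab need not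
  be unlikely: a bound below 1 is enough, because slabs at growing distance are independent. In the
  lower bound, columns of height \<open>\<epsilon> d\<close> are used instead of \<open>d\<close>.
  This costs a constant factor in the probability of a barrier, but the probability that blue cuts
  the chosen barrier becomes of order \<open>\<epsilon>\<close>.\<close>

definition determined_by :: "'i set \<Rightarrow> (('i \<Rightarrow> 'a) \<Rightarrow> bool) \<Rightarrow> bool" where
  "determined_by I P \<longleftrightarrow> (\<forall>\<omega> \<omega>'. (\<forall>i\<in>I. \<omega> i = \<omega>' i) \<longrightarrow> P \<omega> = P \<omega>')"

lemma determined_byI:
  "(\<And>\<omega> \<omega>'. (\<And>i. i \<in> I \<Longrightarrow> \<omega> i = \<omega>' i) \<Longrightarrow> P \<omega> \<Longrightarrow> P \<omega>') \<Longrightarrow> determined_by I P"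
  unfolding determined_by_def by metis

lemma determined_byD:
  "determined_by I P \<Longrightarrow> (\<And>i. i \<in> I \<Longrightarrow> \<omega> i = \<omega>' i) \<Longrightarrow> P \<omega> = P \<omega>'"
  unfolding determined_by_def by metis

lemma determined_by_mono:
  "determined_by I P \<Longrightarrow> I \<subseteq> J \<Longrightarrow> determined_by J P"
  unfolding determined_by_def by blast

lemma determined_by_coord: "i \<in> I \<Longrightarrow> determined_by I (\<lambda>\<omega>. Q (\<omega> i))"
  unfolding determined_by_def by metis

lemma determined_by_Not: "determined_by I P \<Longrightarrow> determined_by I (\<lambda>\<omega>. \<not> P \<omega>)"
  unfolding determined_by_def by metis

lemma determined_by_conj:
  "determined_by I P \<Longrightarrow> determined_by I Q \<Longrightarrow> determined_by I (\<lambda>\<omega>. P \<omega> \<and> Q \<omega>)"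
  unfolding determined_by_def by metis

lemma determined_by_disj:
  "determined_by I P \<Longrightarrow> determined_by I Q \<Longrightarrow> determined_by I (\<lambda>\<omega>. P \<omega> \<or> Q \<omega>)"
  unfolding determined_by_def by metis

lemma determined_by_ball:
  "(\<And>k. k \<in> K \<Longrightarrow> determined_by I (P k)) \<Longrightarrow> determined_by I (\<lambda>\<omega>. \<forall>k\<in>K. P k \<omega>)"
  unfolding determined_by_def by metis

lemma determined_by_bex:
  "(\<And>k. k \<in> K \<Longrightarrow> determined_by I (P k)) \<Longrightarrow> determined_by I (\<lambda>\<omega>. \<exists>k\<in>K. P k \<omega>)"
  unfolding determined_by_def by metis

text \<open>\<open>idx\<close> pins down the index type, which \<open>Q\<close> alone leaves
  open.\<close>

locale iid_product =
  fixes Q :: "'a :: countable pmf" and idx :: "'i itself"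
begin

abbreviation iid :: "('i \<Rightarrow> 'a) measure" where
  "iid \<equiv> \<Pi>\<^sub>M i\<in>UNIV. measure_pmf Q"

sublocale product_prob_space "\<lambda>_ :: 'i. measure_pmf Q" UNIV
  by unfold_locales

lemma space_iid [simp]: "space iid = UNIV"
  by (auto simp: space_PiM)

text \<open>Countability of \<open>'a\<close> enters here: a finite product of countable discrete
  spaces is discrete. Hence an event read off finitely many coordinates is measurable as soon as the
  coordinates are exhibited.\<close>

lemma sets_PiM_finite:
  fixes I :: "'i set" assumes "finite I"
  shows "sets (\<Pi>\<^sub>M i\<in>I. measure_pmf Q) = Pow (PiE I (\<lambda>_. UNIV))"
proof -
  have "sets (\<Pi>\<^sub>M i\<in>I. measure_pmf Q) = sets (\<Pi>\<^sub>M i\<in>I. count_space (UNIV :: 'a set))"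
    by (rule sets_PiM_cong) auto
  also have "(\<Pi>\<^sub>M i\<in>I. count_space (UNIV :: 'a set)) = count_space (PiE I (\<lambda>_. UNIV))"
    using assms by (intro count_space_PiM_finite) auto
  finally show ?thesis by simp
qed

lemma restrict_vimage_determined:
  assumes "determined_by I P"
  shows "{\<omega>. P \<omega>} = (\<lambda>\<omega>. restrict \<omega> I) -` ((\<lambda>\<omega>. restrict \<omega> I) ` {\<omega>. P \<omega>}) \<inter> UNIV"
proof -
  have "P \<omega>" if "P \<omega>'" "restrict \<omega> I = restrict \<omega>' I" for \<omega> \<omega>'
    using assms that determined_byD[OF assms, of \<omega> \<omega>'] by (metis restrict_apply')
  then show ?thesis by auto
qed

lemma determined_sets:
  assumes "finite I" "determined_by I P"
  shows "{\<omega>. P \<omega>} \<in> sets iid"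
proof -
  have "(\<lambda>\<omega>. restrict \<omega> I) \<in> measurable iid (\<Pi>\<^sub>M i\<in>I. measure_pmf Q)"
    by (rule measurable_restrict_subset) auto
  then have "(\<lambda>\<omega>. restrict \<omega> I) -` ((\<lambda>\<omega>. restrict \<omega> I) ` {\<omega>. P \<omega>}) \<inter> space iid \<in> sets iid"
    by (rule measurable_sets) (auto simp: sets_PiM_finite[OF assms(1)])
  then show ?thesis unfolding space_iid restrict_vimage_determined[OF assms(2), symmetric] .
qed

lemma indep_coordinates: "P.indep_vars (\<lambda>_. measure_pmf Q) (\<lambda>i \<omega>. \<omega> i) (UNIV :: 'i set)"
proof -
  have "(\<lambda>\<omega>. \<omega> i) \<in> iid \<rightarrow>\<^sub>M measure_pmf Q" for i :: 'i
    by (rule measurable_component_singleton) auto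
  moreover have "distr iid (measure_pmf Q) (\<lambda>\<omega>. \<omega> i) = measure_pmf Q" for i :: 'i
    by (rule distr_PiM_component) (auto intro: prob_space_measure_pmf)
  moreover have "distr iid (Pi\<^sub>M UNIV (\<lambda>_. measure_pmf Q)) (\<lambda>x. \<lambda>i\<in>UNIV. x i) = iid"
    unfolding restrict_UNIV by (rule distr_id2) simp
  ultimately show ?thesis
    by (subst P.indep_vars_iff_distr_eq_PiM) auto
qed

lemma prob_coord: "P.prob {\<omega>. \<omega> i \<in> S} = measure_pmf.prob Q S"
proof -
  have "measure iid (prod_emb UNIV (\<lambda>_. measure_pmf Q) {i} (PiE {i} (\<lambda>_. S))) = measure_pmf.prob Q S"
    by (subst measure_PiM_emb) auto
  moreover have "prod_emb UNIV (\<lambda>_. measure_pmf Q) {i} (PiE {i} (\<lambda>_. S)) = {\<omega>. \<omega> i \<in> S}"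
    by (auto simp: prod_emb_def space_PiM)
  ultimately show ?thesis by simp
qed

text \<open>The restrictions of \<open>\<omega>\<close> to the disjoint sets \<open>I k\<close> are
  independent, and each event is a preimage under its own restriction.\<close>

lemma prob_Ball_determined:
  assumes "finite K" "\<And>k. k \<in> K \<Longrightarrow> finite (I k)" "disjoint_family_on I K"
    and "\<And>k. k \<in> K \<Longrightarrow> determined_by (I k) (E k)"
  shows "P.prob {\<omega>. \<forall>k\<in>K. E k \<omega>} = (\<Prod>k\<in>K. P.prob {\<omega>. E k \<omega>})"
proof (cases "K = {}")
  case True
  then show ?thesis using P.prob_space by simp
next
  case False
  have "P.indep_vars (\<lambda>k. \<Pi>\<^sub>M i\<in>I k. measure_pmf Q) (\<lambda>k \<omega>. restrict \<omega> (I k)) K"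
    using P.indep_vars_restrict[OF indep_coordinates _ assms(3)] by simp
  then have "P.indep_sets (\<lambda>k. {(\<lambda>\<omega>. restrict \<omega> (I k)) -` A \<inter> space iid | A.
       A \<in> sets (\<Pi>\<^sub>M i\<in>I k. measure_pmf Q)}) K"
    unfolding P.indep_vars_def2 by auto
  moreover have "{\<omega>. E k \<omega>} \<in> {(\<lambda>\<omega>. restrict \<omega> (I k)) -` A \<inter> space iid | A.
       A \<in> sets (\<Pi>\<^sub>M i\<in>I k. measure_pmf Q)}" if "k \<in> K" for k
    unfolding sets_PiM_finite[OF assms(2)[OF that]] mem_Collect_eq space_iid
    by (intro exI[of _ "(\<lambda>\<omega>. restrict \<omega> (I k)) ` {\<omega>. E k \<omega>}"] conjI
          restrict_vimage_determined[OF assms(4)[OF that]]) auto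
  ultimately have "P.prob (\<Inter>k\<in>K. {\<omega>. E k \<omega>}) = (\<Prod>k\<in>K. P.prob {\<omega>. E k \<omega>})"
    using assms(1) False by (intro P.indep_setsD) auto
  moreover have "(\<Inter>k\<in>K. {\<omega>. E k \<omega>}) = {\<omega>. \<forall>k\<in>K. E k \<omega>}" by auto
  ultimately show ?thesis by simp
qed

lemma prob_conj_determined:
  assumes "finite I" "finite J" "I \<inter> J = {}" "determined_by I E" "determined_by J F"
  shows "P.prob {\<omega>. E \<omega> \<and> F \<omega>} = P.prob {\<omega>. E \<omega>} * P.prob {\<omega>. F \<omega>}"
proof -
  have "P.prob {\<omega>. \<forall>b\<in>UNIV. (if b then E else F) \<omega>} =
    (\<Prod>b\<in>UNIV. P.prob {\<omega>. (if b then E else F) \<omega>})"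
    by (rule prob_Ball_determined[where I = "\<lambda>b. if b then I else J"])
      (use assms in \<open>auto simp: disjoint_family_on_def\<close>)
  moreover have "{\<omega>. \<forall>b\<in>UNIV. (if b then E else F) \<omega>} = {\<omega>. E \<omega> \<and> F \<omega>}"
    by (auto split: if_splits)
  ultimately show ?thesis by (simp add: UNIV_bool mult.commute)
qed

lemma prob_Not_determined:
  assumes "finite I" "determined_by I E"
  shows "P.prob {\<omega>. \<not> E \<omega>} = 1 - P.prob {\<omega>. E \<omega>}"
proof -
  have "{\<omega>. \<not> E \<omega>} = space iid - {\<omega>. E \<omega>}" by auto
  then show ?thesis using P.prob_compl[OF determined_sets[OF assms]] by simp
qed

lemma prob_coord_Ball:
  assumes "finite V"
  shows "P.prob {\<omega>. \<forall>v\<in>V. \<omega> v \<in> S} = measure_pmf.prob Q S ^ card V"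
proof -
  have "P.prob {\<omega>. \<forall>v\<in>V. \<omega> v \<in> S} = (\<Prod>v\<in>V. P.prob {\<omega>. \<omega> v \<in> S})"
    by (rule prob_Ball_determined[where I = "\<lambda>v. {v}"])
      (use assms in \<open>auto simp: disjoint_family_on_def determined_by_def\<close>)
  then show ?thesis by (simp add: prob_coord)
qed

lemma prob_le_determined:
  assumes "finite I" "determined_by I F" "\<And>\<omega>. E \<omega> \<Longrightarrow> F \<omega>"
  shows "P.prob {\<omega>. E \<omega>} \<le> P.prob {\<omega>. F \<omega>}"
  using assms by (intro P.finite_measure_mono determined_sets[OF assms(1,2)]) auto

lemma prob_Bex_le:
  assumes "finite K" "\<And>k. k \<in> K \<Longrightarrow> {\<omega>. E k \<omega>} \<in> P.events"
  shows "P.prob {\<omega>. \<exists>k\<in>K. E k \<omega>} \<le> (\<Sum>k\<in>K. P.prob {\<omega>. E k \<omega>})"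
proof -
  have "{\<omega>. \<exists>k\<in>K. E k \<omega>} = (\<Union>k\<in>K. {\<omega>. E k \<omega>})" by auto
  then show ?thesis
    using P.finite_measure_subadditive_finite[OF assms(1), of "\<lambda>k. {\<omega>. E k \<omega>}"] assms(2) by auto
qed

lemma prob_Bex_le_card:
  fixes b :: real
  assumes "finite K" "\<And>k. k \<in> K \<Longrightarrow> {\<omega>. E k \<omega>} \<in> P.events" "\<And>k. k \<in> K \<Longrightarrow> P.prob {\<omega>. E k \<omega>} \<le> b"
  shows "P.prob {\<omega>. \<exists>k\<in>K. E k \<omega>} \<le> card K * b"
proof -
  have "P.prob {\<omega>. \<exists>k\<in>K. E k \<omega>} \<le> (\<Sum>k\<in>K. P.prob {\<omega>. E k \<omega>})"
    using assms by (intro prob_Bex_le)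
  also have "\<dots> \<le> (\<Sum>k\<in>K. b)"
    using assms by (intro sum_mono)
  finally show ?thesis by simp
qed

lemma prob_disj_le:
  assumes "{\<omega>. E \<omega>} \<in> P.events" "{\<omega>. F \<omega>} \<in> P.events"
  shows "P.prob {\<omega>. E \<omega> \<or> F \<omega>} \<le> P.prob {\<omega>. E \<omega>} + P.prob {\<omega>. F \<omega>}"
  using measure_Un_le[OF assms] by (simp add: Collect_disj_eq)

end

section \<open>Spread of the two colours\<close>

text \<open>The infimum stays folded: update times are accessed through
  \<open>update_time_Suc\<close>.\<close>

declare update_time.simps(2) [simp del]

locale competition =
  fixes \<rho> \<tau> :: nat and r :: real
  assumes rho_pos: "\<rho> \<ge> 1" and tau_pos: "\<tau> \<ge> 1" and r_pos: "r > 0"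
begin

definition red_nbhd :: "vertex set" where "red_nbhd = {0} \<times> {- int \<rho>..int \<rho>}"
definition blue_nbhd :: "vertex set" where "blue_nbhd = {- int \<tau>..int \<tau>} \<times> {0}"

abbreviation st :: "(vertex \<Rightarrow> color \<times> bool) \<Rightarrow> nat \<Rightarrow> vertex \<Rightarrow> color" where
  "st \<equiv> state blue_nbhd red_nbhd r"

abbreviation init :: "(vertex \<Rightarrow> color \<times> bool) \<Rightarrow> vertex \<Rightarrow> color" where
  "init \<omega> v \<equiv> fst (\<omega> v)"

abbreviation ut :: "nat \<Rightarrow> real" where "ut \<equiv> update_time r"

definition ever :: "(vertex \<Rightarrow> color \<times> bool) \<Rightarrow> color \<Rightarrow> vertex \<Rightarrow> bool" where
  "ever \<omega> c v \<longleftrightarrow> (\<exists>n. st \<omega> n v = c)"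

text \<open>Distances are controlled by real time; the step number mixes two clocks that need not be
  commensurable.\<close>

definition by_time :: "(vertex \<Rightarrow> color \<times> bool) \<Rightarrow> real \<Rightarrow> color \<Rightarrow> vertex \<Rightarrow> bool" where
  "by_time \<omega> t c v \<longleftrightarrow> (\<exists>n. ut n \<le> t \<and> st \<omega> n v = c)"

lemma ut_mono: "strict_mono ut"
  by (rule strict_monoI_Suc) (rule update_time_Suc(1)[OF r_pos])

lemma ut_nonneg: "0 \<le> ut n"
  using strict_mono_less_eq[OF ut_mono, of 0 n] by simp

text \<open>Only finitely many update times precede \<open>t\<close>, so the strictly increasing
  sequence \<open>ut\<close> cannot stay below \<open>t\<close>. The first \<open>ut n\<close> that
  is at least \<open>t\<close> cannot exceed it, because \<open>t\<close> itself was a candidate for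
  the next update time.\<close>

lemma ut_hits:
  assumes "blue_time t \<or> red_time r t"
  shows "\<exists>n. ut (Suc n) = t"
proof -
  \<comment> \<open>\<open>0\<close> is added because \<open>ut 0 = 0\<close> is not an update
    time.\<close>
  let ?E = "{s. s < t \<and> (s = 0 \<or> blue_time s \<or> red_time r s)}"
  obtain N :: nat where N: "t < real N" using reals_Archimedean2 by blast
  obtain K :: nat where K: "t < real K * r" using r_pos reals_Archimedean3 by blast
  have "?E \<subseteq> insert 0 (real ` {..N} \<union> (\<lambda>k. real k * r) ` {..K})"
  proof
    fix s assume s: "s \<in> ?E"
    then consider "s = 0" | k :: nat where "s = real k" | k :: nat where "s = real k * r"
      by (auto simp: blue_time_def red_time_def)
    then show "s \<in> insert 0 (real ` {..N} \<union> (\<lambda>k. real k * r) ` {..K})"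
    proof cases
      case (3 k)
      then have "real k * r < real K * r" using s K by auto
      then have "k \<le> K" using r_pos by simp
      then show ?thesis using 3 by auto
    qed (use s N in auto)
  qed
  then have fin: "finite ?E" by (rule finite_subset) auto
  have "\<exists>n. t \<le> ut n"
  proof (rule ccontr)
    assume "\<nexists>n. t \<le> ut n"
    then have lt: "ut n < t" for n by (auto simp: not_le)
    have "ut n \<in> ?E" for n
      using update_time_Suc(2)[OF r_pos, of "n - 1"] lt[of n] by (cases "n = 0") auto
    then have "range ut \<subseteq> ?E" by blast
    then show False
      using fin strict_mono_imp_inj_on[OF ut_mono] finite_subset range_inj_infinite by blast
  qed
  define n where "n = (LEAST n. t \<le> ut n)"
  have le: "t \<le> ut n" unfolding n_def using \<open>\<exists>n. t \<le> ut n\<close> by (rule LeastI_ex)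
  have "t > 0" using assms r_pos by (auto simp: blue_time_def red_time_def)
  then obtain m where m: "n = Suc m" using le by (cases n) auto
  then have "ut m < t" using not_less_Least[of m "\<lambda>n. t \<le> ut n"] unfolding n_def by auto
  then have "ut (Suc m) \<le> t" using update_time_Suc(3)[OF r_pos] assms by blast
  then show ?thesis using le m by (intro exI[of _ m]) auto
qed

lemma st_persists: "st \<omega> m v = c \<Longrightarrow> c \<noteq> Empty \<Longrightarrow> m \<le> n \<Longrightarrow> st \<omega> n v = c"
  using state_stable by metis

lemma st_Suc_Blue:
  assumes "st \<omega> (Suc n) (x, y) = Blue" "st \<omega> n (x, y) \<noteq> Blue"
  shows "blue_time (ut (Suc n))" "\<exists>d. \<bar>d\<bar> \<le> int \<tau> \<and> st \<omega> n (x + d, y) = Blue"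
proof -
  have *: "blue_time (ut (Suc n)) \<and> (\<exists>b\<in>blue_nbhd. st \<omega> n ((x, y) + b) = Blue)"
    using assms by (auto simp: update_def Let_def split: if_splits)
  then show "blue_time (ut (Suc n))" by blast
  obtain b where "b \<in> blue_nbhd" "st \<omega> n ((x, y) + b) = Blue" using * by blast
  then show "\<exists>d. \<bar>d\<bar> \<le> int \<tau> \<and> st \<omega> n (x + d, y) = Blue"
    unfolding blue_nbhd_def by (intro exI[of _ "fst b"]) auto
qed

lemma st_Suc_Red:
  assumes "st \<omega> (Suc n) (x, y) = Red" "st \<omega> n (x, y) \<noteq> Red"
  shows "red_time r (ut (Suc n))" "\<exists>d. \<bar>d\<bar> \<le> int \<rho> \<and> st \<omega> n (x, y + d) = Red"
proof -
  have *: "red_time r (ut (Suc n)) \<and> (\<exists>b\<in>red_nbhd. st \<omega> n ((x, y) + b) = Red)"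
    using assms by (auto simp: update_def Let_def split: if_splits)
  then show "red_time r (ut (Suc n))" by blast
  obtain b where "b \<in> red_nbhd" "st \<omega> n ((x, y) + b) = Red" using * by blast
  then show "\<exists>d. \<bar>d\<bar> \<le> int \<rho> \<and> st \<omega> n (x, y + d) = Red"
    unfolding red_nbhd_def by (intro exI[of _ "snd b"]) auto
qed

text \<open>\<open>\<lfloor>ut n\<rfloor>\<close> counts the blue updates up to step
  \<open>n\<close>; each of them moves blue by at most \<open>\<tau>\<close> along its row, and red
  updates create no blue.\<close>

lemma blue_speed:
  "st \<omega> n (x, y) = Blue \<Longrightarrow> \<exists>d. \<bar>d\<bar> \<le> int \<tau> * \<lfloor>ut n\<rfloor> \<and> init \<omega> (x + d, y) = Blue"
proof (induction n arbitrary: x)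
  case 0
  then show ?case by (intro exI[of _ 0]) auto
next
  case (Suc n)
  have le: "\<lfloor>ut n\<rfloor> \<le> \<lfloor>ut (Suc n)\<rfloor>"
    using update_time_Suc(1)[OF r_pos] by (intro floor_mono less_imp_le)
  show ?case
  proof (cases "st \<omega> n (x, y) = Blue")
    case True
    then obtain d where d: "\<bar>d\<bar> \<le> int \<tau> * \<lfloor>ut n\<rfloor>" "init \<omega> (x + d, y) = Blue"
      using Suc.IH by blast
    then have "\<bar>d\<bar> \<le> int \<tau> * \<lfloor>ut (Suc n)\<rfloor>"
      using mult_left_mono[OF le, of "int \<tau>"] by linarith
    then show ?thesis using d by blast
  next
    case False
    obtain d where d: "\<bar>d\<bar> \<le> int \<tau>" "st \<omega> n (x + d, y) = Blue"
      using st_Suc_Blue(2)[OF Suc.prems False] by blast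
    obtain e where e: "\<bar>e\<bar> \<le> int \<tau> * \<lfloor>ut n\<rfloor>" "init \<omega> (x + d + e, y) = Blue"
      using Suc.IH d by blast
    obtain k :: nat where k: "ut (Suc n) = real k"
      using st_Suc_Blue(1)[OF Suc.prems False] unfolding blue_time_def by blast
    have "ut n < real k" using update_time_Suc(1)[OF r_pos, of n] k by simp
    then have "\<lfloor>ut n\<rfloor> < int k" by (simp add: floor_less_iff)
    then have "\<lfloor>ut n\<rfloor> + 1 \<le> \<lfloor>ut (Suc n)\<rfloor>" unfolding k by simp
    then have "int \<tau> * (\<lfloor>ut n\<rfloor> + 1) \<le> int \<tau> * \<lfloor>ut (Suc n)\<rfloor>"
      by (intro mult_left_mono) auto
    then have "\<bar>d + e\<bar> \<le> int \<tau> * \<lfloor>ut (Suc n)\<rfloor>"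
      using d e by (simp add: algebra_simps)
    then show ?thesis using e by (intro exI[of _ "d + e"]) (simp add: add.assoc)
  qed
qed

lemma red_speed:
  "st \<omega> n (x, y) = Red \<Longrightarrow> \<exists>d. \<bar>d\<bar> \<le> int \<rho> * \<lfloor>ut n / r\<rfloor> \<and> init \<omega> (x, y + d) = Red"
proof (induction n arbitrary: y)
  case 0
  then show ?case by (intro exI[of _ 0]) auto
next
  case (Suc n)
  have le: "\<lfloor>ut n / r\<rfloor> \<le> \<lfloor>ut (Suc n) / r\<rfloor>"
    using update_time_Suc(1)[OF r_pos] r_pos by (intro floor_mono divide_right_mono less_imp_le)
  show ?case
  proof (cases "st \<omega> n (x, y) = Red")
    case True
    then obtain d where d: "\<bar>d\<bar> \<le> int \<rho> * \<lfloor>ut n / r\<rfloor>" "init \<omega> (x, y + d) = Red"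
      using Suc.IH by blast
    then have "\<bar>d\<bar> \<le> int \<rho> * \<lfloor>ut (Suc n) / r\<rfloor>"
      using mult_left_mono[OF le, of "int \<rho>"] by linarith
    then show ?thesis using d by blast
  next
    case False
    obtain d where d: "\<bar>d\<bar> \<le> int \<rho>" "st \<omega> n (x, y + d) = Red"
      using st_Suc_Red(2)[OF Suc.prems False] by blast
    obtain e where e: "\<bar>e\<bar> \<le> int \<rho> * \<lfloor>ut n / r\<rfloor>" "init \<omega> (x, y + d + e) = Red"
      using Suc.IH d by blast
    obtain k :: nat where k: "ut (Suc n) = real k * r"
      using st_Suc_Red(1)[OF Suc.prems False] unfolding red_time_def by blast
    have "ut n < real k * r" using update_time_Suc(1)[OF r_pos, of n] k by simp
    then have "ut n / r < real k" using r_pos by (simp add: field_simps)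
    then have "\<lfloor>ut n / r\<rfloor> < int k" by (simp add: floor_less_iff)
    then have "\<lfloor>ut n / r\<rfloor> + 1 \<le> \<lfloor>ut (Suc n) / r\<rfloor>" unfolding k using r_pos by simp
    then have "int \<rho> * (\<lfloor>ut n / r\<rfloor> + 1) \<le> int \<rho> * \<lfloor>ut (Suc n) / r\<rfloor>"
      by (intro mult_left_mono) auto
    then have "\<bar>d + e\<bar> \<le> int \<rho> * \<lfloor>ut (Suc n) / r\<rfloor>"
      using d e by (simp add: algebra_simps)
    then show ?thesis using e by (intro exI[of _ "d + e"]) (simp add: add.assoc)
  qed
qed

text \<open>At time \<open>k\<close> a vertex within reach of blue cannot remain empty, but an
  earlier arrival or a lost tie may have made it red. Each use has to exclude red, either up to time
  \<open>k\<close> by the speed bound or for all times.\<close>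

lemma blue_growth:
  assumes "by_time \<omega> t Blue (x', y)" "\<bar>x' - x\<bar> \<le> int \<tau>" "t < real k"
  shows "by_time \<omega> (real k) Blue (x, y) \<or> by_time \<omega> (real k) Red (x, y)"
proof -
  obtain m where m: "ut m \<le> t" "st \<omega> m (x', y) = Blue" using assms(1) by (auto simp: by_time_def)
  have "real k > 0" using m ut_nonneg[of m] assms(3) by linarith
  then have "blue_time (real k)" by (auto simp: blue_time_def)
  then obtain n where n: "ut (Suc n) = real k" using ut_hits by blast
  have "m < Suc n"
    using m assms(3) n strict_mono_less[OF ut_mono, of m "Suc n"] by linarith
  then have "st \<omega> n (x', y) = Blue" using st_persists[OF m(2), of n] by simp
  then have "\<exists>b\<in>blue_nbhd. st \<omega> n ((x, y) + b) = Blue"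
    using assms(2) by (intro bexI[of _ "(x' - x, 0)"]) (auto simp: blue_nbhd_def)
  then have "st \<omega> (Suc n) (x, y) \<noteq> Empty"
    using \<open>blue_time (real k)\<close> n by (simp add: update_def Let_def)
  then have "st \<omega> (Suc n) (x, y) = Blue \<or> st \<omega> (Suc n) (x, y) = Red"
    by (cases "st \<omega> (Suc n) (x, y)") auto
  then show ?thesis unfolding by_time_def using n by (metis order_refl)
qed

lemma red_growth:
  assumes "by_time \<omega> t Red (x, y')" "\<bar>y' - y\<bar> \<le> int \<rho>" "t < real k * r"
  shows "by_time \<omega> (real k * r) Blue (x, y) \<or> by_time \<omega> (real k * r) Red (x, y)"
proof -
  obtain m where m: "ut m \<le> t" "st \<omega> m (x, y') = Red" using assms(1) by (auto simp: by_time_def)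
  have "real k * r > 0" using m ut_nonneg[of m] assms(3) by linarith
  then have "red_time r (real k * r)" by (auto simp: red_time_def zero_less_mult_iff intro!: exI[of _ k] Suc_leI)
  then obtain n where n: "ut (Suc n) = real k * r" using ut_hits by blast
  have "m < Suc n"
    using m assms(3) n strict_mono_less[OF ut_mono, of m "Suc n"] by linarith
  then have "st \<omega> n (x, y') = Red" using st_persists[OF m(2), of n] by simp
  then have "\<exists>b\<in>red_nbhd. st \<omega> n ((x, y) + b) = Red"
    using assms(2) by (intro bexI[of _ "(0, y' - y)"]) (auto simp: red_nbhd_def)
  then have "st \<omega> (Suc n) (x, y) \<noteq> Empty"
    using \<open>red_time r (real k * r)\<close> n by (simp add: update_def Let_def)
  then have "st \<omega> (Suc n) (x, y) = Blue \<or> st \<omega> (Suc n) (x, y) = Red"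
    by (cases "st \<omega> (Suc n) (x, y)") auto
  then show ?thesis unfolding by_time_def using n by (metis order_refl)
qed

lemma by_time_ever: "by_time \<omega> t c v \<Longrightarrow> ever \<omega> c v"
  by (auto simp: by_time_def ever_def)

lemma ever_by_time: "ever \<omega> c v \<Longrightarrow> \<exists>k. by_time \<omega> (real k) c v"
  unfolding by_time_def ever_def using real_arch_simple by blast

lemma by_time_mono: "by_time \<omega> s c v \<Longrightarrow> s \<le> t \<Longrightarrow> by_time \<omega> t c v"
  unfolding by_time_def using order.trans by blast

lemma by_time_init: "init \<omega> v = c \<Longrightarrow> 0 \<le> t \<Longrightarrow> by_time \<omega> t c v"
  unfolding by_time_def by (intro exI[of _ 0]) auto

lemma ever_unique: "ever \<omega> c v \<Longrightarrow> ever \<omega> d v \<Longrightarrow> c \<noteq> Empty \<Longrightarrow> d \<noteq> Empty \<Longrightarrow> c = d"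
  unfolding ever_def by (metis nat_le_linear st_persists)

lemma blue_speed_by_time:
  assumes "by_time \<omega> t Blue (x, y)"
  shows "\<exists>d. \<bar>d\<bar> \<le> int \<tau> * \<lfloor>t\<rfloor> \<and> init \<omega> (x + d, y) = Blue"
proof -
  obtain n where n: "ut n \<le> t" "st \<omega> n (x, y) = Blue" using assms by (auto simp: by_time_def)
  then obtain d where d: "\<bar>d\<bar> \<le> int \<tau> * \<lfloor>ut n\<rfloor>" "init \<omega> (x + d, y) = Blue"
    using blue_speed by blast
  have "int \<tau> * \<lfloor>ut n\<rfloor> \<le> int \<tau> * \<lfloor>t\<rfloor>" using n by (intro mult_left_mono floor_mono) auto
  then show ?thesis using d by (intro exI[of _ d]) auto
qed

lemma red_speed_by_time:
  assumes "by_time \<omega> t Red (x, y)"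
  shows "\<exists>d. \<bar>d\<bar> \<le> int \<rho> * \<lfloor>t / r\<rfloor> \<and> init \<omega> (x, y + d) = Red"
proof -
  obtain n where n: "ut n \<le> t" "st \<omega> n (x, y) = Red" using assms by (auto simp: by_time_def)
  then obtain d where d: "\<bar>d\<bar> \<le> int \<rho> * \<lfloor>ut n / r\<rfloor>" "init \<omega> (x, y + d) = Red"
    using red_speed by blast
  have "int \<rho> * \<lfloor>ut n / r\<rfloor> \<le> int \<rho> * \<lfloor>t / r\<rfloor>"
    using n r_pos by (intro mult_left_mono floor_mono divide_right_mono) auto
  then show ?thesis using d by (intro exI[of _ d]) auto
qed

end

section \<open>Blocking\<close>

context competition begin

definition red_in :: "(vertex \<Rightarrow> color \<times> bool) \<Rightarrow> int \<Rightarrow> int set \<Rightarrow> bool" where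
  "red_in \<omega> c Y \<longleftrightarrow> (\<exists>y\<in>Y. init \<omega> (c, y) = Red)"

definition blue_in :: "(vertex \<Rightarrow> color \<times> bool) \<Rightarrow> int set \<Rightarrow> int \<Rightarrow> bool" where
  "blue_in \<omega> X y \<longleftrightarrow> (\<exists>c\<in>X. init \<omega> (c, y) = Blue)"

text \<open>
  In a good slab, blue takes \<open>\<rho>\<close> consecutive rows of every red-free column among
  \<open>x + 1, \<dots>, x + \<tau>\<close> before red from outside the slab can enter its middle third. The event depends on
  columns up to \<open>x\<close> only, which makes it independent of the red vertices in those columns.
\<close>
definition good_slab :: "(vertex \<Rightarrow> color \<times> bool) \<Rightarrow> int \<Rightarrow> nat \<Rightarrow> nat \<Rightarrow> int \<Rightarrow> bool" where
  "good_slab \<omega> x w m a \<longleftrightarrow>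
     \<not> red_in \<omega> x {a..<a + 3 * int m} \<and>
     (\<forall>s\<in>{x - int w..x - int \<tau>}. \<exists>i\<in>{1..int \<tau>}. \<not> red_in \<omega> (s + i) {a..<a + 3 * int m}) \<and>
     (\<exists>b\<in>{a + int m..a + 2 * int m - int \<rho>}. \<forall>j\<in>{0..<int \<rho>}. blue_in \<omega> {x - int w..x} (b + j))"

text \<open>A row of the middle third is at distance at least \<open>m\<close> from the outside of
  the slab, so red arriving in time must have started inside the slab.\<close>

lemma not_red_by_time:
  assumes "\<not> red_in \<omega> c {a..<a + 3 * int m}" "y \<in> {a + int m..<a + 2 * int m}"
    and "int \<rho> * \<lfloor>t / r\<rfloor> \<le> int m"
  shows "\<not> by_time \<omega> t Red (c, y)"
proof
  assume "by_time \<omega> t Red (c, y)"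
  then obtain d where "\<bar>d\<bar> \<le> int \<rho> * \<lfloor>t / r\<rfloor>" "init \<omega> (c, y + d) = Red"
    using red_speed_by_time by blast
  moreover from this have "y + d \<in> {a..<a + 3 * int m}" using assms by auto
  ultimately show False using assms(1) by (auto simp: red_in_def)
qed

text \<open>
  Blue advances from a source in the slab towards column \<open>x\<close> by at least one column per unit of
  time: it is never stopped because fewer than \<open>\<tau>\<close> consecutive columns can be red in time.
\<close>
lemma good_slab_row_blue:
  assumes good: "good_slab \<omega> x w m a" and m: "int \<rho> * \<lfloor>(real w + 1) / r\<rfloor> \<le> int m"
    and c: "x < c" "c \<le> x + int \<tau>" "\<not> red_in \<omega> c {a..<a + 3 * int m}"
    and y: "y \<in> {a + int m..<a + 2 * int m}" "blue_in \<omega> {x - int w..x} y"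
  shows "ever \<omega> Blue (c, y)"
proof -
  have not_red: "\<not> by_time \<omega> t Red (c', y)"
    if "t \<le> real w + 1" "\<not> red_in \<omega> c' {a..<a + 3 * int m}" for c' t
  proof (rule not_red_by_time[OF that(2) y(1)])
    have "int \<rho> * \<lfloor>t / r\<rfloor> \<le> int \<rho> * \<lfloor>(real w + 1) / r\<rfloor>"
      using that(1) r_pos by (intro mult_left_mono floor_mono divide_right_mono) auto
    then show "int \<rho> * \<lfloor>t / r\<rfloor> \<le> int m" using m by linarith
  qed
  obtain c0 where c0: "c0 \<in> {x - int w..x}" "init \<omega> (c0, y) = Blue"
    using y(2) by (auto simp: blue_in_def)
  \<comment> \<open>The minimum with \<open>x\<close> lets blue wait in column \<open>x\<close> once
    it has arrived there, so that the statement holds up to \<open>s = w\<close> for every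
    source.\<close>
  have advance: "\<exists>p. min x (c0 + int s) \<le> p \<and> p \<le> x \<and> by_time \<omega> (real s) Blue (p, y)"
    if "s \<le> w" for s :: nat
    using that
  proof (induction s)
    case 0
    then show ?case using c0 by (intro exI[of _ c0]) (auto intro: by_time_init)
  next
    case (Suc s)
    then obtain p where p: "min x (c0 + int s) \<le> p" "p \<le> x" "by_time \<omega> (real s) Blue (p, y)"
      by auto
    have "\<exists>p'. min x (p + 1) \<le> p' \<and> p' \<le> x \<and> p' \<le> p + int \<tau> \<and> p \<le> p'
        \<and> \<not> red_in \<omega> p' {a..<a + 3 * int m}"
    \<comment> \<open>Within reach of \<open>x\<close> the next column is \<open>x\<close> itself,
      which the first clause of \<open>good_slab\<close> keeps free of red. Further away, the second
      clause supplies one of the next \<open>\<tau>\<close> columns.\<close>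
    proof (cases "x \<le> p + int \<tau>")
      case True
      then show ?thesis using good p by (intro exI[of _ x]) (auto simp: good_slab_def)
    next
      case False
      then have "p \<in> {x - int w..x - int \<tau>}" using p c0 by auto
      then obtain i where "i \<in> {1..int \<tau>}" "\<not> red_in \<omega> (p + i) {a..<a + 3 * int m}"
        using good unfolding good_slab_def by blast
      then show ?thesis using False by (intro exI[of _ "p + i"]) auto
    qed
    then obtain p' where p': "min x (p + 1) \<le> p'" "p' \<le> x" "\<bar>p - p'\<bar> \<le> int \<tau>"
      "\<not> red_in \<omega> p' {a..<a + 3 * int m}" by fastforce
    have "by_time \<omega> (real (Suc s)) Blue (p', y)"
      using blue_growth[OF p(3) p'(3), of "Suc s"] not_red[OF _ p'(4), of "real (Suc s)"] Suc.prems
      by auto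
    then show ?case using p p' by (intro exI[of _ p']) auto
  qed
  obtain p where p: "min x (c0 + int w) \<le> p" "p \<le> x" "by_time \<omega> (real w) Blue (p, y)"
    using advance[of w] by auto
  then have "p = x" using c0 by auto
  \<comment> \<open>One last unit of time leads from \<open>x\<close> to \<open>c\<close>; this is
    why the time allowed for in \<open>m\<close> is \<open>w + 1\<close>.\<close>
  then have "by_time \<omega> (real (Suc w)) Blue (c, y)"
    using blue_growth[OF p(3), of c "Suc w"] not_red[OF _ c(3), of "real (Suc w)"] c by auto
  then show ?thesis by (rule by_time_ever)
qed

text \<open>The first red vertex inside the strip would have its red source outside, within distance
  \<open>\<rho>\<close>. It would therefore lie in the lowest or the highest \<open>\<rho>\<close>
  rows of the strip, which are ever blue. When they turn blue does not matter, since a vertex has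
  only one colour in its life.\<close>

lemma red_confined:
  assumes up: "\<And>j. j \<in> {0..<int \<rho>} \<Longrightarrow> ever \<omega> Blue (c, b + j)"
    and down: "\<And>j. j \<in> {0..<int \<rho>} \<Longrightarrow> ever \<omega> Blue (c, b' + j)"
    and init: "\<not> red_in \<omega> c {b'..<b + int \<rho>}"
    and y: "y \<in> {b'..<b + int \<rho>}"
  shows "\<not> ever \<omega> Red (c, y)"
proof -
  have "st \<omega> n (c, y) \<noteq> Red" for n
    using y
  proof (induction n arbitrary: y)
    case 0
    then show ?case using init by (auto simp: red_in_def)
  next
    case (Suc n)
    show ?case
    proof
      assume red: "st \<omega> (Suc n) (c, y) = Red"
      then obtain d where d: "\<bar>d\<bar> \<le> int \<rho>" "st \<omega> n (c, y + d) = Red"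
        using st_Suc_Red(2) Suc by blast
      then have "y + d \<notin> {b'..<b + int \<rho>}" using Suc.IH by blast
      then have "y - b \<in> {0..<int \<rho>} \<or> y - b' \<in> {0..<int \<rho>}" using d(1) Suc.prems by auto
      then have "ever \<omega> Blue (c, y)" using up[of "y - b"] down[of "y - b'"] by auto
      moreover have "ever \<omega> Red (c, y)" using red unfolding ever_def by blast
      ultimately show False using ever_unique by blast
    qed
  qed
  then show ?thesis by (auto simp: ever_def)
qed

lemma blue_confined:
  assumes right: "\<And>j. j \<in> {0..<int \<tau>} \<Longrightarrow> ever \<omega> Red (b + j, y)"
    and left: "\<And>j. j \<in> {0..<int \<tau>} \<Longrightarrow> ever \<omega> Red (b' + j, y)"
    and init: "\<not> blue_in \<omega> {b'..<b + int \<tau>} y"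
    and x: "x \<in> {b'..<b + int \<tau>}"
  shows "\<not> ever \<omega> Blue (x, y)"
proof -
  have "st \<omega> n (x, y) \<noteq> Blue" for n
    using x
  proof (induction n arbitrary: x)
    case 0
    then show ?case using init by (auto simp: blue_in_def)
  next
    case (Suc n)
    show ?case
    proof
      assume blue: "st \<omega> (Suc n) (x, y) = Blue"
      then obtain d where d: "\<bar>d\<bar> \<le> int \<tau>" "st \<omega> n (x + d, y) = Blue"
        using st_Suc_Blue(2) Suc by blast
      then have "x + d \<notin> {b'..<b + int \<tau>}" using Suc.IH by blast
      then have "x - b \<in> {0..<int \<tau>} \<or> x - b' \<in> {0..<int \<tau>}" using d(1) Suc.prems by auto
      then have "ever \<omega> Red (x, y)" using right[of "x - b"] left[of "x - b'"] by auto
      moreover have "ever \<omega> Blue (x, y)" using blue unfolding ever_def by blast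
      ultimately show False using ever_unique by blast
    qed
  qed
  then show ?thesis by (auto simp: ever_def)
qed

text \<open>Each slab yields \<open>\<rho>\<close> consecutive blue rows in column \<open>c\<close>,
  one run above and one below row \<open>0\<close>, and red is confined between them. Freedom from
  red in column \<open>c\<close> is a separate hypothesis because \<open>good_slab\<close> looks
  only at columns up to \<open>x\<close>.\<close>

lemma good_slabs_block_red:
  assumes m: "int \<rho> * \<lfloor>(real w + 1) / r\<rfloor> \<le> int m" "m \<ge> 1"
    and up: "good_slab \<omega> x w m a" "0 \<le> a"
    and down: "good_slab \<omega> x w m a'" "a' + 3 * int m \<le> 0"
    and c: "x < c" "c \<le> x + int \<tau>" "\<not> red_in \<omega> c {a'..<a + 3 * int m}"
  shows "\<not> ever \<omega> Red (c, 0)"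
proof -
  have block: "\<exists>b\<in>{e + int m..e + 2 * int m - int \<rho>}. \<forall>j\<in>{0..<int \<rho>}. ever \<omega> Blue (c, b + j)"
    if good: "good_slab \<omega> x w m e" and "\<not> red_in \<omega> c {e..<e + 3 * int m}" for e
  proof -
    obtain b where b: "b \<in> {e + int m..e + 2 * int m - int \<rho>}"
      "\<forall>j\<in>{0..<int \<rho>}. blue_in \<omega> {x - int w..x} (b + j)"
      using good unfolding good_slab_def by blast
    have "ever \<omega> Blue (c, b + j)" if "j \<in> {0..<int \<rho>}" for j
      by (rule good_slab_row_blue[OF good m(1) c(1,2) \<open>\<not> red_in \<omega> c {e..<e + 3 * int m}\<close>])
        (use b that in auto)
    then show ?thesis using b by blast
  qed
  have "\<not> red_in \<omega> c {a..<a + 3 * int m}" "\<not> red_in \<omega> c {a'..<a' + 3 * int m}"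
    using c(3) up(2) down(2) unfolding red_in_def by auto
  from block[OF up(1) this(1)] block[OF down(1) this(2)] obtain b b' where
    b: "b \<in> {a + int m..a + 2 * int m - int \<rho>}" "\<And>j. j \<in> {0..<int \<rho>} \<Longrightarrow> ever \<omega> Blue (c, b + j)"
    and b': "b' \<in> {a' + int m..a' + 2 * int m - int \<rho>}"
      "\<And>j. j \<in> {0..<int \<rho>} \<Longrightarrow> ever \<omega> Blue (c, b' + j)"
    by blast
  show ?thesis
  proof (rule red_confined[OF b(2) b'(2)])
    show "\<not> red_in \<omega> c {b'..<b + int \<rho>}" using c(3) b(1) b'(1) unfolding red_in_def by auto
    show "0 \<in> {b'..<b + int \<rho>}" using b(1) b'(1) up(2) down(2) rho_pos by auto
  qed
qed

lemma ever_red_red_in: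
  assumes "ever \<omega> Red (c, y)"
  shows "\<exists>k::nat. red_in \<omega> c {y - int k..<y + int k}"
proof -
  obtain n where "st \<omega> n (c, y) = Red" using assms by (auto simp: ever_def)
  then obtain d where "init \<omega> (c, y + d) = Red" using red_speed by blast
  then show ?thesis unfolding red_in_def
    by (intro exI[of _ "nat \<bar>d\<bar> + 1"] bexI[of _ "y + d"]) auto
qed

text \<open>Take the leftmost vertex \<open>k\<close> of the nonnegative half of row
  \<open>0\<close> that is ever blue. Everything within distance \<open>\<tau>\<close> of it gets a
  colour. If \<open>k\<close> were more than \<open>\<tau>\<close> away from the origin, one of the
  \<open>\<tau>\<close> vertices to its left would be never red, hence blue, against
  minimality.\<close>

lemma eventually_blue:
  assumes "blue_in \<omega> {1..L} 0" "\<not> ever \<omega> Red (0, 0)"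
    and "\<And>x. x \<in> {0..L} \<Longrightarrow> \<exists>c\<in>{x + 1..x + int \<tau>}. \<not> ever \<omega> Red (c, 0)"
  shows "ever \<omega> Blue (0, 0)"
proof -
  obtain x0 where x0: "x0 \<in> {1..L}" "ever \<omega> Blue (x0, 0)"
    using assms(1) by_time_ever[OF by_time_init[of \<omega> _ Blue 0]] by (auto simp: blue_in_def)
  define P where "P k \<longleftrightarrow> ever \<omega> Blue (int k, 0)" for k
  define k where "k = (LEAST k. P k)"
  have "P (nat x0)" using x0 by (auto simp: P_def)
  then have Pk: "P k" and kle: "k \<le> nat x0" unfolding k_def by (auto intro: LeastI Least_le)
  have least: "\<not> P j" if "j < k" for j using that not_less_Least unfolding k_def by blast
  obtain t :: nat where t: "by_time \<omega> (real t) Blue (int k, 0)"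
    using Pk ever_by_time unfolding P_def by blast
  have near: "ever \<omega> Blue (z, 0) \<or> ever \<omega> Red (z, 0)" if "\<bar>int k - z\<bar> \<le> int \<tau>" for z
    using blue_growth[OF t that, of "Suc t"] by (auto dest: by_time_ever)
  show ?thesis
  proof (cases "k \<le> \<tau>")
    case True
    then show ?thesis using near[of 0] assms(2) by auto
  next
    case False
    \<comment> \<open>With this choice \<open>{x + 1..x + int \<tau>}\<close> is the set of the
      \<open>\<tau>\<close> columns immediately left of \<open>k\<close>, and
      \<open>x \<ge> 0\<close> because \<open>k > \<tau>\<close>.\<close>
    define x where "x = int k - int \<tau> - 1"
    have "x \<in> {0..L}" using False kle x0 by (auto simp: x_def)
    then obtain c where c: "c \<in> {x + 1..x + int \<tau>}" "\<not> ever \<omega> Red (c, 0)" using assms(3) by blast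
    then have "ever \<omega> Blue (c, 0)" using near[of c] by (auto simp: x_def)
    then have "P (nat c)" using c False by (auto simp: P_def x_def)
    moreover have "nat c < k" using c False by (auto simp: x_def)
    ultimately show ?thesis using least by blast
  qed
qed

text \<open>Red is led down by at least one row per red update, so \<open>h\<close> updates, taking
  time \<open>h * r\<close>, bring it to row \<open>0\<close>; \<open>D\<close> bounds how far blue
  travels meanwhile. From \<open>y > \<rho>\<close> one of the rows
  \<open>y - \<rho>, \<dots>, y - 1\<close> has no blue source within \<open>D\<close> of column
  \<open>c\<close>; from \<open>y \<le> \<rho>\<close> red goes to row \<open>0\<close> at
  once.\<close>

lemma red_descends:
  assumes start: "red_in \<omega> c {1..int h}" and D: "int \<tau> * \<lfloor>real h * r\<rfloor> \<le> D"
    and row0: "\<not> blue_in \<omega> {c - D..c + D} 0"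
    and rows: "\<And>b. 1 \<le> b \<Longrightarrow> b + int \<rho> \<le> int h \<Longrightarrow>
      \<exists>j\<in>{0..<int \<rho>}. \<not> blue_in \<omega> {c - D..c + D} (b + j)"
  shows "ever \<omega> Red (c, 0)"
proof -
  have not_blue: "\<not> by_time \<omega> t Blue (c, y)" if "t \<le> real h * r" "\<not> blue_in \<omega> {c - D..c + D} y" for t y
  proof
    assume "by_time \<omega> t Blue (c, y)"
    then obtain d where d: "\<bar>d\<bar> \<le> int \<tau> * \<lfloor>t\<rfloor>" "init \<omega> (c + d, y) = Blue"
      using blue_speed_by_time by blast
    have "int \<tau> * \<lfloor>t\<rfloor> \<le> int \<tau> * \<lfloor>real h * r\<rfloor>"
      using that(1) by (intro mult_left_mono floor_mono) auto
    then have "\<bar>d\<bar> \<le> D" using d D by linarith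
    then have "c + d \<in> {c - D..c + D}" by auto
    then show False using that(2) d(2) unfolding blue_in_def by blast
  qed
  have descend: "\<exists>y. 0 \<le> y \<and> y \<le> int h - int s \<and> by_time \<omega> (real s * r) Red (c, y)"
    if "s \<le> h" for s :: nat
    using that
  proof (induction s)
    case 0
    obtain y where "y \<in> {1..int h}" "init \<omega> (c, y) = Red" using start by (auto simp: red_in_def)
    then show ?case by (intro exI[of _ y]) (auto intro: by_time_init)
  next
    case (Suc s)
    then obtain y where y: "0 \<le> y" "y \<le> int h - int s" "by_time \<omega> (real s * r) Red (c, y)" by auto
    show ?case
    proof (cases "y = 0")
      case True
      have "real s * r \<le> real (Suc s) * r" using r_pos by simp
      then show ?thesis using True y(3) Suc.prems by (intro exI[of _ 0]) (auto intro: by_time_mono)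
    next
      case False
      have "\<exists>y'. 0 \<le> y' \<and> y' \<le> y - 1 \<and> \<bar>y - y'\<bar> \<le> int \<rho> \<and> \<not> blue_in \<omega> {c - D..c + D} y'"
      proof (cases "y \<le> int \<rho>")
        case True
        then show ?thesis using row0 y False by (intro exI[of _ 0]) auto
      next
        case False
        then obtain j where "j \<in> {0..<int \<rho>}" "\<not> blue_in \<omega> {c - D..c + D} (y - int \<rho> + j)"
          using rows[of "y - int \<rho>"] y by auto
        then show ?thesis using False by (intro exI[of _ "y - int \<rho> + j"]) auto
      qed
      then obtain y' where y': "0 \<le> y'" "y' \<le> y - 1" "\<bar>y - y'\<bar> \<le> int \<rho>"
        "\<not> blue_in \<omega> {c - D..c + D} y'" by blast
      have "real (Suc s) * r \<le> real h * r" using Suc.prems r_pos by (intro mult_right_mono) auto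
      then have "by_time \<omega> (real (Suc s) * r) Red (c, y')"
        using red_growth[OF y(3) y'(3), of "Suc s"] not_blue[OF _ y'(4), of "real (Suc s) * r"] r_pos
        by auto
      then show ?thesis using y y' by (intro exI[of _ y']) auto
    qed
  qed
  obtain y where "0 \<le> y" "y \<le> 0" "by_time \<omega> (real h * r) Red (c, y)"
    using descend[of h] by auto
  then show ?thesis by (auto dest: by_time_ever)
qed

end

section \<open>Probability of good slabs\<close>

instance color :: countable by countable_datatype

text \<open>This gives measurability: the state after \<open>n\<close> steps is an event of finitely
  many coordinates, and \<open>ever\<close> is a countable union of such events.\<close>

lemma state_finite_dependence:
  assumes "finite B" "finite R"
  shows "\<exists>I. finite I \<and> (\<forall>\<omega> \<omega>'. (\<forall>i\<in>I. \<omega> i = \<omega>' i) \<longrightarrow> state B R r \<omega> n v = state B R r \<omega>' n v)"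
proof (induction n arbitrary: v)
  case 0
  show ?case by (intro exI[of _ "{v}"]) auto
next
  case (Suc n)
  then obtain I where I: "\<And>v. finite (I v)"
    "\<And>v \<omega> \<omega>'. (\<And>i. i \<in> I v \<Longrightarrow> \<omega> i = \<omega>' i) \<Longrightarrow> state B R r \<omega> n v = state B R r \<omega>' n v" by metis
  let ?J = "insert v (I v) \<union> (\<Union>b\<in>B \<union> R. I (v + b))"
  have "state B R r \<omega> (Suc n) v = state B R r \<omega>' (Suc n) v" if "\<forall>i\<in>?J. \<omega> i = \<omega>' i" for \<omega> \<omega>'
  proof -
    have "state B R r \<omega> n v = state B R r \<omega>' n v" by (rule I(2)) (use that in auto)
    moreover have "state B R r \<omega> n (v + b) = state B R r \<omega>' n (v + b)" if "b \<in> B \<union> R" for b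
      by (rule I(2)) (use \<open>\<forall>i\<in>?J. \<omega> i = \<omega>' i\<close> that in auto)
    ultimately show ?thesis using that by (simp add: update_def)
  qed
  moreover have "finite ?J" using I(1) assms by auto
  ultimately show ?case by blast
qed

context competition begin

lemma finite_nbhds: "finite blue_nbhd" "finite red_nbhd"
  by (auto simp: blue_nbhd_def red_nbhd_def)

lemma determined_by_red_in: "{c} \<times> Y \<subseteq> I \<Longrightarrow> determined_by I (\<lambda>\<omega>. red_in \<omega> c Y)"
  unfolding red_in_def by (intro determined_by_bex determined_by_coord) auto

lemma determined_by_blue_in: "X \<times> {y} \<subseteq> I \<Longrightarrow> determined_by I (\<lambda>\<omega>. blue_in \<omega> X y)"
  unfolding blue_in_def by (intro determined_by_bex determined_by_coord) auto

lemma determined_by_good_slab: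
  "determined_by ({x - int w..x} \<times> {a..<a + 3 * int m}) (\<lambda>\<omega>. good_slab \<omega> x w m a)"
  unfolding good_slab_def
  by (intro determined_by_conj determined_by_Not determined_by_ball determined_by_bex
      determined_by_red_in determined_by_blue_in) auto

end

locale random_competition = competition +
  fixes p q :: real
  assumes p_pos: "p > 0" and q_pos: "q > 0" and pq_le: "p + q \<le> 1"
begin

definition vertex_pmf :: "(color \<times> bool) pmf" where
  "vertex_pmf = pair_pmf (initial_pmf p q) (bernoulli_pmf (1/2))"

sublocale iid_product vertex_pmf "TYPE(vertex)" .

abbreviation pr :: "((vertex \<Rightarrow> color \<times> bool) \<Rightarrow> bool) \<Rightarrow> real" where
  "pr E \<equiv> P.prob {\<omega>. E \<omega>}"

lemma sample_space_eq: "sample_space p q = iid"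
  unfolding sample_space_def vertex_pmf_def ..

lemma vertex_pmf_init: "measure_pmf.prob vertex_pmf {s. fst s = c} = pmf (initial_pmf p q) c"
proof -
  have "measure_pmf.prob vertex_pmf {s. fst s = c} = measure_pmf.prob (map_pmf fst vertex_pmf) {c}"
    by (simp add: vimage_def)
  then show ?thesis unfolding vertex_pmf_def by (simp add: map_fst_pair_pmf measure_pmf_single)
qed

lemma pr_init_Blue: "pr (\<lambda>\<omega>. init \<omega> v = Blue) = p"
  using prob_coord[of v "{s. fst s = Blue}"] vertex_pmf_init[of Blue] pmf_initial_pmf p_pos q_pos pq_le
  by simp

lemma pr_init_Red: "pr (\<lambda>\<omega>. init \<omega> v = Red) = q"
  using prob_coord[of v "{s. fst s = Red}"] vertex_pmf_init[of Red] pmf_initial_pmf p_pos q_pos pq_le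
  by simp

lemma pr_all_not_Blue:
  assumes "finite V"
  shows "pr (\<lambda>\<omega>. \<forall>v\<in>V. init \<omega> v \<noteq> Blue) = (1 - p) ^ card V"
proof -
  have "measure_pmf.prob vertex_pmf {s. fst s \<noteq> Blue} = 1 - p"
    using measure_pmf.prob_compl[of "{s. fst s = Blue}" vertex_pmf] vertex_pmf_init[of Blue]
      pmf_initial_pmf p_pos q_pos pq_le by (simp add: Collect_neg_eq flip: Compl_eq_Diff_UNIV)
  then show ?thesis using prob_coord_Ball[OF assms, of "{s. fst s \<noteq> Blue}"] by simp
qed

lemma pr_all_not_Red:
  assumes "finite V"
  shows "pr (\<lambda>\<omega>. \<forall>v\<in>V. init \<omega> v \<noteq> Red) = (1 - q) ^ card V"
proof -
  have "measure_pmf.prob vertex_pmf {s. fst s \<noteq> Red} = 1 - q"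
    using measure_pmf.prob_compl[of "{s. fst s = Red}" vertex_pmf] vertex_pmf_init[of Red]
      pmf_initial_pmf p_pos q_pos pq_le by (simp add: Collect_neg_eq flip: Compl_eq_Diff_UNIV)
  then show ?thesis using prob_coord_Ball[OF assms, of "{s. fst s \<noteq> Red}"] by simp
qed

lemma state_events: "{\<omega>. st \<omega> n v = c} \<in> P.events"
proof -
  obtain I where I: "finite I \<and> (\<forall>\<omega> \<omega>'. (\<forall>i\<in>I. \<omega> i = \<omega>' i) \<longrightarrow> st \<omega> n v = st \<omega>' n v)"
    using state_finite_dependence[OF finite_nbhds] by (rule exE)
  have "determined_by I (\<lambda>\<omega>. st \<omega> n v = c)"
  proof (rule determined_byI)
    fix \<omega> \<omega>' assume "\<And>i. i \<in> I \<Longrightarrow> \<omega> i = \<omega>' i" "st \<omega> n v = c"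
    then show "st \<omega>' n v = c" using I[THEN conjunct2, rule_format, of \<omega> \<omega>'] by simp
  qed
  then show ?thesis using I by (intro determined_sets[of I]) simp_all
qed

lemma ever_events: "{\<omega>. ever \<omega> c v} \<in> P.events"
proof -
  have "{\<omega>. ever \<omega> c v} = (\<Union>n. {\<omega>. st \<omega> n v = c})" by (auto simp: ever_def)
  then show ?thesis using state_events by auto
qed

lemma red_in_events: "finite Y \<Longrightarrow> {\<omega>. red_in \<omega> c Y} \<in> P.events"
  by (rule determined_sets[OF _ determined_by_red_in[OF order_refl]]) auto

lemma blue_in_events: "finite X \<Longrightarrow> {\<omega>. blue_in \<omega> X y} \<in> P.events"
  by (rule determined_sets[OF _ determined_by_blue_in[OF order_refl]]) auto

lemma pr_red_in:
  assumes "finite Y"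
  shows "pr (\<lambda>\<omega>. red_in \<omega> c Y) = 1 - (1 - q) ^ card Y"
proof -
  have "pr (\<lambda>\<omega>. \<not> red_in \<omega> c Y) = (1 - q) ^ card Y"
    using pr_all_not_Red[of "{c} \<times> Y"] assms by (simp add: red_in_def card_cartesian_product)
  then show ?thesis
    using prob_Not_determined[OF _ determined_by_red_in[OF order_refl], of c Y] assms by simp
qed

lemma pr_blue_in:
  assumes "finite X"
  shows "pr (\<lambda>\<omega>. blue_in \<omega> X y) = 1 - (1 - p) ^ card X"
proof -
  have "pr (\<lambda>\<omega>. \<not> blue_in \<omega> X y) = (1 - p) ^ card X"
    using pr_all_not_Blue[of "X \<times> {y}"] assms by (simp add: blue_in_def card_cartesian_product)
  then show ?thesis
    using prob_Not_determined[OF _ determined_by_blue_in[OF order_refl], of X y] assms by simp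
qed

lemma pr_red_in_le:
  assumes "finite Y" shows "pr (\<lambda>\<omega>. red_in \<omega> c Y) \<le> card Y * q"
  using pr_red_in[OF assms] Bernoulli_inequality[of "- q" "card Y"] p_pos pq_le by simp

lemma pr_blue_in_le:
  assumes "finite X" shows "pr (\<lambda>\<omega>. blue_in \<omega> X y) \<le> card X * p"
  using pr_blue_in[OF assms] Bernoulli_inequality[of "- p" "card X"] q_pos pq_le by simp

lemma pr_columns_red:
  assumes "finite C" "finite Y"
  shows "pr (\<lambda>\<omega>. \<forall>c\<in>C. red_in \<omega> c Y) = (1 - (1 - q) ^ card Y) ^ card C"
proof -
  have "pr (\<lambda>\<omega>. \<forall>c\<in>C. red_in \<omega> c Y) = (\<Prod>c\<in>C. pr (\<lambda>\<omega>. red_in \<omega> c Y))"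
    by (rule prob_Ball_determined[where I = "\<lambda>c. {c} \<times> Y"])
      (use assms in \<open>auto simp: disjoint_family_on_def intro: determined_by_red_in\<close>)
  then show ?thesis by (simp add: pr_red_in[OF assms(2)])
qed

lemma pr_columns_red_le:
  assumes "finite C" "finite Y"
  shows "pr (\<lambda>\<omega>. \<forall>c\<in>C. red_in \<omega> c Y) \<le> (card Y * q) ^ card C"
  unfolding pr_columns_red[OF assms] pr_red_in[OF assms(2), of undefined, symmetric]
  by (intro power_mono pr_red_in_le assms measure_nonneg)

lemma pr_rows_blue:
  assumes "finite X" "finite Y"
  shows "pr (\<lambda>\<omega>. \<forall>y\<in>Y. blue_in \<omega> X y) = (1 - (1 - p) ^ card X) ^ card Y"
proof -
  have "pr (\<lambda>\<omega>. \<forall>y\<in>Y. blue_in \<omega> X y) = (\<Prod>y\<in>Y. pr (\<lambda>\<omega>. blue_in \<omega> X y))"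
    by (rule prob_Ball_determined[where I = "\<lambda>y. X \<times> {y}"])
      (use assms in \<open>auto simp: disjoint_family_on_def intro: determined_by_blue_in\<close>)
  then show ?thesis by (simp add: pr_blue_in[OF assms(1)])
qed

text \<open>Only blocks starting at multiples of \<open>\<rho>\<close> from \<open>a\<close> are
  tried. They are disjoint, so independence gives an exact product; overlapping blocks would have
  been dependent.\<close>

lemma pr_no_blue_block:
  assumes "finite X"
  shows "pr (\<lambda>\<omega>. \<forall>k\<in>{..<N}. \<exists>j\<in>{0..<int \<rho>}. \<not> blue_in \<omega> X (a + int \<rho> * int k + j))
    = (1 - (1 - (1 - p) ^ card X) ^ \<rho>) ^ N"
proof -
  define Y where "Y k = {a + int \<rho> * int k..<a + int \<rho> * int k + int \<rho>}" for k
  define E where "E k \<omega> \<longleftrightarrow> \<not> (\<forall>y\<in>Y k. blue_in \<omega> X y)" for k \<omega>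
  have disj: "Y k \<inter> Y l = {}" if "k < l" for k l
  proof -
    have "int \<rho> * (int k + 1) \<le> int \<rho> * int l" using that by (intro mult_left_mono) auto
    then show ?thesis unfolding Y_def by (auto simp: algebra_simps)
  qed
  have det: "determined_by (X \<times> Y k) (E k)" for k
    unfolding E_def by (intro determined_by_Not determined_by_ball determined_by_blue_in) auto
  have fin: "finite (X \<times> Y k)" for k using assms by (auto simp: Y_def)
  have pE: "pr (E k) = 1 - (1 - (1 - p) ^ card X) ^ \<rho>" for k
  proof -
    have "determined_by (X \<times> Y k) (\<lambda>\<omega>. \<forall>y\<in>Y k. blue_in \<omega> X y)"
      by (intro determined_by_ball determined_by_blue_in) auto
    then have "pr (E k) = 1 - pr (\<lambda>\<omega>. \<forall>y\<in>Y k. blue_in \<omega> X y)"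
      unfolding E_def by (intro prob_Not_determined[OF fin])
    also have "pr (\<lambda>\<omega>. \<forall>y\<in>Y k. blue_in \<omega> X y) = (1 - (1 - p) ^ card X) ^ card (Y k)"
      using assms by (intro pr_rows_blue) (auto simp: Y_def)
    finally show ?thesis by (simp add: Y_def)
  qed
  have disj': "disjoint_family_on (\<lambda>k. X \<times> Y k) {..<N}"
    unfolding disjoint_family_on_def
  proof (intro ballI impI)
    fix k l :: nat assume "k \<noteq> l"
    then have "Y k \<inter> Y l = {}" using disj[of k l] disj[of l k] by (cases "k < l") auto
    then show "X \<times> Y k \<inter> X \<times> Y l = {}" by blast
  qed
  have "pr (\<lambda>\<omega>. \<forall>k\<in>{..<N}. E k \<omega>) = (\<Prod>k\<in>{..<N}. pr (E k))"
    by (rule prob_Ball_determined[where I = "\<lambda>k. X \<times> Y k"])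
      (use det fin disj' in auto)
  also have "\<dots> = (1 - (1 - (1 - p) ^ card X) ^ \<rho>) ^ N" by (simp add: pE)
  finally have "pr (\<lambda>\<omega>. \<forall>k\<in>{..<N}. E k \<omega>) = (1 - (1 - (1 - p) ^ card X) ^ \<rho>) ^ N" .
  moreover have "(\<forall>k\<in>{..<N}. E k \<omega>) \<longleftrightarrow>
      (\<forall>k\<in>{..<N}. \<exists>j\<in>{0..<int \<rho>}. \<not> blue_in \<omega> X (a + int \<rho> * int k + j))" for \<omega>
  proof -
    have *: "Y k = (\<lambda>j. a + int \<rho> * int k + j) ` {0..<int \<rho>}" for k
      by (simp add: Y_def add.commute)
    show ?thesis unfolding E_def * by blast
  qed
  ultimately show ?thesis by simp
qed

text \<open>The three terms are a union bound over the failures of the three clauses of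
  \<open>good_slab\<close>. With \<open>m = \<rho> * N\<close> the middle third splits exactly into
  \<open>N\<close> blocks of \<open>\<rho>\<close> rows.\<close>

lemma pr_not_good_slab:
  assumes "m = \<rho> * N"
  shows "pr (\<lambda>\<omega>. \<not> good_slab \<omega> x w m a) \<le>
    real (3 * m) * q + (real w + 1) * (real (3 * m) * q) ^ \<tau> + (1 - (1 - (1 - p) ^ (w + 1)) ^ \<rho>) ^ N"
proof -
  let ?Y = "{a..<a + 3 * int m}" and ?X = "{x - int w..x}"
  let ?E1 = "\<lambda>\<omega>. red_in \<omega> x ?Y"
  let ?E2 = "\<lambda>\<omega>. \<exists>s\<in>{x - int w..x - int \<tau>}. \<forall>c\<in>{s + 1..s + int \<tau>}. red_in \<omega> c ?Y"
  let ?E3 = "\<lambda>\<omega>. \<forall>k\<in>{..<N}. \<exists>j\<in>{0..<int \<rho>}. \<not> blue_in \<omega> ?X (a + int m + int \<rho> * int k + j)"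
  have ev1: "{\<omega>. ?E1 \<omega>} \<in> P.events" by (rule red_in_events) simp
  have ev2': "{\<omega>. \<forall>c\<in>{s + 1..s + int \<tau>}. red_in \<omega> c ?Y} \<in> P.events" for s
    by (rule determined_sets[of "{s + 1..s + int \<tau>} \<times> ?Y"])
      (auto intro!: determined_by_ball determined_by_red_in)
  have ev2: "{\<omega>. ?E2 \<omega>} \<in> P.events"
    by (rule determined_sets[of "?X \<times> ?Y"])
      (auto intro!: determined_by_bex determined_by_ball determined_by_red_in)
  have ev3: "{\<omega>. ?E3 \<omega>} \<in> P.events"
    by (rule determined_sets[of "?X \<times> ((\<lambda>(k, j). a + int m + int \<rho> * int k + j) ` ({..<N} \<times> {0..<int \<rho>}))"])
      (auto intro!: determined_by_ball determined_by_bex determined_by_Not determined_by_blue_in)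
  have incl: "?E1 \<omega> \<or> ?E2 \<omega> \<or> ?E3 \<omega>" if "\<not> good_slab \<omega> x w m a" for \<omega>
  proof (rule ccontr)
    assume "\<not> (?E1 \<omega> \<or> ?E2 \<omega> \<or> ?E3 \<omega>)"
    then have n1: "\<not> ?E1 \<omega>" and n2: "\<not> ?E2 \<omega>" and n3: "\<not> ?E3 \<omega>" by simp_all
    have "\<exists>i\<in>{1..int \<tau>}. \<not> red_in \<omega> (s + i) ?Y" if s: "s \<in> {x - int w..x - int \<tau>}" for s
    proof -
      obtain c where "c \<in> {s + 1..s + int \<tau>}" "\<not> red_in \<omega> c ?Y" using n2 s by blast
      then show ?thesis by (intro bexI[of _ "c - s"]) auto
    qed
    moreover have "\<exists>b\<in>{a + int m..a + 2 * int m - int \<rho>}. \<forall>j\<in>{0..<int \<rho>}. blue_in \<omega> ?X (b + j)"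
    proof -
      obtain k where k: "k \<in> {..<N}"
        "\<forall>j\<in>{0..<int \<rho>}. blue_in \<omega> ?X (a + int m + int \<rho> * int k + j)" using n3 by blast
      have "int \<rho> * (int k + 1) \<le> int \<rho> * int N" using k by (intro mult_left_mono) auto
      then have "a + int m + int \<rho> * int k \<in> {a + int m..a + 2 * int m - int \<rho>}"
        by (simp add: assms algebra_simps)
      then show ?thesis using k(2) by (rule bexI[rotated])
    qed
    ultimately have "good_slab \<omega> x w m a" using n1 unfolding good_slab_def by simp
    then show False using that by contradiction
  qed
  have b1: "pr ?E1 \<le> real (3 * m) * q"
    using pr_red_in_le[of ?Y x] by simp
  have cols: "pr (\<lambda>\<omega>. \<forall>c\<in>{s + 1..s + int \<tau>}. red_in \<omega> c ?Y) \<le> (real (3 * m) * q) ^ \<tau>" for s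
    using pr_columns_red_le[of "{s + 1..s + int \<tau>}" ?Y] by simp
  have "pr ?E2 \<le> card {x - int w..x - int \<tau>} * (real (3 * m) * q) ^ \<tau>"
    by (rule prob_Bex_le_card[OF _ ev2' cols]) simp
  also have "\<dots> \<le> (real w + 1) * (real (3 * m) * q) ^ \<tau>"
    using q_pos by (intro mult_right_mono) (auto simp: nat_le_iff)
  finally have b2: "pr ?E2 \<le> (real w + 1) * (real (3 * m) * q) ^ \<tau>" .
  have b3: "pr ?E3 = (1 - (1 - (1 - p) ^ (w + 1)) ^ \<rho>) ^ N"
    using pr_no_blue_block[of ?X N "a + int m"] by (simp add: nat_add_distrib)
  have ev23: "{\<omega>. ?E2 \<omega> \<or> ?E3 \<omega>} \<in> P.events" using ev2 ev3 by (simp add: Collect_disj_eq sets.Un)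
  have "pr (\<lambda>\<omega>. \<not> good_slab \<omega> x w m a) \<le> pr (\<lambda>\<omega>. ?E1 \<omega> \<or> (?E2 \<omega> \<or> ?E3 \<omega>))"
    using incl ev1 ev23 by (intro P.finite_measure_mono) (auto simp: Collect_disj_eq[of ?E1])
  also have "\<dots> \<le> pr ?E1 + pr (\<lambda>\<omega>. ?E2 \<omega> \<or> ?E3 \<omega>)" by (rule prob_disj_le[OF ev1 ev23])
  also have "pr (\<lambda>\<omega>. ?E2 \<omega> \<or> ?E3 \<omega>) \<le> pr ?E2 + pr ?E3" by (rule prob_disj_le[OF ev2 ev3])
  finally show ?thesis using b1 b2 b3 by linarith
qed

end

section \<open>Probability of red barriers\<close>

text \<open>The quotient of successive terms tends to \<open>\<kappa>\<close>, so it is eventually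
  below any \<open>c\<close> between \<open>\<kappa>\<close> and 1. In the application
  \<open>\<kappa> ^ k\<close> stands for \<open>k\<close> failed slabs and the power of
  \<open>k + 1\<close> for the \<open>j\<close> columns that must contain red within a height
  proportional to \<open>k + 1\<close>.\<close>

lemma summable_geometric_times_poly:
  fixes \<kappa> :: real
  assumes "0 \<le> \<kappa>" "\<kappa> < 1"
  shows "summable (\<lambda>k. \<kappa> ^ k * (real k + 1) ^ j)"
proof -
  obtain c where c: "\<kappa> < c" "c < 1" using dense assms(2) by blast
  have "(\<lambda>k :: nat. (real k + 2) / (real k + 1)) \<longlonglongrightarrow> 1" by real_asymp
  then have "(\<lambda>k :: nat. \<kappa> * ((real k + 2) / (real k + 1)) ^ j) \<longlonglongrightarrow> \<kappa> * 1 ^ j"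
    by (intro tendsto_intros)
  then have "\<forall>\<^sub>F k in sequentially. \<kappa> * ((real k + 2) / (real k + 1)) ^ j < c"
    using c by (intro order_tendstoD(2)) auto
  then obtain N where N: "\<kappa> * ((real k + 2) / (real k + 1)) ^ j < c" if "k \<ge> N" for k
    by (auto simp: eventually_sequentially)
  show ?thesis
  proof (rule summable_ratio_test[OF c(2)])
    fix k assume "k \<ge> N"
    then have "\<kappa> * (real k + 2) ^ j \<le> c * (real k + 1) ^ j"
      using N[of k] by (simp add: power_divide field_simps)
    then have "\<kappa> ^ k * (\<kappa> * (real k + 2) ^ j) \<le> \<kappa> ^ k * (c * (real k + 1) ^ j)"
      using assms by (intro mult_left_mono) auto
    then show "norm (\<kappa> ^ Suc k * (real (Suc k) + 1) ^ j) \<le> c * norm (\<kappa> ^ k * (real k + 1) ^ j)"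
      using assms by (simp add: abs_mult mult_ac add_ac)
  qed
qed

context random_competition begin

text \<open>The disjunction in \<open>sep\<close> serves both stacks of slabs, the one going up and
  the one going down.\<close>

lemma pr_all_not_good_le:
  assumes \<kappa>: "\<And>a. pr (\<lambda>\<omega>. \<not> good_slab \<omega> x w m a) \<le> \<kappa>"
    and sep: "\<And>k l. k < l \<Longrightarrow> f k + 3 * int m \<le> f l \<or> f l + 3 * int m \<le> f k"
  shows "pr (\<lambda>\<omega>. \<forall>k\<in>{..<K :: nat}. \<not> good_slab \<omega> x w m (f k)) \<le> \<kappa> ^ K"
proof -
  have "{x - int w..x} \<times> {f k..<f k + 3 * int m} \<inter> {x - int w..x} \<times> {f l..<f l + 3 * int m} = {}"
    if "k \<noteq> l" for k l
    using sep[of k l] sep[of l k] that by (cases "k < l") auto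
  then have "pr (\<lambda>\<omega>. \<forall>k\<in>{..<K}. \<not> good_slab \<omega> x w m (f k))
      = (\<Prod>k\<in>{..<K}. pr (\<lambda>\<omega>. \<not> good_slab \<omega> x w m (f k)))"
    by (intro prob_Ball_determined[where I = "\<lambda>k. {x - int w..x} \<times> {f k..<f k + 3 * int m}"])
      (auto simp: disjoint_family_on_def intro: determined_by_Not determined_by_good_slab)
  also have "\<dots> \<le> (\<Prod>k\<in>{..<K}. \<kappa>)"
    by (intro prod_mono) (auto simp: \<kappa>)
  finally show ?thesis by simp
qed

text \<open>
  If all columns become red, let \<open>k\<close> be least such that each of them contains an initially red vertex
  in the first \<open>k + 1\<close> slabs above or below row \<open>0\<close>. Then the first \<open>k\<close> slabs on one of the two sides
  all fail to be good; the sum is over \<open>k\<close>.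
\<close>
lemma pr_columns_ever_red:
  assumes m: "int \<rho> * \<lfloor>(real w + 1) / r\<rfloor> \<le> int m" "m \<ge> 1"
    and j: "j \<le> \<tau>" "1 \<le> j"
    and \<kappa>: "0 \<le> \<kappa>" "\<kappa> < 1" "\<And>a. pr (\<lambda>\<omega>. \<not> good_slab \<omega> x w m a) \<le> \<kappa>"
  shows "pr (\<lambda>\<omega>. \<forall>c\<in>{x + 1..x + int j}. ever \<omega> Red (c, 0))
    \<le> (6 * real m * q) ^ j * (\<Sum>k. 2 * (\<kappa> ^ k * (real k + 1) ^ j))"
proof -
  define M where "M = 3 * int m"
  define C where "C = {x + 1..x + int j}"
  define Y where "Y k = {- (int k * M)..<int k * M}" for k :: nat
  define up where "up k \<omega> \<longleftrightarrow> (\<forall>i\<in>{..<k}. \<not> good_slab \<omega> x w m (int i * M))" for k :: nat and \<omega>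
  define down where "down k \<omega> \<longleftrightarrow> (\<forall>i\<in>{..<k}. \<not> good_slab \<omega> x w m (- ((int i + 1) * M)))"
    for k :: nat and \<omega>
  \<comment> \<open>The index counts the slabs that failed. Red is then required in one slab more,
    because the next slab may be the first to contain red in all columns.\<close>
  define A where "A k = {\<omega>. (up k \<omega> \<or> down k \<omega>) \<and> (\<forall>c\<in>C. red_in \<omega> c (Y (Suc k)))}" for k :: nat
  define I where "I k = {x - int w..x} \<times> Y k" for k
  have M1: "M \<ge> 1" using m(2) by (simp add: M_def)
  have Y_mono: "Y k \<subseteq> Y l" if "k \<le> l" for k l
  proof -
    have "int k * M \<le> int l * M" using that M1 by (intro mult_right_mono) auto
    then show ?thesis unfolding Y_def by auto
  qed
  have finC: "finite C" and finY: "finite (Y k)" and finI: "finite (I k)" for k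
    by (auto simp: C_def Y_def I_def)
  have up_row: "{int i * M..<int i * M + 3 * int m} \<subseteq> Y k" if "i < k" for i k
  proof -
    have "(int i + 1) * M \<le> int k * M" using that M1 by (intro mult_right_mono) auto
    moreover have "(int i + 1) * M = int i * M + 3 * int m" by (simp add: M_def algebra_simps)
    moreover have "0 \<le> int i * M" "0 \<le> int k * M" using M1 by simp_all
    ultimately show ?thesis unfolding Y_def by auto
  qed
  have down_row: "{- ((int i + 1) * M)..<- ((int i + 1) * M) + 3 * int m} \<subseteq> Y k" if "i < k" for i k
  proof -
    have "(int i + 1) * M \<le> int k * M" using that M1 by (intro mult_right_mono) auto
    moreover have "(int i + 1) * M = int i * M + 3 * int m" by (simp add: M_def algebra_simps)
    moreover have "0 \<le> int i * M" "0 \<le> int k * M" using M1 by simp_all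
    ultimately show ?thesis unfolding Y_def by auto
  qed
  have det_up: "determined_by (I k) (up k)" and det_down: "determined_by (I k) (down k)" for k
    unfolding up_def down_def I_def
    by (intro determined_by_ball determined_by_Not determined_by_mono[OF determined_by_good_slab]
        Sigma_mono order_refl up_row down_row, simp)+
  have det_red: "determined_by (C \<times> Y (Suc k)) (\<lambda>\<omega>. \<forall>c\<in>C. red_in \<omega> c (Y (Suc k)))" for k
    by (intro determined_by_ball determined_by_red_in) auto
  \<comment> \<open>The slabs end at column \<open>x\<close> and \<open>C\<close> begins at
    \<open>x + 1\<close>: failure of slabs is independent of red in the columns of
    \<open>C\<close>.\<close>
  have IC: "I k \<inter> C \<times> Y (Suc k) = {}" for k by (auto simp: I_def C_def)
  have pr_up: "pr (up k) \<le> \<kappa> ^ k" for k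
    unfolding up_def
  proof (rule pr_all_not_good_le[OF \<kappa>(3)])
    fix k l :: nat assume "k < l"
    then have "(int k + 1) * M \<le> int l * M" using M1 by (intro mult_right_mono) auto
    then show "int k * M + 3 * int m \<le> int l * M \<or> int l * M + 3 * int m \<le> int k * M"
      by (auto simp: M_def algebra_simps)
  qed
  have pr_down: "pr (down k) \<le> \<kappa> ^ k" for k
    unfolding down_def
  proof (rule pr_all_not_good_le[OF \<kappa>(3)])
    fix k l :: nat assume "k < l"
    then have "(int k + 1) * M \<le> int l * M" using M1 by (intro mult_right_mono) auto
    then show "- ((int k + 1) * M) + 3 * int m \<le> - ((int l + 1) * M) \<or>
        - ((int l + 1) * M) + 3 * int m \<le> - ((int k + 1) * M)"
      by (auto simp: M_def algebra_simps)
  qed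
  have cardY: "real (card (Y (Suc k))) = 6 * real m * (real k + 1)" for k
  proof -
    have "int (card (Y (Suc k))) = 2 * (int (Suc k) * M)"
      using M1 unfolding Y_def by simp
    then have "real_of_int (int (card (Y (Suc k)))) = real_of_int (2 * (int (Suc k) * M))" by simp
    then show ?thesis by (simp add: M_def algebra_simps)
  qed
  have pr_A: "P.prob (A k) \<le> (6 * real m * q) ^ j * (2 * (\<kappa> ^ k * (real k + 1) ^ j))" for k
  proof -
    have "P.prob (A k) = pr (\<lambda>\<omega>. up k \<omega> \<or> down k \<omega>) * pr (\<lambda>\<omega>. \<forall>c\<in>C. red_in \<omega> c (Y (Suc k)))"
      unfolding A_def
      by (rule prob_conj_determined[OF finI[of k] _ IC determined_by_disj[OF det_up det_down] det_red])
        (use finC finY in auto)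
    also have "\<dots> \<le> (2 * \<kappa> ^ k) * (card (Y (Suc k)) * q) ^ card C"
    proof (intro mult_mono pr_columns_red_le finC finY)
      have "pr (\<lambda>\<omega>. up k \<omega> \<or> down k \<omega>) \<le> pr (up k) + pr (down k)"
        by (intro prob_disj_le determined_sets[OF finI det_up] determined_sets[OF finI det_down])
      then show "pr (\<lambda>\<omega>. up k \<omega> \<or> down k \<omega>) \<le> 2 * \<kappa> ^ k"
        using pr_up[of k] pr_down[of k] by linarith
    qed (use \<kappa> in auto)
    also have "card C = j" by (simp add: C_def)
    also have "real (card (Y (Suc k))) * q = (6 * real m * q) * (real k + 1)"
      by (simp add: cardY algebra_simps)
    finally show ?thesis
      unfolding power_mult_distrib[of "6 * real m * q" "real k + 1"] by (simp only: mult_ac)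
  qed
  have A_events: "A k \<in> P.events" for k
    unfolding A_def
    by (rule determined_sets[of "I k \<union> C \<times> Y (Suc k)"])
      (use finI finC finY in \<open>auto intro!: determined_by_conj determined_by_disj
        intro: determined_by_mono[OF det_up[of k]] determined_by_mono[OF det_down[of k]] determined_by_mono[OF det_red]\<close>)
  have cover: "\<exists>k. \<omega> \<in> A k" if red: "\<forall>c\<in>C. ever \<omega> Red (c, 0)" for \<omega>
  proof -
    define Q where "Q k \<longleftrightarrow> (\<forall>c\<in>C. red_in \<omega> c (Y k))" for k
    have "\<exists>k. red_in \<omega> c (Y k)" if "c \<in> C" for c
    proof -
      obtain k :: nat where "red_in \<omega> c {0 - int k..<0 + int k}"
        using ever_red_red_in red \<open>c \<in> C\<close> by blast
      moreover have "int k * 1 \<le> int k * M" using M1 by (intro mult_left_mono) auto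
      then have "{0 - int k..<0 + int k} \<subseteq> Y k" unfolding Y_def by auto
      ultimately show ?thesis unfolding red_in_def by blast
    qed
    then obtain f where f: "\<And>c. c \<in> C \<Longrightarrow> red_in \<omega> c (Y (f c))" by metis
    have "Q (Max (f ` C))"
      unfolding Q_def
    proof
      fix c assume "c \<in> C"
      then have "Y (f c) \<subseteq> Y (Max (f ` C))" using finC by (intro Y_mono Max_ge) auto
      then show "red_in \<omega> c (Y (Max (f ` C)))" using f[OF \<open>c \<in> C\<close>] unfolding red_in_def by blast
    qed
    then have ex: "\<exists>k. Q k" by blast
    \<comment> \<open>\<open>Y 0\<close> is empty and \<open>C\<close> is not, as
      \<open>1 \<le> j\<close>; so the least index is a successor.\<close>
    have "\<not> Q 0" using j by (auto simp: Q_def red_in_def Y_def C_def)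
    define k where "k = (LEAST k. Q k)"
    have Qk: "Q k" unfolding k_def using ex by (rule LeastI_ex)
    then obtain l where l: "k = Suc l" using \<open>\<not> Q 0\<close> by (cases k) auto
    have "\<not> Q l" using not_less_Least[of l Q] l unfolding k_def by simp
    then obtain c where c: "c \<in> C" "\<not> red_in \<omega> c (Y l)" by (auto simp: Q_def)
    \<comment> \<open>Column \<open>c\<close> has no red in the first \<open>l\<close> slabs on
      either side. A good slab on each side among these would keep \<open>(c, 0)\<close> from ever
      being red.\<close>
    have "up l \<omega> \<or> down l \<omega>"
    proof (rule ccontr)
      assume "\<not> (up l \<omega> \<or> down l \<omega>)"
      then obtain i i' where i: "i < l" "good_slab \<omega> x w m (int i * M)"
        and i': "i' < l" "good_slab \<omega> x w m (- ((int i' + 1) * M))"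
        by (auto simp: up_def down_def)
      have "\<not> red_in \<omega> c {- ((int i' + 1) * M)..<int i * M + 3 * int m}"
      proof -
        have "{- ((int i' + 1) * M)..<int i * M + 3 * int m} \<subseteq> Y l"
        proof -
          have "(int i + 1) * M \<le> int l * M" "(int i' + 1) * M \<le> int l * M"
            using i i' M1 by (auto intro!: mult_right_mono)
          moreover have "(int i + 1) * M = int i * M + 3 * int m" by (simp add: M_def algebra_simps)
          ultimately show ?thesis unfolding Y_def by auto
        qed
        then show ?thesis using c(2) unfolding red_in_def by blast
      qed
      moreover have "0 \<le> int i * M" "- ((int i' + 1) * M) + 3 * int m \<le> 0"
        using M1 by (simp_all add: M_def algebra_simps)
      ultimately have "\<not> ever \<omega> Red (c, 0)"
        using c(1) j(1) by (intro good_slabs_block_red[OF m i(2) _ i'(2)]) (auto simp: C_def)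
      then show False using red c(1) by blast
    qed
    then have "\<omega> \<in> A l" using Qk l by (auto simp: A_def Q_def)
    then show ?thesis ..
  qed
  have sum: "summable (\<lambda>k. (6 * real m * q) ^ j * (2 * (\<kappa> ^ k * (real k + 1) ^ j)))"
    using summable_geometric_times_poly[OF \<kappa>(1,2), of j] by (intro summable_mult)
  then have sumA: "summable (\<lambda>k. P.prob (A k))"
    by (rule summable_comparison_test'[of _ 0]) (use pr_A in auto)
  have "pr (\<lambda>\<omega>. \<forall>c\<in>C. ever \<omega> Red (c, 0)) \<le> P.prob (\<Union>k. A k)"
    using cover A_events by (intro P.finite_measure_mono) auto
  also have "\<dots> \<le> (\<Sum>k. P.prob (A k))"
    by (rule P.finite_measure_subadditive_countably) (use A_events sumA in auto)
  also have "\<dots> \<le> (\<Sum>k. (6 * real m * q) ^ j * (2 * (\<kappa> ^ k * (real k + 1) ^ j)))"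
    by (rule suminf_le[OF pr_A sumA sum])
  also have "\<dots> = (6 * real m * q) ^ j * (\<Sum>k. 2 * (\<kappa> ^ k * (real k + 1) ^ j))"
    using summable_geometric_times_poly[OF \<kappa>(1,2), of j] by (intro suminf_mult summable_mult)
  finally show ?thesis unfolding C_def .
qed

text \<open>Membership in the information carried by the set of initially red vertices. Conditioning
  on that set is expressed by inequalities for joint events, without conditional measures.\<close>

definition red_determined :: "((vertex \<Rightarrow> color \<times> bool) \<Rightarrow> bool) \<Rightarrow> bool" where
  "red_determined E \<longleftrightarrow> (\<forall>\<omega> \<omega>'. (\<forall>v. init \<omega> v = Red \<longleftrightarrow> init \<omega>' v = Red) \<longrightarrow> E \<omega> = E \<omega>')"

text \<open>
  Given the set of initially red vertices, the other vertices are blue independently with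
  probability \<open>p / (1 - q)\<close>; this is the form in which that fact is needed.
\<close>
lemma pr_conj_init_Blue_le:
  assumes I: "finite I" "determined_by I E"
    and ins: "\<And>\<omega> s. E \<omega> \<Longrightarrow> init \<omega> v \<noteq> Red \<Longrightarrow> fst s \<noteq> Red \<Longrightarrow> E (fun_upd \<omega> v s)"
  shows "pr (\<lambda>\<omega>. E \<omega> \<and> init \<omega> v = Blue) \<le> p / (1 - q) * pr E"
proof -
  \<comment> \<open>Freezing the state of \<open>v\<close> at some non-red value removes the
    dependence on \<open>v\<close>, and \<open>E'\<close> still agrees with \<open>E\<close>
    wherever \<open>v\<close> is not red. Thus \<open>E'\<close> is independent of the state of
    \<open>v\<close>.\<close>
  define E' where "E' \<omega> = E (fun_upd \<omega> v (Empty, False))" for \<omega>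
  have E'_iff: "E' \<omega> \<longleftrightarrow> E \<omega>" if "init \<omega> v \<noteq> Red" for \<omega>
  proof
    assume "E \<omega>"
    then show "E' \<omega>" using ins that by (simp add: E'_def)
  next
    assume "E' \<omega>"
    then show "E \<omega>"
      using ins[of "fun_upd \<omega> v (Empty, False)" "\<omega> v"] that by (simp add: E'_def)
  qed
  have det: "determined_by (I - {v}) E'"
  proof (rule determined_byI)
    fix \<omega> \<omega>' assume "\<And>i. i \<in> I - {v} \<Longrightarrow> \<omega> i = \<omega>' i" "E' \<omega>"
    then show "E' \<omega>'"
      unfolding E'_def
      using determined_byD[OF I(2), of "fun_upd \<omega> v (Empty, False)" "fun_upd \<omega>' v (Empty, False)"] by simp
  qed
  have det_v: "determined_by {v} (\<lambda>\<omega>. init \<omega> v = c)" for c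
    by (rule determined_by_coord[where Q = "\<lambda>s. fst s = c"]) simp
  have eqB: "(\<lambda>\<omega>. E \<omega> \<and> init \<omega> v = Blue) = (\<lambda>\<omega>. E' \<omega> \<and> init \<omega> v = Blue)"
    using E'_iff by fastforce
  have eqR: "(\<lambda>\<omega>. E \<omega> \<and> init \<omega> v \<noteq> Red) = (\<lambda>\<omega>. E' \<omega> \<and> init \<omega> v \<noteq> Red)"
    using E'_iff by fastforce
  have B: "pr (\<lambda>\<omega>. E \<omega> \<and> init \<omega> v = Blue) = pr E' * p"
    unfolding eqB using prob_conj_determined[OF _ _ _ det det_v, of Blue] I(1) by (simp add: pr_init_Blue)
  have "pr (\<lambda>\<omega>. init \<omega> v \<noteq> Red) = 1 - q"
    using prob_Not_determined[OF _ det_v, of Red] by (simp add: pr_init_Red)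
  then have R: "pr (\<lambda>\<omega>. E \<omega> \<and> init \<omega> v \<noteq> Red) = pr E' * (1 - q)"
    unfolding eqR using prob_conj_determined[OF _ _ _ det determined_by_Not[OF det_v], of Red] I(1)
    by simp
  have "pr E' * (1 - q) \<le> pr E"
    unfolding R[symmetric] by (rule prob_le_determined[OF I]) simp
  moreover have "1 - q > 0" using p_pos pq_le by simp
  ultimately have "pr E' * p \<le> (pr E / (1 - q)) * p"
    using p_pos by (intro mult_right_mono) (simp_all add: field_simps)
  then show ?thesis unfolding B by (simp add: mult_ac)
qed

lemma pr_conj_blue_in_le:
  assumes I: "finite I" "determined_by I E" and X: "finite X"
    and ins: "\<And>\<omega> s x. E \<omega> \<Longrightarrow> x \<in> X \<Longrightarrow> init \<omega> (x, y) \<noteq> Red \<Longrightarrow> fst s \<noteq> Red \<Longrightarrow> E (fun_upd \<omega> (x, y) s)"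
  shows "pr (\<lambda>\<omega>. E \<omega> \<and> blue_in \<omega> X y) \<le> card X * p / (1 - q) * pr E"
proof -
  have "pr (\<lambda>\<omega>. E \<omega> \<and> blue_in \<omega> X y) = pr (\<lambda>\<omega>. \<exists>x\<in>X. E \<omega> \<and> init \<omega> (x, y) = Blue)"
    unfolding blue_in_def by (rule arg_cong[where f = P.prob]) blast
  also have "\<dots> \<le> card X * (p / (1 - q) * pr E)"
  proof (rule prob_Bex_le_card[OF X])
    fix x assume x: "x \<in> X"
    show "{\<omega>. E \<omega> \<and> init \<omega> (x, y) = Blue} \<in> P.events"
      by (rule determined_sets[of "insert (x, y) I"])
        (use I in \<open>auto intro!: determined_by_conj determined_by_coord[where Q = "\<lambda>s. fst s = Blue"]
          intro: determined_by_mono[OF I(2)]\<close>)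
    show "pr (\<lambda>\<omega>. E \<omega> \<and> init \<omega> (x, y) = Blue) \<le> p / (1 - q) * pr E"
      by (rule pr_conj_init_Blue_le[OF I]) (rule ins[OF _ x])
  qed
  finally show ?thesis by simp
qed

text \<open>The rows are added one at a time. Once blue has been required in a row, the event is in
  general no longer \<open>red_determined\<close>; it is only insensitive to non-red changes in the
  next row. That is why \<open>pr_conj_blue_in_le\<close> asks for insensitivity on a single
  row.\<close>

lemma pr_conj_blue_rows_le:
  assumes I: "finite I" "determined_by I E" and E: "red_determined E" and X: "finite X"
  shows "pr (\<lambda>\<omega>. E \<omega> \<and> (\<forall>j\<in>{0..<int n}. blue_in \<omega> X (b + j))) \<le> (card X * p / (1 - q)) ^ n * pr E"
proof (induction n)
  case 0
  then show ?case by simp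
next
  case (Suc n)
  define F where "F \<omega> \<longleftrightarrow> E \<omega> \<and> (\<forall>j\<in>{0..<int n}. blue_in \<omega> X (b + j))" for \<omega>
  let ?J = "I \<union> X \<times> {b..<b + int n}"
  have det: "determined_by ?J F"
    unfolding F_def
    by (intro determined_by_conj determined_by_ball determined_by_blue_in determined_by_mono[OF I(2)]) auto
  have ins: "F (fun_upd \<omega> (x, b + int n) s)"
    if "F \<omega>" "init \<omega> (x, b + int n) \<noteq> Red" "fst s \<noteq> Red" for \<omega> s x
  proof -
    let ?\<omega> = "fun_upd \<omega> (x, b + int n) s"
    have "E ?\<omega> = E \<omega>"
      using E[unfolded red_determined_def, rule_format, of ?\<omega> \<omega>] that by auto
    moreover have "blue_in ?\<omega> X (b + j) = blue_in \<omega> X (b + j)" if "j \<in> {0..<int n}" for j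
      unfolding blue_in_def using that by (intro bex_cong) auto
    ultimately show ?thesis using that(1) unfolding F_def by simp
  qed
  have "(\<lambda>\<omega>. E \<omega> \<and> (\<forall>j\<in>{0..<int (Suc n)}. blue_in \<omega> X (b + j)))
      = (\<lambda>\<omega>. F \<omega> \<and> blue_in \<omega> X (b + int n))"
  proof -
    have "{0..<int (Suc n)} = insert (int n) {0..<int n}" by auto
    then show ?thesis unfolding F_def by auto
  qed
  then have "pr (\<lambda>\<omega>. E \<omega> \<and> (\<forall>j\<in>{0..<int (Suc n)}. blue_in \<omega> X (b + j)))
      = pr (\<lambda>\<omega>. F \<omega> \<and> blue_in \<omega> X (b + int n))" by simp
  also have "\<dots> \<le> card X * p / (1 - q) * pr F"
    by (rule pr_conj_blue_in_le[OF _ det X ins]) (use I X in auto)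
  also have "\<dots> \<le> card X * p / (1 - q) * ((card X * p / (1 - q)) ^ n * pr E)"
    using Suc.IH p_pos q_pos pq_le unfolding F_def by (intro mult_left_mono) auto
  finally show ?case by simp
qed

lemma pr_conj_blue_block_le:
  assumes I: "finite I" "determined_by I E" and E: "red_determined E" and X: "finite X"
  shows "pr (\<lambda>\<omega>. E \<omega> \<and> (\<exists>b\<in>{1..int h - int \<rho>}. \<forall>j\<in>{0..<int \<rho>}. blue_in \<omega> X (b + j)))
    \<le> real h * (card X * p / (1 - q)) ^ \<rho> * pr E"
proof -
  have "pr (\<lambda>\<omega>. E \<omega> \<and> (\<exists>b\<in>{1..int h - int \<rho>}. \<forall>j\<in>{0..<int \<rho>}. blue_in \<omega> X (b + j)))
     = pr (\<lambda>\<omega>. \<exists>b\<in>{1..int h - int \<rho>}. E \<omega> \<and> (\<forall>j\<in>{0..<int \<rho>}. blue_in \<omega> X (b + j)))"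
    by (rule arg_cong[where f = P.prob]) blast
  also have "\<dots> \<le> card {1..int h - int \<rho>} * ((card X * p / (1 - q)) ^ \<rho> * pr E)"
  proof (rule prob_Bex_le_card)
    fix b
    show "{\<omega>. E \<omega> \<and> (\<forall>j\<in>{0..<int \<rho>}. blue_in \<omega> X (b + j))} \<in> P.events"
      by (rule determined_sets[of "I \<union> X \<times> {b..<b + int \<rho>}"])
        (use I X in \<open>auto intro!: determined_by_conj determined_by_ball determined_by_blue_in
          intro: determined_by_mono[OF I(2)]\<close>)
    show "pr (\<lambda>\<omega>. E \<omega> \<and> (\<forall>j\<in>{0..<int \<rho>}. blue_in \<omega> X (b + j))) \<le> (card X * p / (1 - q)) ^ \<rho> * pr E"
      by (rule pr_conj_blue_rows_le[OF I E X])
  qed simp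
  also have "\<dots> \<le> real h * ((card X * p / (1 - q)) ^ \<rho> * pr E)"
    using p_pos pq_le q_pos by (intro mult_right_mono mult_nonneg_nonneg) auto
  finally show ?thesis by (simp add: mult_ac)
qed

text \<open>
  The first \<open>k\<close> whose columns all contain an initially red vertex near row \<open>0\<close> is determined by the
  red vertices, so the bound on blue blocks applies to it without a union bound over \<open>k\<close>.
\<close>
lemma pr_no_red_barrier:
  fixes X :: "nat \<Rightarrow> int" and D :: nat
  assumes sep: "\<And>k l. k < l \<Longrightarrow> X k + int \<tau> \<le> X l \<or> X l + int \<tau> \<le> X k"
  shows "pr (\<lambda>\<omega>. \<not> (\<exists>k\<in>{..<N}. (\<forall>c\<in>{X k + 1..X k + int \<tau>}. red_in \<omega> c {1..int h}) \<and>
      \<not> (\<exists>b\<in>{1..int h - int \<rho>}. \<forall>j\<in>{0..<int \<rho>}.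
          blue_in \<omega> {X k + 1 - int D..X k + int \<tau> + int D} (b + j))))
    \<le> (1 - (1 - (1 - q) ^ h) ^ \<tau>) ^ N + real h * ((2 * real D + real \<tau>) * p / (1 - q)) ^ \<rho>"
proof -
  define C where "C k = {X k + 1..X k + int \<tau>}" for k
  define W where "W k = {X k + 1 - int D..X k + int \<tau> + int D}" for k
  define tall where "tall k \<omega> \<longleftrightarrow> (\<forall>c\<in>C k. red_in \<omega> c {1..int h})" for k \<omega>
  define bad where "bad k \<omega> \<longleftrightarrow> (\<exists>b\<in>{1..int h - int \<rho>}. \<forall>j\<in>{0..<int \<rho>}. blue_in \<omega> (W k) (b + j))" for k \<omega>
  define first where "first k \<omega> \<longleftrightarrow> tall k \<omega> \<and> (\<forall>l\<in>{..<k}. \<not> tall l \<omega>)" for k \<omega>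
  define \<beta> where "\<beta> = real h * ((2 * real D + real \<tau>) * p / (1 - q)) ^ \<rho>"
  have \<beta>0: "\<beta> \<ge> 0" using p_pos pq_le q_pos by (simp add: \<beta>_def)
  have disj: "C k \<inter> C l = {}" if "k \<noteq> l" for k l
    using sep[of k l] sep[of l k] that unfolding C_def by (cases "k < l") auto
  have det_tall: "determined_by (C k \<times> {1..int h}) (tall k)" for k
    unfolding tall_def by (intro determined_by_ball determined_by_red_in) auto
  have finC: "finite (C k)" for k by (simp add: C_def)
  have pr_tall: "pr (tall k) = (1 - (1 - q) ^ h) ^ \<tau>" for k
    unfolding tall_def using pr_columns_red[of "C k" "{1..int h}"] by (simp add: C_def)
  define J where "J k = (\<Union>l\<in>{..k}. C l \<times> {1..int h})" for k
  have finJ: "finite (J k)" for k by (simp add: J_def C_def)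
  have det_first: "determined_by (J k) (first k)" for k
    unfolding first_def J_def
    by (intro determined_by_conj determined_by_ball determined_by_Not determined_by_mono[OF det_tall])
      (auto, meson atMost_iff less_imp_le)
  have red_first: "red_determined (first k)" for k
    unfolding red_determined_def first_def tall_def red_in_def by simp
  have ev_first: "{\<omega>. first k \<omega>} \<in> P.events" for k
    by (rule determined_sets[OF finJ det_first])
  have det_bad: "determined_by (W k \<times> {1..int h}) (bad k)" for k
    unfolding bad_def by (intro determined_by_bex determined_by_ball determined_by_blue_in) auto
  have ev_first_bad: "{\<omega>. first k \<omega> \<and> bad k \<omega>} \<in> P.events" for k
    by (rule determined_sets[of "J k \<union> W k \<times> {1..int h}"])
      (use finJ in \<open>auto simp: W_def[of k] intro!: determined_by_conj
        intro: determined_by_mono[OF det_first[of k]] determined_by_mono[OF det_bad[of k, unfolded W_def]]\<close>)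
  have first_bad: "pr (\<lambda>\<omega>. first k \<omega> \<and> bad k \<omega>) \<le> \<beta> * pr (first k)" for k
  proof -
    have "real (card (W k)) = 2 * real D + real \<tau>" unfolding W_def by simp
    then show ?thesis
      using pr_conj_blue_block_le[OF finJ det_first red_first, of "W k" k h]
      unfolding bad_def \<beta>_def by (simp add: W_def add.commute)
  qed
  have none: "pr (\<lambda>\<omega>. \<forall>k\<in>{..<N}. \<not> tall k \<omega>) = (1 - (1 - (1 - q) ^ h) ^ \<tau>) ^ N"
  proof -
    have "pr (\<lambda>\<omega>. \<forall>k\<in>{..<N}. \<not> tall k \<omega>) = (\<Prod>k\<in>{..<N}. pr (\<lambda>\<omega>. \<not> tall k \<omega>))"
    proof (rule prob_Ball_determined[where I = "\<lambda>k. C k \<times> {1..int h}"])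
      show "disjoint_family_on (\<lambda>k. C k \<times> {1..int h}) {..<N}"
        unfolding disjoint_family_on_def using disj by blast
    qed (use finC det_tall in \<open>auto intro: determined_by_Not\<close>)
    also have "\<dots> = (\<Prod>k\<in>{..<N}. 1 - (1 - (1 - q) ^ h) ^ \<tau>)"
      using prob_Not_determined[OF _ det_tall] finC pr_tall by simp
    finally show ?thesis by simp
  qed
  \<comment> \<open>The events \<open>first k\<close> are disjoint, so \<open>\<beta>\<close> is
    paid once and not \<open>N\<close> times.\<close>
  have sum_first: "(\<Sum>k\<in>{..<N}. pr (first k)) \<le> 1"
  proof -
    have "disjoint_family_on (\<lambda>k. {\<omega>. first k \<omega>}) {..<N}"
      unfolding disjoint_family_on_def
    proof (intro ballI impI)
      fix k l :: nat assume "k \<noteq> l"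
      then show "{\<omega>. first k \<omega>} \<inter> {\<omega>. first l \<omega>} = {}"
        unfolding first_def by (cases "k < l") auto
    qed
    then have "P.prob (\<Union>k\<in>{..<N}. {\<omega>. first k \<omega>}) = (\<Sum>k\<in>{..<N}. pr (first k))"
      using ev_first by (intro P.finite_measure_finite_Union) auto
    then show ?thesis using P.prob_le_1 by metis
  qed
  have incl: "(\<forall>k\<in>{..<N}. \<not> tall k \<omega>) \<or> (\<exists>k\<in>{..<N}. first k \<omega> \<and> bad k \<omega>)"
    if "\<not> (\<exists>k\<in>{..<N}. tall k \<omega> \<and> \<not> bad k \<omega>)" for \<omega>
  proof (cases "\<forall>k\<in>{..<N}. \<not> tall k \<omega>")
    case False
    then obtain k where k: "k < N" "tall k \<omega>" by auto
    define l where "l = (LEAST l. tall l \<omega>)"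
    have l: "tall l \<omega>" "l \<le> k" unfolding l_def using k(2) by (rule LeastI, rule Least_le)
    moreover have "\<not> tall i \<omega>" if "i < l" for i
      using not_less_Least[of i "\<lambda>l. tall l \<omega>"] that by (simp add: l_def)
    ultimately have "first l \<omega>" "l \<in> {..<N}" using k by (auto simp: first_def)
    then show ?thesis using that l(1) by blast
  qed simp
  have ev_none: "{\<omega>. \<forall>k\<in>{..<N}. \<not> tall k \<omega>} \<in> P.events"
    by (rule determined_sets[OF finJ[of N]], unfold J_def,
        intro determined_by_ball determined_by_Not determined_by_mono[OF det_tall])
      (auto, meson atMost_iff less_imp_le)
  have ev_fb: "{\<omega>. \<exists>k\<in>{..<N}. first k \<omega> \<and> bad k \<omega>} \<in> P.events"
  proof -
    have "{\<omega>. \<exists>k\<in>{..<N}. first k \<omega> \<and> bad k \<omega>} = (\<Union>k\<in>{..<N}. {\<omega>. first k \<omega> \<and> bad k \<omega>})" by auto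
    then show ?thesis using ev_first_bad by auto
  qed
  have "pr (\<lambda>\<omega>. \<not> (\<exists>k\<in>{..<N}. tall k \<omega> \<and> \<not> bad k \<omega>)) \<le>
      pr (\<lambda>\<omega>. (\<forall>k\<in>{..<N}. \<not> tall k \<omega>) \<or> (\<exists>k\<in>{..<N}. first k \<omega> \<and> bad k \<omega>))"
    using incl ev_none ev_fb by (intro P.finite_measure_mono) (auto simp only: Collect_disj_eq mem_Collect_eq sets.Un)
  also have "\<dots> \<le> pr (\<lambda>\<omega>. \<forall>k\<in>{..<N}. \<not> tall k \<omega>) + pr (\<lambda>\<omega>. \<exists>k\<in>{..<N}. first k \<omega> \<and> bad k \<omega>)"
    by (rule prob_disj_le[OF ev_none ev_fb])
  also have "pr (\<lambda>\<omega>. \<exists>k\<in>{..<N}. first k \<omega> \<and> bad k \<omega>) \<le> (\<Sum>k\<in>{..<N}. pr (\<lambda>\<omega>. first k \<omega> \<and> bad k \<omega>))"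
    by (rule prob_Bex_le[OF _ ev_first_bad]) simp
  also have "\<dots> \<le> (\<Sum>k\<in>{..<N}. \<beta> * pr (first k))" by (intro sum_mono first_bad)
  also have "\<dots> = \<beta> * (\<Sum>k\<in>{..<N}. pr (first k))" by (simp add: sum_distrib_left)
  also have "\<dots> \<le> \<beta> * 1" using sum_first \<beta>0 by (rule mult_left_mono)
  finally have bound: "pr (\<lambda>\<omega>. \<not> (\<exists>k\<in>{..<N}. tall k \<omega> \<and> \<not> bad k \<omega>)) \<le>
      pr (\<lambda>\<omega>. \<forall>k\<in>{..<N}. \<not> tall k \<omega>) + \<beta>" by simp
  show ?thesis
    using bound[unfolded none, unfolded tall_def bad_def C_def W_def \<beta>_def] .
qed

text \<open>If row \<open>0\<close> has no blue within distance \<open>L\<close> and a barrier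
  without blue blocks lies on each side of the origin, red descends in \<open>\<tau>\<close>
  consecutive columns on each side and \<open>blue_confined\<close> applies. The condition on
  \<open>L\<close> makes room for \<open>N\<close> candidates of width \<open>\<tau>\<close> and a
  margin \<open>D\<close> on either side.\<close>

lemma pr_ever_Blue_le:
  fixes h D N L :: nat
  assumes D: "int \<tau> * \<lfloor>real h * r\<rfloor> \<le> int D" and L: "N * \<tau> + D \<le> L"
  shows "pr (\<lambda>\<omega>. ever \<omega> Blue (0, 0)) \<le> (2 * real L + 1) * p
    + 2 * ((1 - (1 - (1 - q) ^ h) ^ \<tau>) ^ N + real h * ((2 * real D + real \<tau>) * p / (1 - q)) ^ \<rho>)"
proof -
  define barrier where "barrier x \<omega> \<longleftrightarrow> (\<forall>c\<in>{x + 1..x + int \<tau>}. red_in \<omega> c {1..int h}) \<and>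
      \<not> (\<exists>b\<in>{1..int h - int \<rho>}. \<forall>j\<in>{0..<int \<rho>}.
          blue_in \<omega> {x + 1 - int D..x + int \<tau> + int D} (b + j))" for x \<omega>
  define B where "B = (1 - (1 - (1 - q) ^ h) ^ \<tau>) ^ N + real h * ((2 * real D + real \<tau>) * p / (1 - q)) ^ \<rho>"
  \<comment> \<open>The candidates tile the columns \<open>1, 2, \<dots>\<close> on the right and
    \<open>-1, -2, \<dots>\<close> on the left, leaving out column \<open>0\<close>.\<close>
  define XR XL where "XR k = int k * int \<tau>" and "XL k = - ((int k + 1) * int \<tau>) - 1" for k :: nat
  let ?E1 = "\<lambda>\<omega>. blue_in \<omega> {- int L..int L} 0"
  let ?E2 = "\<lambda>\<omega>. \<not> (\<exists>k\<in>{..<N}. barrier (XR k) \<omega>)"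
  let ?E3 = "\<lambda>\<omega>. \<not> (\<exists>k\<in>{..<N}. barrier (XL k) \<omega>)"
  have det: "determined_by ({x + 1 - int D..x + int \<tau> + int D} \<times> {1..int h}) (barrier x)" for x
    unfolding barrier_def
    by (intro determined_by_conj determined_by_Not determined_by_bex determined_by_ball
      determined_by_blue_in determined_by_red_in) auto
  have ev: "{\<omega>. \<not> (\<exists>k\<in>{..<N}. barrier (X k) \<omega>)} \<in> P.events" for X :: "nat \<Rightarrow> int"
    by (rule determined_sets[of "\<Union>k\<in>{..<N}. {X k + 1 - int D..X k + int \<tau> + int D} \<times> {1..int h}"])
      (simp, intro determined_by_bex determined_by_Not determined_by_mono[OF det] UN_upper)
  have ev1: "{\<omega>. ?E1 \<omega>} \<in> P.events" by (rule blue_in_events) simp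
  have mono: "(int k + 1) * int \<tau> \<le> int l * int \<tau>" if "k < l" for k l
    using that by (intro mult_right_mono) auto
  have b2: "pr ?E2 \<le> B"
    unfolding barrier_def B_def
  proof (rule pr_no_red_barrier)
    show "XR k + int \<tau> \<le> XR l \<or> XR l + int \<tau> \<le> XR k" if "k < l" for k l
      using mono[OF that] by (simp add: XR_def algebra_simps)
  qed
  have b3: "pr ?E3 \<le> B"
    unfolding barrier_def B_def
  proof (rule pr_no_red_barrier)
    show "XL k + int \<tau> \<le> XL l \<or> XL l + int \<tau> \<le> XL k" if "k < l" for k l
      using mono[OF that] by (simp add: XL_def algebra_simps)
  qed
  have b1: "pr ?E1 \<le> (2 * real L + 1) * p"
    using pr_blue_in_le[of "{- int L..int L}" 0] by (simp add: nat_add_distrib add.commute)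
  have barrier_red: "ever \<omega> Red (c, 0)"
    if b: "barrier x \<omega>" and nb: "\<not> ?E1 \<omega>" and c: "c \<in> {x + 1..x + int \<tau>}"
      and x: "- int L \<le> x + 1 - int D" "x + int \<tau> + int D \<le> int L" for x \<omega> c
  proof (rule red_descends[where h = h and D = "int D"])
    have sub: "{c - int D..c + int D} \<subseteq> {x + 1 - int D..x + int \<tau> + int D}" using c by auto
    show "red_in \<omega> c {1..int h}" using b c by (simp add: barrier_def)
    show "int \<tau> * \<lfloor>real h * r\<rfloor> \<le> int D" by (rule D)
    show "\<not> blue_in \<omega> {c - int D..c + int D} 0"
      using nb sub x unfolding blue_in_def by fastforce
    show "\<exists>j\<in>{0..<int \<rho>}. \<not> blue_in \<omega> {c - int D..c + int D} (b + j)"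
      if "1 \<le> b" "b + int \<rho> \<le> int h" for b
    proof -
      have "b \<in> {1..int h - int \<rho>}" using that by auto
      then obtain j where "j \<in> {0..<int \<rho>}"
        "\<not> blue_in \<omega> {x + 1 - int D..x + int \<tau> + int D} (b + j)"
        using \<open>barrier x \<omega>\<close> unfolding barrier_def by blast
      then show ?thesis using sub unfolding blue_in_def by blast
    qed
  qed
  have incl: "?E1 \<omega> \<or> ?E2 \<omega> \<or> ?E3 \<omega>" if blue: "ever \<omega> Blue (0, 0)" for \<omega>
  proof (rule ccontr)
    assume *: "\<not> (?E1 \<omega> \<or> ?E2 \<omega> \<or> ?E3 \<omega>)"
    then obtain k l where k: "k < N" "barrier (XR k) \<omega>" and l: "l < N" "barrier (XL l) \<omega>"
      and nb: "\<not> ?E1 \<omega>" by auto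
    have kL: "XR k + int \<tau> + int D \<le> int L" and lL: "- int L \<le> XL l + 1 - int D"
    proof -
      have "int N * int \<tau> + int D \<le> int L" using L by (metis of_nat_add of_nat_le_iff of_nat_mult)
      then show "XR k + int \<tau> + int D \<le> int L" "- int L \<le> XL l + 1 - int D"
        using mono[OF k(1)] mono[OF l(1)] by (simp_all add: XR_def XL_def algebra_simps)
    qed
    have k0: "0 \<le> XR k" and l0: "XL l + int \<tau> \<le> - 1" using tau_pos by (simp_all add: XR_def XL_def algebra_simps)
    have redR: "ever \<omega> Red (XR k + 1 + j, 0)" if "j \<in> {0..<int \<tau>}" for j
      by (rule barrier_red[OF k(2) nb]) (use that kL k0 in auto)
    have redL: "ever \<omega> Red (XL l + 1 + j, 0)" if "j \<in> {0..<int \<tau>}" for j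
      by (rule barrier_red[OF l(2) nb]) (use that lL l0 kL k0 in auto)
    have "\<not> ever \<omega> Blue (0, 0)"
    proof (rule blue_confined[OF redR redL])
      show "\<not> blue_in \<omega> {XL l + 1..<XR k + 1 + int \<tau>} 0"
        using nb kL lL unfolding blue_in_def by fastforce
      show "0 \<in> {XL l + 1..<XR k + 1 + int \<tau>}" using k0 l0 tau_pos by auto
    qed
    then show False using blue by contradiction
  qed
  have ev23: "{\<omega>. ?E2 \<omega> \<or> ?E3 \<omega>} \<in> P.events"
    using ev[of XR] ev[of XL] by (simp only: Collect_disj_eq sets.Un)
  have "pr (\<lambda>\<omega>. ever \<omega> Blue (0, 0)) \<le> pr (\<lambda>\<omega>. ?E1 \<omega> \<or> ?E2 \<omega> \<or> ?E3 \<omega>)"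
  proof (rule P.finite_measure_mono)
    show "{\<omega>. ?E1 \<omega> \<or> ?E2 \<omega> \<or> ?E3 \<omega>} \<in> P.events"
      using sets.Un[OF ev1 ev23] by (simp only: Collect_disj_eq)
  qed (use incl in blast)
  moreover have "\<dots> \<le> pr ?E1 + pr (\<lambda>\<omega>. ?E2 \<omega> \<or> ?E3 \<omega>)" by (rule prob_disj_le[OF ev1 ev23])
  moreover have "pr (\<lambda>\<omega>. ?E2 \<omega> \<or> ?E3 \<omega>) \<le> pr ?E2 + pr ?E3" by (rule prob_disj_le[OF ev[of XR] ev[of XL]])
  ultimately have "pr (\<lambda>\<omega>. ever \<omega> Blue (0, 0)) \<le> (2 * real L + 1) * p + 2 * B"
    using b1 b2 b3 by linarith
  then show ?thesis unfolding B_def .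
qed

end

section \<open>Explicit bounds after choosing the parameters on the scale of
  \<open>red_distance\<close>\<close>

lemma one_minus_power_le:
  fixes x :: real
  assumes "0 \<le> x" "x \<le> 1"
  shows "min 1 (x * real k) / 2 \<le> 1 - (1 - x) ^ k"
proof -
  let ?y = "x * real k"
  have y: "0 \<le> ?y" using assms by simp
  \<comment> \<open>Bernoulli's inequality replaces \<open>1 + ?y\<close> by
    \<open>(1 + x) ^ k\<close>, whose product with \<open>(1 - x) ^ k\<close> is at most 1.\<close>
  have "(1 - x) ^ k * (1 + ?y) \<le> (1 - x) ^ k * (1 + x) ^ k"
    using assms Bernoulli_inequality[of x k] by (intro mult_left_mono) (simp_all add: mult.commute)
  also have "\<dots> = (1 - x\<^sup>2) ^ k" by (simp flip: power_mult_distrib add: algebra_simps power2_eq_square)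
  also have "\<dots> \<le> 1" using assms by (intro power_le_one) (auto simp: power_le_one)
  finally have "(1 - x) ^ k \<le> 1 / (1 + ?y)" using y by (simp add: field_simps)
  moreover have "1 / (1 + ?y) \<le> 1 - min 1 ?y / 2"
  proof (cases "?y \<le> 1")
    case True
    have "?y * ?y \<le> ?y * 1" using y True by (intro mult_left_mono)
    then show ?thesis using True y by (simp add: field_simps)
  next
    case False
    then show ?thesis using y by (simp add: field_simps)
  qed
  ultimately show ?thesis by linarith
qed

lemma one_minus_power_le_exp:
  fixes x :: real
  assumes "x \<le> 1"
  shows "(1 - x) ^ k \<le> exp (- (x * real k))"
proof -
  have "(1 - x) ^ k \<le> exp (- x) ^ k"
    using exp_ge_add_one_self[of "- x"] assms by (intro power_mono) auto
  then show ?thesis by (simp add: exp_of_nat_mult[symmetric] mult.commute)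
qed

text \<open>The factor 2 accounts for slabs above and below row \<open>0\<close>, the power
  \<open>j\<close> for the number of columns.\<close>

definition poly_geometric_sum :: "real \<Rightarrow> nat \<Rightarrow> real" where
  "poly_geometric_sum \<kappa> j = (\<Sum>k. 2 * (\<kappa> ^ k * (real k + 1) ^ j))"

text \<open>
  Up to constants, \<open>red_distance s\<close> is the distance a red vertex spreads before it is blocked by
  \<open>\<rho>\<close> consecutive blue vertices, when \<open>s\<close> is the density of blue.
\<close>
definition (in competition) red_distance :: "real \<Rightarrow> real" where
  "red_distance s = s powr (- (real \<rho> / (real \<rho> + 1)))"

text \<open>Chosen so that \<open>slab_const * real w\<close> is \<open>6 * real m\<close>, the
  number of rows in the first slab on either side together, for
  \<open>m = \<rho> * nat \<lceil>2 / r\<rceil> * w\<close>.\<close>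

definition (in competition) slab_const :: real where
  "slab_const = 6 * real \<rho> * real (nat \<lceil>2 / r\<rceil>)"

text \<open>The window around a barrier has at most \<open>\<tau> * (2 * r + 3) * h\<close> columns,
  and the conditional density \<open>p / (1 - q)\<close> of blue is at most
  \<open>2 * p\<close>.\<close>

definition (in competition) barrier_const :: real where
  "barrier_const = (2 * real \<tau> * (2 * r + 3)) ^ \<rho>"

context random_competition begin

abbreviation red_range :: real where "red_range \<equiv> red_distance p"

text \<open>A union bound over the failures of the three hypotheses of
  \<open>eventually_blue\<close>; the origin is the single column obtained from
  \<open>x = -1\<close>.\<close>

lemma pr_not_ever_Blue_le:
  assumes m: "int \<rho> * \<lfloor>(real w + 1) / r\<rfloor> \<le> int m" "m \<ge> 1"
    and \<kappa>: "0 \<le> \<kappa>" "\<kappa> < 1" "\<And>x a. pr (\<lambda>\<omega>. \<not> good_slab \<omega> x w m a) \<le> \<kappa>"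
  shows "pr (\<lambda>\<omega>. \<not> ever \<omega> Blue (0, 0)) \<le> (1 - p) ^ L + 6 * real m * q * poly_geometric_sum \<kappa> 1
    + (real L + 1) * ((6 * real m * q) ^ \<tau> * poly_geometric_sum \<kappa> \<tau>)"
proof -
  let ?E1 = "\<lambda>\<omega>. \<not> blue_in \<omega> {1..int L} 0"
  let ?E2 = "\<lambda>\<omega>. ever \<omega> Red (0, 0)"
  let ?E3 = "\<lambda>\<omega>. \<exists>x\<in>{0..int L}. \<forall>c\<in>{x + 1..x + int \<tau>}. ever \<omega> Red (c, 0)"
  have ev_cols: "{\<omega>. \<forall>c\<in>{x + 1..x + int \<tau>}. ever \<omega> Red (c, 0)} \<in> P.events" for x
  proof -
    have "{\<omega>. \<forall>c\<in>{x + 1..x + int \<tau>}. ever \<omega> Red (c, 0)} =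
        (\<Inter>c\<in>{x + 1..x + int \<tau>}. {\<omega>. ever \<omega> Red (c, 0)})" by auto
    then show ?thesis using ever_events tau_pos by (auto intro!: sets.finite_INT)
  qed
  have ev1: "{\<omega>. ?E1 \<omega>} \<in> P.events"
    by (rule determined_sets[OF _ determined_by_Not[OF determined_by_blue_in[OF order_refl]]]) simp
  have ev3: "{\<omega>. ?E3 \<omega>} \<in> P.events"
  proof -
    have "{\<omega>. ?E3 \<omega>} = (\<Union>x\<in>{0..int L}. {\<omega>. \<forall>c\<in>{x + 1..x + int \<tau>}. ever \<omega> Red (c, 0)})" by auto
    then show ?thesis using ev_cols by auto
  qed
  have "pr ?E1 = (1 - p) ^ L"
    using prob_Not_determined[OF _ determined_by_blue_in[OF order_refl], of "{1..int L}" 0]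
      pr_blue_in[of "{1..int L}" 0] by simp
  moreover have "pr ?E2 \<le> 6 * real m * q * poly_geometric_sum \<kappa> 1"
    using pr_columns_ever_red[OF m tau_pos order_refl \<kappa>, of "- 1"]
    by (simp add: poly_geometric_sum_def)
  moreover have "pr ?E3 \<le> card {0..int L} * ((6 * real m * q) ^ \<tau> * poly_geometric_sum \<kappa> \<tau>)"
    using pr_columns_ever_red[OF m order_refl tau_pos \<kappa>] ev_cols
    by (intro prob_Bex_le_card) (simp_all add: poly_geometric_sum_def)
  moreover have "real (card {0..int L}) = real L + 1" by simp
  moreover have "pr (\<lambda>\<omega>. \<not> ever \<omega> Blue (0, 0)) \<le> pr (\<lambda>\<omega>. ?E1 \<omega> \<or> (?E2 \<omega> \<or> ?E3 \<omega>))"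
  proof (rule P.finite_measure_mono)
    show "{\<omega>. ?E1 \<omega> \<or> (?E2 \<omega> \<or> ?E3 \<omega>)} \<in> P.events"
      using sets.Un[OF ev1 sets.Un[OF ever_events ev3]] by (simp only: Collect_disj_eq)
    show "{\<omega>. \<not> ever \<omega> Blue (0, 0)} \<subseteq> {\<omega>. ?E1 \<omega> \<or> (?E2 \<omega> \<or> ?E3 \<omega>)}"
      using eventually_blue[of _ "int L"] by blast
  qed
  moreover have ev23: "{\<omega>. ?E2 \<omega> \<or> ?E3 \<omega>} \<in> P.events"
    using sets.Un[OF ever_events ev3] by (simp only: Collect_disj_eq)
  moreover have "pr (\<lambda>\<omega>. ?E1 \<omega> \<or> (?E2 \<omega> \<or> ?E3 \<omega>)) \<le> pr ?E1 + pr (\<lambda>\<omega>. ?E2 \<omega> \<or> ?E3 \<omega>)"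
    by (rule prob_disj_le[OF ev1 ev23])
  moreover have "pr (\<lambda>\<omega>. ?E2 \<omega> \<or> ?E3 \<omega>) \<le> pr ?E2 + pr ?E3" by (rule prob_disj_le[OF ever_events ev3])
  ultimately show ?thesis by simp
qed

lemma poly_geometric_sum_nonneg: "0 \<le> \<kappa> \<Longrightarrow> \<kappa> < 1 \<Longrightarrow> 0 \<le> poly_geometric_sum \<kappa> j"
  unfolding poly_geometric_sum_def
  by (intro suminf_nonneg summable_mult summable_geometric_times_poly) auto

text \<open>The equation that determines the scale: with \<open>d\<close> for
  \<open>red_range\<close>, \<open>d * (p * d) ^ \<rho> = 1\<close>. In height \<open>d\<close> and
  width \<open>d\<close> the expected number of runs of \<open>\<rho>\<close> rows containing blue
  is of order 1.\<close>

lemma red_range_power: "red_range ^ (\<rho> + 1) * p ^ \<rho> = 1"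
proof -
  have "red_range ^ (\<rho> + 1) = red_range powr real (\<rho> + 1)"
    using p_pos by (intro powr_realpow[symmetric]) (simp add: red_distance_def)
  also have "\<dots> = p powr (- (real \<rho> / (real \<rho> + 1)) * real (\<rho> + 1))"
    unfolding red_distance_def by (rule powr_powr)
  also have "- (real \<rho> / (real \<rho> + 1)) * real (\<rho> + 1) = - real \<rho>" by (simp add: field_simps)
  finally have "red_range ^ (\<rho> + 1) = p powr (- real \<rho>)" .
  then show ?thesis using p_pos by (simp add: powr_minus powr_realpow)
qed

lemma red_range_ge_1: "1 \<le> red_range"
  unfolding red_distance_def using p_pos q_pos pq_le by (simp add: powr_minus one_le_inverse_iff powr_le1)

text \<open>Windows are about \<open>red_range\<close> columns wide. A row meets blue in such a
  window with probability at least \<open>p * w / 2\<close>, where \<open>small\<close> ensures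
  \<open>p * w \<le> 1\<close>. By \<open>red_range_power\<close>, \<open>N\<close> blocks of
  \<open>\<rho>\<close> rows then all fail with probability at most
  \<open>exp (- ((1 / 2) ^ \<rho>))\<close>, a number below 1 that does not depend on
  \<open>p\<close>.\<close>

lemma pr_not_ever_Blue_bound:
  fixes \<mu> \<kappa> :: real
  assumes \<mu>: "\<mu> \<ge> 0" and small: "2 * p * red_range \<le> 1"
    and \<kappa>: "\<kappa> < 1"
      "slab_const * red_range * q + 3 * red_range * (slab_const * red_range * q) ^ \<tau> + exp (- ((1 / 2) ^ \<rho>)) \<le> \<kappa>"
  shows "pr (\<lambda>\<omega>. \<not> ever \<omega> Blue (0, 0)) \<le> exp (- \<mu>)
    + 2 * slab_const * red_range * q * poly_geometric_sum \<kappa> 1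
    + (\<mu> + 2) / p * ((2 * slab_const * red_range * q) ^ \<tau> * poly_geometric_sum \<kappa> \<tau>)"
proof -
  \<comment> \<open>For \<open>w \<ge> 1\<close> one has
    \<open>(w + 1) / r \<le> (2 / r) * w\<close>; so \<open>N = A * w\<close> bounds the number of
    red updates while blue crosses the window.\<close>
  define A where "A = nat \<lceil>2 / r\<rceil>"
  define w where "w = nat \<lceil>red_range\<rceil>"
  define N where "N = A * w"
  define m where "m = \<rho> * N"
  \<comment> \<open>The nearest blue vertex on the right is farther than \<open>\<mu> / p\<close>
    with probability at most \<open>exp (- \<mu>)\<close>.\<close>
  define L where "L = nat \<lceil>\<mu> / p\<rceil>"
  have p1: "p \<le> 1" and q1: "q \<le> 1" using p_pos q_pos pq_le by auto
  have w: "red_range \<le> real w" "real w \<le> 2 * red_range" "1 \<le> w"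
    using red_range_ge_1 unfolding w_def by linarith+
  have A1: "A \<ge> 1" using r_pos unfolding A_def by (simp add: Suc_leI)
  have N1: "N \<ge> 1" using A1 w(3) by (simp add: N_def)
  have m1: "m \<ge> 1" using N1 rho_pos by (simp add: m_def)
  have m0: "int \<rho> * \<lfloor>(real w + 1) / r\<rfloor> \<le> int m"
  proof -
    have "(real w + 1) / r \<le> (2 / r) * real w" using w(3) r_pos by (simp add: field_simps)
    also have "\<dots> \<le> real A * real w" unfolding A_def by (intro mult_right_mono) linarith+
    also have "\<dots> = real N" by (simp add: N_def)
    finally have "\<lfloor>(real w + 1) / r\<rfloor> \<le> int N" by linarith
    then show ?thesis unfolding m_def of_nat_mult by (intro mult_left_mono) auto
  qed
  have m_le: "6 * real m \<le> 2 * slab_const * red_range"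
  proof -
    have "6 * real m = slab_const * real w" by (simp add: m_def N_def slab_const_def A_def)
    also have "\<dots> \<le> slab_const * (2 * red_range)" using w by (intro mult_left_mono) (auto simp: slab_const_def)
    finally show ?thesis by simp
  qed
  have mq_le: "6 * real m * q \<le> 2 * slab_const * red_range * q"
    using m_le q_pos by (intro mult_right_mono) auto
  have \<kappa>0: "0 \<le> \<kappa>"
  proof -
    have "0 \<le> slab_const * red_range * q" using q_pos red_range_ge_1 by (simp add: slab_const_def)
    then have "0 \<le> slab_const * red_range * q + 3 * red_range * (slab_const * red_range * q) ^ \<tau> + exp (- ((1 / 2) ^ \<rho>))"
      using red_range_ge_1 by simp
    then show ?thesis using \<kappa> by linarith
  qed
  have slab: "pr (\<lambda>\<omega>. \<not> good_slab \<omega> x w m a) \<le> \<kappa>" for x a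
  proof -
    have mq: "real (3 * m) * q \<le> slab_const * red_range * q" using mq_le by (simp add: mult_ac)
    have "(real w + 1) * (real (3 * m) * q) ^ \<tau> \<le> 3 * red_range * (slab_const * red_range * q) ^ \<tau>"
      using mq w red_range_ge_1 q_pos by (intro mult_mono power_mono) auto
    moreover have "(1 - (1 - (1 - p) ^ (w + 1)) ^ \<rho>) ^ N \<le> exp (- ((1 / 2) ^ \<rho>))"
    proof -
      let ?\<theta> = "1 - (1 - p) ^ (w + 1)"
      have "(1 - p) ^ (w + 1) \<le> (1 - p) ^ w" using p1 p_pos by (intro power_decreasing) auto
      moreover have "p * real w \<le> 1"
      proof -
        have "p * real w \<le> p * (2 * red_range)" using w(2) p_pos by (intro mult_left_mono) auto
        also have "\<dots> \<le> 1" using small by (simp add: mult_ac)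
        finally show ?thesis .
      qed
      ultimately have \<theta>: "p * real w / 2 \<le> ?\<theta>"
        using one_minus_power_le[of p w] p1 p_pos by simp
      have pw: "0 \<le> (1 - p) ^ (w + 1)" "(1 - p) ^ (w + 1) \<le> 1"
        using p1 p_pos by (intro zero_le_power power_le_one; simp)+
      have \<theta>1: "?\<theta> ^ \<rho> \<le> 1" using pw by (intro power_le_one) linarith+
      have "(1 / 2) ^ \<rho> = (red_range ^ (\<rho> + 1) * p ^ \<rho>) * (1 / 2) ^ \<rho>" by (simp only: red_range_power)
      also have "\<dots> \<le> (real w ^ (\<rho> + 1) * p ^ \<rho>) * (1 / 2) ^ \<rho>"
        using w(1) p_pos red_range_ge_1 by (intro mult_right_mono power_mono) auto
      also have "\<dots> = (p * real w / 2) ^ \<rho> * real w" by (simp add: power_mult_distrib power_divide)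
      also have "\<dots> \<le> ?\<theta> ^ \<rho> * real N"
      proof (intro mult_mono power_mono \<theta>)
        show "real w \<le> real N" using mult_right_mono[OF A1, of w] by (simp add: N_def flip: of_nat_mult)
        show "0 \<le> ?\<theta> ^ \<rho>" using pw by (intro zero_le_power) linarith
      qed (use p_pos in auto)
      finally have "exp (- (?\<theta> ^ \<rho> * real N)) \<le> exp (- ((1 / 2) ^ \<rho>))" by simp
      then show ?thesis using one_minus_power_le_exp[OF \<theta>1, of N] by linarith
    qed
    ultimately show ?thesis using pr_not_good_slab[OF m_def, of x w a] mq \<kappa>(2) by linarith
  qed
  have S: "0 \<le> poly_geometric_sum \<kappa> j" for j by (rule poly_geometric_sum_nonneg[OF \<kappa>0 \<kappa>(1)])
  have "(1 - p) ^ L \<le> exp (- (p * real L))" by (rule one_minus_power_le_exp[OF p1])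
  also have "\<mu> / p \<le> real L" unfolding L_def by linarith
  then have "\<mu> \<le> p * real L" using p_pos by (simp add: field_simps)
  then have "exp (- (p * real L)) \<le> exp (- \<mu>)" by simp
  finally have t1: "(1 - p) ^ L \<le> exp (- \<mu>)" .
  have t2: "6 * real m * q * poly_geometric_sum \<kappa> 1 \<le> 2 * slab_const * red_range * q * poly_geometric_sum \<kappa> 1"
    using mq_le S by (rule mult_right_mono)
  have "\<mu> / p \<ge> 0" using \<mu> p_pos by simp
  then have "real L + 1 \<le> \<mu> / p + 2" unfolding L_def by linarith
  also have "\<dots> \<le> (\<mu> + 2) / p" using p_pos p1 by (simp add: field_simps)
  finally have "real L + 1 \<le> (\<mu> + 2) / p" .
  then have t3: "(real L + 1) * ((6 * real m * q) ^ \<tau> * poly_geometric_sum \<kappa> \<tau>) \<le>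
      (\<mu> + 2) / p * ((2 * slab_const * red_range * q) ^ \<tau> * poly_geometric_sum \<kappa> \<tau>)"
  proof (intro mult_mono)
    show "(6 * real m * q) ^ \<tau> \<le> (2 * slab_const * red_range * q) ^ \<tau>"
      using mq_le by (rule power_mono) (use q_pos in simp)
    have "0 \<le> slab_const" "0 \<le> red_range" using red_range_ge_1 by (auto simp: slab_const_def)
    then show "0 \<le> (2 * slab_const * red_range * q) ^ \<tau>" using q_pos by simp
  qed (use S q_pos p_pos \<mu> in auto)
  show ?thesis using pr_not_ever_Blue_le[OF m0 m1 \<kappa>0 \<kappa>(1) slab, of L] t1 t2 t3 by linarith
qed

text \<open>The search range \<open>\<epsilon> / p\<close> keeps blue out of row \<open>0\<close> up
  to probability \<open>2 * \<epsilon> + p\<close>. Height \<open>\<epsilon> * red_range\<close>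
  turns the bound for blue blocks into a multiple of \<open>\<epsilon> ^ (\<rho> + 1)\<close>, hence
  of \<open>\<epsilon>\<close>. About \<open>\<epsilon> / (2 * \<tau> * p)\<close> candidates on
  each side remain, and the exponent is a lower bound for the expected number of those full of
  red.\<close>

lemma pr_ever_Blue_bound:
  assumes \<epsilon>: "0 < \<epsilon>" "\<epsilon> \<le> 1" and q2: "q \<le> 1 / 2" and large: "1 \<le> \<epsilon> * red_range"
    and small: "(1 + real \<tau> * (r + 1) * red_range + real \<tau>) * p \<le> \<epsilon> / 2"
  shows "pr (\<lambda>\<omega>. ever \<omega> Blue (0, 0)) \<le> 2 * \<epsilon> + p
    + 2 * (exp (- (\<epsilon> / (2 * real \<tau>) * ((min 1 (q * (\<epsilon> * red_range / 2)) / 2) ^ \<tau> / p))) + \<epsilon> * barrier_const)"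
proof -
  define h where "h = nat \<lfloor>\<epsilon> * red_range\<rfloor>"
  define D where "D = \<tau> * nat \<lceil>real h * r\<rceil>"
  define L where "L = nat \<lfloor>\<epsilon> / p\<rfloor>"
  define N where "N = (L - D) div \<tau>"
  define g where "g = (1 - (1 - q) ^ h) ^ \<tau>"
  have p1: "p \<le> 1" and q1: "q \<le> 1" using p_pos q_pos pq_le by auto
  have h: "real h \<le> \<epsilon> * red_range" "\<epsilon> * red_range / 2 \<le> real h" "1 \<le> real h"
  proof -
    have fl: "1 \<le> \<lfloor>\<epsilon> * red_range\<rfloor>" using large by (simp add: le_floor_iff)
    then have "real h = of_int \<lfloor>\<epsilon> * red_range\<rfloor>" unfolding h_def by simp
    then show "real h \<le> \<epsilon> * red_range" "\<epsilon> * red_range / 2 \<le> real h" "1 \<le> real h"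
      using fl by linarith+
  qed
  have h_scale: "real h \<le> red_range"
  proof -
    have "\<epsilon> * red_range \<le> 1 * red_range" using \<epsilon> red_range_ge_1 by (intro mult_right_mono) auto
    then show ?thesis using h(1) by linarith
  qed
  have ceil: "real (nat \<lceil>real h * r\<rceil>) \<le> real h * r + 1"
    using r_pos h(3) by (simp add: le_diff_eq[symmetric])
  have D0: "int \<tau> * \<lfloor>real h * r\<rfloor> \<le> int D"
    unfolding D_def of_nat_mult by (intro mult_left_mono) linarith+
  have D_le: "real D \<le> real \<tau> * (real h * r + 1)"
    unfolding D_def of_nat_mult using ceil by (intro mult_left_mono) auto
  also have "\<dots> \<le> real \<tau> * (red_range * r + red_range)"
    using h_scale red_range_ge_1 r_pos by (intro mult_left_mono add_mono mult_right_mono) auto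
  finally have D_scale: "real D \<le> real \<tau> * (r + 1) * red_range" by (simp add: algebra_simps)
  have L: "real L \<le> \<epsilon> / p" "\<epsilon> / p - 1 \<le> real L"
  proof -
    have "\<epsilon> / p \<ge> 0" using \<epsilon> p_pos by simp
    then show "real L \<le> \<epsilon> / p" "\<epsilon> / p - 1 \<le> real L" unfolding L_def by linarith+
  qed
  \<comment> \<open>The margin \<open>D\<close> and the rounding take at most half of the search
    range \<open>\<epsilon> / p\<close>.\<close>
  have small': "1 + real \<tau> * (r + 1) * red_range + real \<tau> \<le> \<epsilon> / p - \<epsilon> / (2 * p)"
    using small p_pos by (simp add: field_simps)
  have eps_pos: "0 \<le> \<epsilon> / (2 * p)" using \<epsilon> p_pos by simp
  have DL: "D \<le> L"
  proof -
    have "real D \<le> real L" using D_scale L small' eps_pos by linarith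
    then show ?thesis by simp
  qed
  have NL: "N * \<tau> + D \<le> L"
    using DL div_mult2_eq unfolding N_def by (metis add_le_mono1 div_times_less_eq_dividend le_add_diff_inverse2)
  have N_ge: "\<epsilon> / (2 * real \<tau> * p) \<le> real N"
  proof -
    have "L - D < (N + 1) * \<tau>"
      unfolding N_def using tau_pos dividend_less_div_times[of \<tau> "L - D"] by (simp add: add.commute)
    then have "real (L - D) \<le> real ((N + 1) * \<tau>)" by (simp only: of_nat_le_iff)
    then have "real L - real D \<le> (real N + 1) * real \<tau>" using DL by (simp add: of_nat_diff algebra_simps)
    then have "\<epsilon> / (2 * p) \<le> real N * real \<tau>"
      using D_scale L small' by (simp add: algebra_simps)
    then show ?thesis using tau_pos p_pos by (simp add: field_simps)
  qed
  have "min 1 (q * (\<epsilon> * red_range / 2)) / 2 \<le> min 1 (q * real h) / 2"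
    using h(2) q_pos by (intro divide_right_mono min.mono mult_left_mono) auto
  also have "\<dots> \<le> 1 - (1 - q) ^ h" using q_pos q1 by (intro one_minus_power_le) auto
  finally have "(min 1 (q * (\<epsilon> * red_range / 2)) / 2) ^ \<tau> \<le> g"
    unfolding g_def using q_pos \<epsilon> red_range_ge_1 by (intro power_mono) auto
  then have "(min 1 (q * (\<epsilon> * red_range / 2)) / 2) ^ \<tau> * (\<epsilon> / (2 * real \<tau> * p)) \<le> g * real N"
    using N_ge \<epsilon> p_pos q_pos red_range_ge_1 q1 unfolding g_def
    by (intro mult_mono) (auto simp: power_le_one)
  moreover have "g \<le> 1" unfolding g_def using q1 q_pos by (intro power_le_one) (auto simp: power_le_one)
  then have "(1 - g) ^ N \<le> exp (- (g * real N))" by (rule one_minus_power_le_exp)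
  ultimately have t1: "(1 - g) ^ N \<le>
      exp (- (\<epsilon> / (2 * real \<tau>) * ((min 1 (q * (\<epsilon> * red_range / 2)) / 2) ^ \<tau> / p)))"
    by (smt (verit) exp_le_cancel_iff mult.commute times_divide_times_eq mult.assoc times_divide_eq_right divide_divide_eq_left')
  have t2: "real h * ((2 * real D + real \<tau>) * p / (1 - q)) ^ \<rho> \<le> \<epsilon> * barrier_const"
  proof -
    have "2 * real D + real \<tau> \<le> real \<tau> * (2 * r * real h + 3)" using D_le by (simp add: algebra_simps)
    also have "\<dots> \<le> real \<tau> * (2 * r * real h + 3 * real h)"
      using h(3) by (intro mult_left_mono) auto
    finally have "2 * real D + real \<tau> \<le> real \<tau> * (2 * r + 3) * real h" by (simp add: algebra_simps)
    then have "(2 * real D + real \<tau>) * (p / (1 - q)) \<le> (real \<tau> * (2 * r + 3) * real h) * (2 * p)"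
      using q2 p_pos r_pos by (intro mult_mono) (auto simp: field_simps)
    then have "real h * ((2 * real D + real \<tau>) * (p / (1 - q))) ^ \<rho> \<le>
        real h * ((real \<tau> * (2 * r + 3) * real h) * (2 * p)) ^ \<rho>"
      using q2 p_pos by (intro mult_left_mono power_mono) auto
    also have "\<dots> = real h ^ (\<rho> + 1) * p ^ \<rho> * barrier_const"
      unfolding barrier_const_def by (simp add: power_mult_distrib mult_ac)
    also have "\<dots> \<le> (\<epsilon> * red_range) ^ (\<rho> + 1) * p ^ \<rho> * barrier_const"
      using h p_pos r_pos unfolding barrier_const_def by (intro mult_right_mono power_mono) auto
    also have "\<dots> = \<epsilon> ^ (\<rho> + 1) * (red_range ^ (\<rho> + 1) * p ^ \<rho>) * barrier_const"
      unfolding power_mult_distrib by (simp only: mult_ac)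
    also have "\<dots> = \<epsilon> ^ (\<rho> + 1) * barrier_const" unfolding red_range_power by simp
    also have "\<dots> \<le> \<epsilon> ^ 1 * barrier_const"
      using \<epsilon> r_pos unfolding barrier_const_def by (intro mult_right_mono power_decreasing) auto
    finally show ?thesis by simp
  qed
  have t0: "(2 * real L + 1) * p \<le> 2 * \<epsilon> + p"
    using mult_right_mono[OF L(1), of p] p_pos by (simp add: algebra_simps)
  show ?thesis
    by (rule order.trans[OF pr_ever_Blue_le[OF D0 NL]])
      (intro add_mono mult_left_mono t0 t1[unfolded g_def] t2, simp)
qed

end

section \<open>Limits\<close>

lemma (in random_competition) final_state_prob_eq:
  assumes "c \<noteq> Empty"
  shows "final_state_prob blue_nbhd red_nbhd r p q c = pr (\<lambda>\<omega>. ever \<omega> c (0, 0))"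
  unfolding final_state_prob_def sample_space_eq ever_def
  using has_final_state_colored_iff[OF assms] by simp

context competition begin

lemma eventually_random_competition:
  assumes "\<forall>\<^sub>F i in F. p i > 0 \<and> q i > 0" "(p \<longlongrightarrow> 0) F" "(q \<longlongrightarrow> 0) F"
  shows "\<forall>\<^sub>F i in F. random_competition \<rho> \<tau> r (p i) (q i)"
proof -
  have "\<forall>\<^sub>F i in F. p i < 1 / 2" "\<forall>\<^sub>F i in F. q i < 1 / 2"
    by (rule order_tendstoD(2)[OF assms(2)], simp, rule order_tendstoD(2)[OF assms(3)], simp)
  with assms(1) show ?thesis
  proof eventually_elim
    case (elim i)
    then show ?case by unfold_locales auto
  qed
qed

lemma density_times_red_distance:
  fixes p :: real
  assumes "p > 0"
  shows "p * red_distance p = p powr (1 / (real \<rho> + 1))"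
proof -
  have "p * red_distance p = p powr (1 + - (real \<rho> / (real \<rho> + 1)))"
    unfolding red_distance_def powr_add using assms by simp
  also have "1 + - (real \<rho> / (real \<rho> + 1)) = 1 / (real \<rho> + 1)" by (simp add: field_simps)
  finally show ?thesis .
qed

lemma red_distance_times_density:
  fixes p q :: real
  assumes pq: "p > 0" "q > 0" and \<gamma>: "\<gamma> = 1 / real \<tau> + real \<rho> / (real \<rho> + 1)"
  shows "red_distance p * q = q / p powr \<gamma> * p powr (1 / real \<tau>)"
    and "(red_distance p * q) ^ \<tau> = (q / p powr \<gamma>) ^ \<tau> * p"
proof -
  have "p powr \<gamma> * red_distance p = p powr (1 / real \<tau>)"
    unfolding red_distance_def powr_add[symmetric] by (simp add: \<gamma>)
  then show *: "red_distance p * q = q / p powr \<gamma> * p powr (1 / real \<tau>)"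
    using pq by (simp add: field_simps)
  have "(p powr (1 / real \<tau>)) ^ \<tau> = (p powr (1 / real \<tau>)) powr real \<tau>"
    using pq by (intro powr_realpow[symmetric]) simp
  also have "\<dots> = p" using pq tau_pos by (simp add: powr_powr)
  finally show "(red_distance p * q) ^ \<tau> = (q / p powr \<gamma>) ^ \<tau> * p"
    unfolding * power_mult_distrib by simp
qed

lemma blue_wins:
  fixes p q :: "'i \<Rightarrow> real"
  assumes pos: "\<forall>\<^sub>F i in F. p i > 0 \<and> q i > 0" and lim: "(p \<longlongrightarrow> 0) F" "(q \<longlongrightarrow> 0) F"
    and \<gamma>: "\<gamma> = 1 / real \<tau> + real \<rho> / (real \<rho> + 1)"
    and sparse: "((\<lambda>i. q i / p i powr \<gamma>) \<longlongrightarrow> 0) F"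
  shows "((\<lambda>i. final_state_prob blue_nbhd red_nbhd r (p i) (q i) Blue) \<longlongrightarrow> 1) F"
proof -
  define R where "R i = red_distance (p i)" for i
  define u where "u i = q i / p i powr \<gamma>" for i
  define C where "C = slab_const"
  define e0 where "e0 = exp (- ((1 / 2 :: real) ^ \<rho>))"
  \<comment> \<open>Any fixed number strictly between \<open>e0\<close> and 1 would do. It must not
    depend on \<open>i\<close>, so that the values of \<open>poly_geometric_sum \<kappa>\<close> are
    constants in the limit.\<close>
  define \<kappa> where "\<kappa> = (1 + e0) / 2"
  have e0: "e0 < 1" unfolding e0_def by simp
  then have \<kappa>: "\<kappa> < 1" "e0 < \<kappa>" by (simp_all add: \<kappa>_def)
  note rc = eventually_random_competition[OF pos lim]
  have pos_p: "\<forall>\<^sub>F i in F. 0 \<le> p i" using pos by eventually_elim simp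
  have u0: "(u \<longlongrightarrow> 0) F" using sparse unfolding u_def[abs_def] .
  have p_powr: "((\<lambda>i. p i powr c) \<longlongrightarrow> 0) F" if "c > 0" for c
    by (rule tendsto_zero_powrI[OF lim(1) tendsto_const pos_p that])
  have lim_pR: "((\<lambda>i. p i * R i) \<longlongrightarrow> 0) F"
  proof (rule Lim_transform_eventually)
    show "((\<lambda>i. p i powr (1 / (real \<rho> + 1))) \<longlongrightarrow> 0) F" by (rule p_powr) simp
    show "\<forall>\<^sub>F i in F. p i powr (1 / (real \<rho> + 1)) = p i * R i"
      using pos by eventually_elim (simp add: density_times_red_distance R_def)
  qed
  have lim_Rq: "((\<lambda>i. R i * q i) \<longlongrightarrow> 0) F"
  proof (rule Lim_transform_eventually)
    show "((\<lambda>i. u i * p i powr (1 / real \<tau>)) \<longlongrightarrow> 0) F"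
      using tendsto_mult[OF u0 p_powr[of "1 / real \<tau>"]] tau_pos by simp
    show "\<forall>\<^sub>F i in F. u i * p i powr (1 / real \<tau>) = R i * q i"
      using pos by eventually_elim (simp add: red_distance_times_density(1)[OF _ _ \<gamma>] R_def u_def)
  qed
  have u\<tau>: "((\<lambda>i. u i ^ \<tau>) \<longlongrightarrow> 0) F"
    using tendsto_power[OF u0, of \<tau>] tau_pos by (simp add: power_0_left)
  \<comment> \<open>This controls red barriers inside the window of a slab: of order
    \<open>R\<close> positions, each with probability of order
    \<open>(R * q) ^ \<tau> = u ^ \<tau> * p\<close>.\<close>
  have lim_R: "((\<lambda>i. R i * (R i * q i) ^ \<tau>) \<longlongrightarrow> 0) F"
  proof (rule Lim_transform_eventually)
    show "((\<lambda>i. u i ^ \<tau> * (p i * R i)) \<longlongrightarrow> 0) F" using tendsto_mult[OF u\<tau> lim_pR] by simp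
    show "\<forall>\<^sub>F i in F. u i ^ \<tau> * (p i * R i) = R i * (R i * q i) ^ \<tau>"
      using pos by eventually_elim (simp add: red_distance_times_density(2)[OF _ _ \<gamma>] R_def u_def)
  qed
  have lim_cols: "((\<lambda>i. (R i * q i) ^ \<tau> / p i) \<longlongrightarrow> 0) F"
  proof (rule Lim_transform_eventually[OF u\<tau>])
    show "\<forall>\<^sub>F i in F. u i ^ \<tau> = (R i * q i) ^ \<tau> / p i"
      using pos by eventually_elim (simp add: red_distance_times_density(2)[OF _ _ \<gamma>] R_def u_def)
  qed
  have "((\<lambda>i. C * (R i * q i) + 3 * C ^ \<tau> * (R i * (R i * q i) ^ \<tau>) + e0) \<longlongrightarrow> C * 0 + 3 * C ^ \<tau> * 0 + e0) F"
    by (intro tendsto_intros lim_Rq lim_R)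
  then have ev_\<kappa>: "\<forall>\<^sub>F i in F. C * (R i * q i) + 3 * C ^ \<tau> * (R i * (R i * q i) ^ \<tau>) + e0 < \<kappa>"
    using \<kappa>(2) by (intro order_tendstoD(2)) auto
  have ev_pR: "\<forall>\<^sub>F i in F. p i * R i < 1 / 2" using lim_pR by (rule order_tendstoD(2)) simp
  show ?thesis
  proof (rule order_tendstoI)
    fix a :: real assume "a < 1"
    \<comment> \<open>\<open>\<mu>\<close> is fixed before the limit is taken:
      \<open>exp (- \<mu>)\<close> is at most half of the allowed error, and the terms multiplied by
      \<open>\<mu> + 2\<close> tend to 0.\<close>
    define \<mu> where "\<mu> = max 0 (- ln ((1 - a) / 2))"
    have \<mu>0: "\<mu> \<ge> 0" by (simp add: \<mu>_def)
    have "exp (- \<mu>) \<le> exp (ln ((1 - a) / 2))" by (simp add: \<mu>_def)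
    also have "\<dots> = (1 - a) / 2" using \<open>a < 1\<close> by simp
    finally have \<mu>: "exp (- \<mu>) < 1 - a" using \<open>a < 1\<close> by simp
    let ?b = "\<lambda>i. exp (- \<mu>) + 2 * C * poly_geometric_sum \<kappa> 1 * (R i * q i)
        + (\<mu> + 2) * (2 * C) ^ \<tau> * poly_geometric_sum \<kappa> \<tau> * ((R i * q i) ^ \<tau> / p i)"
    have "(?b \<longlongrightarrow> exp (- \<mu>) + 2 * C * poly_geometric_sum \<kappa> 1 * 0
        + (\<mu> + 2) * (2 * C) ^ \<tau> * poly_geometric_sum \<kappa> \<tau> * 0) F"
      by (intro tendsto_intros lim_Rq lim_cols)
    then have "\<forall>\<^sub>F i in F. ?b i < 1 - a" using \<mu> by (intro order_tendstoD(2)) auto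
    with rc ev_\<kappa> ev_pR show "\<forall>\<^sub>F i in F. a < final_state_prob blue_nbhd red_nbhd r (p i) (q i) Blue"
    proof eventually_elim
      case (elim i)
      interpret random_competition \<rho> \<tau> r "p i" "q i" by fact
      have "pr (\<lambda>\<omega>. \<not> ever \<omega> Blue (0, 0)) \<le> exp (- \<mu>)
          + 2 * slab_const * red_range * q i * poly_geometric_sum \<kappa> 1
          + (\<mu> + 2) / p i * ((2 * slab_const * red_range * q i) ^ \<tau> * poly_geometric_sum \<kappa> \<tau>)"
      proof (rule pr_not_ever_Blue_bound[OF \<mu>0 _ \<kappa>(1)])
        show "2 * p i * red_range \<le> 1" using elim(3) by (simp add: R_def)
        show "slab_const * red_range * q i + 3 * red_range * (slab_const * red_range * q i) ^ \<tau>
            + exp (- ((1 / 2) ^ \<rho>)) \<le> \<kappa>"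
          using elim(2) by (simp add: R_def C_def e0_def power_mult_distrib mult_ac)
      qed
      also have "\<dots> = ?b i" by (simp add: R_def C_def power_mult_distrib mult_ac)
      finally have "pr (\<lambda>\<omega>. \<not> ever \<omega> Blue (0, 0)) < 1 - a" using elim(4) by linarith
      moreover have "pr (\<lambda>\<omega>. \<not> ever \<omega> Blue (0, 0)) = 1 - pr (\<lambda>\<omega>. ever \<omega> Blue (0, 0))"
      proof -
        have "{\<omega>. \<not> ever \<omega> Blue (0, 0)} = space iid - {\<omega>. ever \<omega> Blue (0, 0)}" by auto
        then show ?thesis using P.prob_compl[OF ever_events] by simp
      qed
      ultimately show ?case by (simp add: final_state_prob_eq)
    qed
  next
    fix a :: real assume "1 < a"
    from rc show "\<forall>\<^sub>F i in F. final_state_prob blue_nbhd red_nbhd r (p i) (q i) Blue < a"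
    proof eventually_elim
      case (elim i)
      interpret random_competition \<rho> \<tau> r "p i" "q i" by fact
      show ?case using le_less_trans[OF P.prob_le_1 \<open>1 < a\<close>] by (simp add: final_state_prob_eq)
    qed
  qed
qed

lemma blue_blocked:
  fixes p q :: "'i \<Rightarrow> real"
  assumes pos: "\<forall>\<^sub>F i in F. p i > 0 \<and> q i > 0" and lim: "(p \<longlongrightarrow> 0) F" "(q \<longlongrightarrow> 0) F"
    and \<gamma>: "\<gamma> = 1 / real \<tau> + real \<rho> / (real \<rho> + 1)"
    and dense: "((\<lambda>i. p i powr \<gamma> / q i) \<longlongrightarrow> 0) F"
  shows "((\<lambda>i. final_state_prob blue_nbhd red_nbhd r (p i) (q i) Blue) \<longlongrightarrow> 0) F"
proof -
  define R where "R i = red_distance (p i)" for i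
  define v where "v i = p i powr \<gamma> / q i" for i
  define K where "K = barrier_const"
  have K0: "K \<ge> 0" using r_pos by (simp add: K_def barrier_const_def)
  note rc = eventually_random_competition[OF pos lim]
  have pos_p: "\<forall>\<^sub>F i in F. 0 \<le> p i" using pos by eventually_elim simp
  have v0: "(v \<longlongrightarrow> 0) F" using dense unfolding v_def[abs_def] .
  have v\<tau>: "((\<lambda>i. v i ^ \<tau>) \<longlongrightarrow> 0) F"
    using tendsto_power[OF v0, of \<tau>] tau_pos by (simp add: power_0_left)
  have lim_pR: "((\<lambda>i. p i * R i) \<longlongrightarrow> 0) F"
  proof (rule Lim_transform_eventually)
    show "((\<lambda>i. p i powr (1 / (real \<rho> + 1))) \<longlongrightarrow> 0) F"
      by (rule tendsto_zero_powrI[OF lim(1) tendsto_const pos_p]) simp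
    show "\<forall>\<^sub>F i in F. p i powr (1 / (real \<rho> + 1)) = p i * R i"
      using pos by eventually_elim (simp add: density_times_red_distance R_def)
  qed
  have lim_Rinv: "((\<lambda>i. p i powr (real \<rho> / (real \<rho> + 1))) \<longlongrightarrow> 0) F"
    by (rule tendsto_zero_powrI[OF lim(1) tendsto_const pos_p]) (use rho_pos in simp)
  have upper: "\<forall>\<^sub>F i in F. final_state_prob blue_nbhd red_nbhd r (p i) (q i) Blue < a" if "a > 0" for a
  proof -
    \<comment> \<open>The error \<open>a\<close> is split: the terms in \<open>\<epsilon>\<close>
      take at most \<open>a / 3\<close>, the term \<open>p\<close> less than \<open>a / 3\<close>,
      and twice the exponential at most \<open>2 * a / 7\<close>.\<close>
    define \<epsilon> where "\<epsilon> = min 1 (a / (6 * (1 + K)))"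
    have \<epsilon>: "0 < \<epsilon>" "\<epsilon> \<le> 1" using that K0 by (auto simp: \<epsilon>_def)
    have "\<epsilon> \<le> a / (6 * (1 + K))" by (simp add: \<epsilon>_def)
    then have "\<epsilon> * (6 * (1 + K)) \<le> a" using K0 by (simp add: pos_le_divide_eq)
    then have \<epsilon>K: "2 * \<epsilon> + 2 * (\<epsilon> * K) \<le> a / 3" by (simp add: algebra_simps)
    define c where "c = \<epsilon> / (2 * real \<tau>)"
    have c0: "c > 0" using \<epsilon> tau_pos by (simp add: c_def)
    define Z where "Z = - ln (a / 7) / c"
    have Z: "exp (- (c * z)) \<le> a / 7" if "Z \<le> z" for z
    proof -
      have "- ln (a / 7) \<le> c * z" using that unfolding Z_def pos_divide_le_eq[OF c0] by (simp add: mult.commute)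
      then have "exp (- (c * z)) \<le> exp (ln (a / 7))" by simp
      then show ?thesis using \<open>a > 0\<close> by simp
    qed
    have e1: "\<forall>\<^sub>F i in F. q i < 1 / 2" using lim(2) by (rule order_tendstoD(2)) simp
    have e2: "\<forall>\<^sub>F i in F. p i powr (real \<rho> / (real \<rho> + 1)) < \<epsilon>"
      using lim_Rinv \<epsilon>(1) by (rule order_tendstoD(2))
    have "((\<lambda>i. p i + real \<tau> * (r + 1) * (p i * R i) + real \<tau> * p i) \<longlongrightarrow>
        0 + real \<tau> * (r + 1) * 0 + real \<tau> * 0) F"
      by (intro tendsto_intros lim_pR lim(1))
    then have e3: "\<forall>\<^sub>F i in F. p i + real \<tau> * (r + 1) * (p i * R i) + real \<tau> * p i < \<epsilon> / 2"
      using \<epsilon>(1) by (intro order_tendstoD(2)) auto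
    have e4: "\<forall>\<^sub>F i in F. p i < a / 3" using lim(1) that by (intro order_tendstoD(2)) auto
    have "((\<lambda>i. Z * p i) \<longlongrightarrow> Z * 0) F" "((\<lambda>i. Z * v i ^ \<tau>) \<longlongrightarrow> Z * 0) F"
      by (intro tendsto_intros lim(1) v\<tau>)+
    \<comment> \<open>Divergence of the exponent is stated in multiplied form, one inequality for
      each branch of the \<open>min\<close> in \<open>pr_ever_Blue_bound\<close>.\<close>
    then have e5: "\<forall>\<^sub>F i in F. Z * p i < (1 / 2) ^ \<tau>" and e6: "\<forall>\<^sub>F i in F. Z * v i ^ \<tau> < (\<epsilon> / 4) ^ \<tau>"
      using \<epsilon>(1) by (auto intro!: order_tendstoD(2))
    show ?thesis using rc e1 e2 e3 e4 e5 e6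
    proof eventually_elim
      case (elim i)
      interpret random_competition \<rho> \<tau> r "p i" "q i" by fact
      let ?x = "(min 1 (q i * (\<epsilon> * red_range / 2)) / 2) ^ \<tau> / p i"
      have x: "Z \<le> ?x"
      \<comment> \<open>If red is so dense that the \<open>min\<close> is 1, the exponent grows
        because \<open>p\<close> tends to 0. Otherwise it is a multiple of the inverse of
        \<open>v ^ \<tau>\<close>.\<close>
      proof (cases "1 \<le> q i * (\<epsilon> * red_range / 2)")
        case True
        then have "?x = (1 / 2) ^ \<tau> / p i" by (simp add: min_def)
        then show ?thesis using less_imp_le[OF elim(6)] by (simp only: pos_le_divide_eq[OF p_pos])
      next
        case False
        have "v i * (q i / p i powr \<gamma>) = 1" using p_pos q_pos by (simp add: v_def)
        then have "v i ^ \<tau> * (q i / p i powr \<gamma>) ^ \<tau> = 1"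
          by (simp only: power_mult_distrib[symmetric] power_one)
        then have inv: "v i ^ \<tau> * ((red_range * q i) ^ \<tau> / p i) = 1"
          using p_pos by (simp add: red_distance_times_density(2)[OF p_pos q_pos \<gamma>])
        have "(red_range * q i) ^ \<tau> / p i \<ge> 0" using p_pos q_pos red_range_ge_1 by simp
        then have "Z * v i ^ \<tau> * ((red_range * q i) ^ \<tau> / p i) \<le> (\<epsilon> / 4) ^ \<tau> * ((red_range * q i) ^ \<tau> / p i)"
          using elim(7) by (intro mult_right_mono) auto
        then have "Z \<le> (\<epsilon> / 4) ^ \<tau> * ((red_range * q i) ^ \<tau> / p i)"
          using inv by (simp add: mult.assoc)
        also have "\<dots> = ?x"
        proof -
          have "min 1 (q i * (\<epsilon> * red_range / 2)) / 2 = (\<epsilon> / 4) * (red_range * q i)"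
            using False by (simp add: min_def)
          then show ?thesis by (simp only: power_mult_distrib times_divide_eq_right)
        qed
        finally show ?thesis .
      qed
      define e where "e = exp (- (c * ?x))"
      have "pr (\<lambda>\<omega>. ever \<omega> Blue (0, 0)) \<le> 2 * \<epsilon> + p i + 2 * (e + \<epsilon> * K)"
        unfolding e_def c_def K_def
      proof (rule pr_ever_Blue_bound[OF \<epsilon>])
        show "q i \<le> 1 / 2" using elim(2) by simp
        have "1 = p i powr (real \<rho> / (real \<rho> + 1)) * red_range"
          unfolding red_distance_def powr_add[symmetric] using p_pos by simp
        also have "\<dots> \<le> \<epsilon> * red_range" using elim(3) red_range_ge_1 by (intro mult_right_mono) auto
        finally show "1 \<le> \<epsilon> * red_range" .
        show "(1 + real \<tau> * (r + 1) * red_range + real \<tau>) * p i \<le> \<epsilon> / 2"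
          using elim(4) by (simp add: R_def algebra_simps)
      qed
      moreover have "e \<le> a / 7" unfolding e_def by (rule Z[OF x])
      moreover have "2 * (e + \<epsilon> * K) = 2 * e + 2 * (\<epsilon> * K)" by simp
      moreover define k where "k = 2 * (\<epsilon> * K)"
      ultimately have "pr (\<lambda>\<omega>. ever \<omega> Blue (0, 0)) < a"
        using \<epsilon>K elim(5) \<open>a > 0\<close> unfolding k_def[symmetric] by linarith
      then show ?case by (simp add: final_state_prob_eq)
    qed
  qed
  show ?thesis
  proof (rule order_tendstoI)
    fix a :: real assume "a < 0"
    then show "\<forall>\<^sub>F i in F. a < final_state_prob blue_nbhd red_nbhd r (p i) (q i) Blue"
      unfolding final_state_prob_def by (intro always_eventually allI less_le_trans[OF _ measure_nonneg])
  qed (rule upper)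
qed

end

section \<open>Exchanging the colours\<close>

primrec swap_color :: "color \<Rightarrow> color" where
  "swap_color Empty = Empty"
| "swap_color Blue = Red"
| "swap_color Red = Blue"

lemma swap_color_swap_color [simp]: "swap_color (swap_color c) = c"
  by (cases c) auto

lemma swap_color_eq_iff [simp]:
  "swap_color c = Empty \<longleftrightarrow> c = Empty" "swap_color c = Blue \<longleftrightarrow> c = Red" "swap_color c = Red \<longleftrightarrow> c = Blue"
  by (cases c; simp)+

lemma inj_swap_color: "inj swap_color"
  by (rule injI) (metis swap_color_swap_color)

definition flip :: "color \<times> bool \<Rightarrow> color \<times> bool" where
  "flip s = (swap_color (fst s), \<not> snd s)"

text \<open>
  The coin is negated because the outcome \<open>True\<close> favours blue; to match, time has to be divided by
  \<open>r\<close>, so that the former red updates happen at the integers.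
\<close>
definition mirror :: "(vertex \<Rightarrow> color \<times> bool) \<Rightarrow> vertex \<Rightarrow> color \<times> bool" where
  "mirror \<omega> v = flip (\<omega> (prod.swap v))"

lemma event_time_scale:
  assumes "r > 0"
  shows "blue_time (t / r) \<or> red_time (1 / r) (t / r) \<longleftrightarrow> blue_time t \<or> red_time r t"
proof -
  have "blue_time (t / r) \<longleftrightarrow> red_time r t" "red_time (1 / r) (t / r) \<longleftrightarrow> blue_time t"
    using assms by (auto simp: blue_time_def red_time_def field_simps)
  then show ?thesis by blast
qed

text \<open>Division by \<open>r\<close> is a bijection between the two sets of update times, so the
  minimality of the next update time can be used in both directions.\<close>

lemma update_time_scale:
  assumes r: "r > 0"
  shows "update_time (1 / r) n = update_time r n / r"
proof (induction n)
  case 0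
  then show ?case by simp
next
  case (Suc n)
  have r': "1 / r > 0" using r by simp
  note T = update_time_Suc[OF r, of n] and T' = update_time_Suc[OF r', of n]
  show ?case
  proof (rule antisym)
    have "update_time (1 / r) n < update_time r (Suc n) / r"
      using T(1) r unfolding Suc.IH by (intro divide_strict_right_mono)
    then show "update_time (1 / r) (Suc n) \<le> update_time r (Suc n) / r"
      using T'(3) T(2) event_time_scale[OF r] by blast
  next
    let ?t = "update_time (1 / r) (Suc n) * r"
    have t: "?t / r = update_time (1 / r) (Suc n)" using r by simp
    have "update_time r n < ?t" using T'(1) r unfolding Suc.IH by (simp add: field_simps)
    moreover have "blue_time ?t \<or> red_time r ?t"
      using T'(2) event_time_scale[OF r, of ?t] unfolding t by blast
    ultimately have "update_time r (Suc n) \<le> ?t" using T(3) by blast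
    then show "update_time r (Suc n) / r \<le> update_time (1 / r) (Suc n)"
      using r by (simp add: pos_divide_le_eq)
  qed
qed

lemma state_mirror:
  assumes r: "r > 0"
  shows "state (prod.swap ` R) (prod.swap ` B) (1 / r) (mirror \<omega>) n v
    = swap_color (state B R r \<omega> n (prod.swap v))"
proof (induction n arbitrary: v)
  case 0
  then show ?case by (simp add: mirror_def flip_def)
next
  case (Suc n)
  let ?t = "update_time r (Suc n)"
  have times: "blue_time (?t / r) \<longleftrightarrow> red_time r ?t" "red_time (1 / r) (?t / r) \<longleftrightarrow> blue_time ?t"
    using r by (auto simp: blue_time_def red_time_def field_simps)
  have add: "prod.swap (v + prod.swap b) = prod.swap v + b" for b :: vertex
    by (cases v; cases b) simp
  show ?case
    using Suc.IH times add
    by (auto simp: update_time_scale[OF r] update_def Let_def mirror_def flip_def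
       )
qed

lemma map_initial_pmf_swap:
  assumes "p \<ge> 0" "q \<ge> 0" "p + q \<le> 1"
  shows "map_pmf swap_color (initial_pmf p q) = initial_pmf q p"
proof (rule pmf_eqI)
  fix c
  have "pmf (map_pmf swap_color (initial_pmf p q)) (swap_color d) = pmf (initial_pmf p q) d" for d
    by (rule pmf_map_inj'[OF inj_swap_color])
  from this[of "swap_color c"] show "pmf (map_pmf swap_color (initial_pmf p q)) c = pmf (initial_pmf q p) c"
    using pmf_initial_pmf[of p q] pmf_initial_pmf[of q p] assms by (cases c) auto
qed

lemma map_flip_pair_pmf:
  assumes "p \<ge> 0" "q \<ge> 0" "p + q \<le> 1"
  shows "map_pmf flip (pair_pmf (initial_pmf p q) (bernoulli_pmf (1/2)))
    = pair_pmf (initial_pmf q p) (bernoulli_pmf (1/2))"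
proof -
  have "map_pmf Not (bernoulli_pmf (1/2)) = bernoulli_pmf (1/2)"
  proof (rule pmf_eqI)
    fix b
    have "pmf (map_pmf Not (bernoulli_pmf (1/2))) (Not d) = pmf (bernoulli_pmf (1/2)) d" for d
      by (rule pmf_map_inj') (auto intro: injI)
    from this[of "\<not> b"] show "pmf (map_pmf Not (bernoulli_pmf (1/2))) b = pmf (bernoulli_pmf (1/2)) b"
      by (cases b) auto
  qed
  moreover have "flip = (\<lambda>(a, b). (swap_color a, \<not> b))" by (auto simp: flip_def)
  ultimately show ?thesis using map_pair[of swap_color Not] map_initial_pmf_swap[OF assms] by simp
qed

section \<open>Relabelling an i.i.d. family and transferring the results to red\<close>

lemma measurable_iid_map_reindex:
  fixes Q :: "'a pmf" and Q' :: "'b pmf" and f :: "'i \<Rightarrow> 'i"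
  shows "(\<lambda>\<omega> i. g (\<omega> (f i))) \<in> (\<Pi>\<^sub>M i\<in>UNIV. measure_pmf Q) \<rightarrow>\<^sub>M (\<Pi>\<^sub>M i\<in>UNIV. measure_pmf Q')"
proof (rule measurable_PiM_single')
  fix i :: 'i
  have "(\<lambda>\<omega>. \<omega> (f i)) \<in> (\<Pi>\<^sub>M i\<in>UNIV. measure_pmf Q) \<rightarrow>\<^sub>M measure_pmf Q"
    by (rule measurable_component_singleton) simp
  moreover have "g \<in> measure_pmf Q \<rightarrow>\<^sub>M measure_pmf Q'" by simp
  ultimately show "(\<lambda>\<omega>. g (\<omega> (f i))) \<in> (\<Pi>\<^sub>M i\<in>UNIV. measure_pmf Q) \<rightarrow>\<^sub>M measure_pmf Q'"
    by (rule measurable_compose)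
qed (simp add: space_PiM)

lemma distr_iid_map_reindex:
  fixes Q :: "'a pmf" and g :: "'a \<Rightarrow> 'b" and f :: "'i \<Rightarrow> 'i"
  assumes f: "inj f"
  shows "distr (\<Pi>\<^sub>M i\<in>UNIV. measure_pmf Q) (\<Pi>\<^sub>M i\<in>UNIV. measure_pmf (map_pmf g Q)) (\<lambda>\<omega> i. g (\<omega> (f i)))
    = (\<Pi>\<^sub>M i\<in>UNIV. measure_pmf (map_pmf g Q))"
proof (rule measure_eqI_PiM_infinite[symmetric, OF refl])
  let ?K = "\<Pi>\<^sub>M i\<in>(UNIV :: 'i set). measure_pmf Q"
  let ?L = "\<Pi>\<^sub>M i\<in>(UNIV :: 'i set). measure_pmf (map_pmf g Q)"
  let ?t = "\<lambda>\<omega> i. g (\<omega> (f i))"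
  interpret prob_space ?L by (rule prob_space_PiM) (rule prob_space_measure_pmf)
  show "finite_measure ?L" by unfold_locales
  fix J :: "'i set" and A :: "'i \<Rightarrow> 'b set"
  assume J: "finite J"
  let ?E = "prod_emb UNIV (\<lambda>_. measure_pmf (map_pmf g Q)) J (Pi\<^sub>E J A)"
  let ?A' = "\<lambda>k. g -` A (the_inv f k)"
  have "emeasure ?L ?E = (\<Prod>j\<in>J. emeasure (measure_pmf (map_pmf g Q)) (A j))"
    using J by (intro emeasure_PiM_emb prob_space_measure_pmf) auto
  also have "\<dots> = (\<Prod>j\<in>J. emeasure (measure_pmf Q) (?A' (f j)))"
    by (simp add: the_inv_f_f[OF f])
  also have "\<dots> = (\<Prod>k\<in>f ` J. emeasure (measure_pmf Q) (?A' k))"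
    using f by (subst prod.reindex) (auto intro: inj_on_subset)
  also have "\<dots> = emeasure ?K (prod_emb UNIV (\<lambda>_. measure_pmf Q) (f ` J) (Pi\<^sub>E (f ` J) ?A'))"
    using J by (intro emeasure_PiM_emb[symmetric] prob_space_measure_pmf) auto
  also have "prod_emb UNIV (\<lambda>_. measure_pmf Q) (f ` J) (Pi\<^sub>E (f ` J) ?A') = ?t -` ?E \<inter> space ?K"
    by (auto simp: prod_emb_def space_PiM PiE_iff the_inv_f_f[OF f])
  also have "emeasure ?K \<dots> = emeasure (distr ?K ?L ?t) ?E"
    using J by (intro emeasure_distr[symmetric] measurable_iid_map_reindex sets_PiM_I) auto
  finally show "emeasure ?L ?E = emeasure (distr ?K ?L ?t) ?E" .
qed simp

text \<open>\<open>mirror\<close> carries the law for densities \<open>p, q\<close> to the law for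
  \<open>q, p\<close> and red histories to blue ones, so the limit results need a proof for blue
  only.\<close>

lemma (in random_competition) final_state_prob_Red_eq_mirror:
  "final_state_prob blue_nbhd red_nbhd r p q Red
    = final_state_prob (competition.blue_nbhd \<rho>) (competition.red_nbhd \<tau>) (1 / r) q p Blue"
proof -
  interpret M: random_competition \<tau> \<rho> "1 / r" q p
    using rho_pos tau_pos r_pos p_pos q_pos pq_le by unfold_locales auto
  let ?Q = "pair_pmf (initial_pmf p q) (bernoulli_pmf (1/2))"
  let ?E = "{\<omega>. M.ever \<omega> Blue (0, 0)}"
  have nbhds: "M.blue_nbhd = prod.swap ` red_nbhd" "M.red_nbhd = prod.swap ` blue_nbhd"
    unfolding M.blue_nbhd_def M.red_nbhd_def red_nbhd_def blue_nbhd_def by auto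
  have flip: "map_pmf flip ?Q = pair_pmf (initial_pmf q p) (bernoulli_pmf (1/2))"
    using map_flip_pair_pmf[of p q] p_pos q_pos pq_le by simp
  have dist: "distr (sample_space p q) (sample_space q p) mirror = sample_space q p"
    using distr_iid_map_reindex[OF inj_swap, of ?Q flip] unfolding flip
    by (simp add: sample_space_def mirror_def[abs_def])
  have meas: "mirror \<in> sample_space p q \<rightarrow>\<^sub>M sample_space q p"
    unfolding sample_space_def mirror_def[abs_def] by (rule measurable_iid_map_reindex)
  have ever: "M.ever (mirror \<omega>) Blue (0, 0) \<longleftrightarrow> ever \<omega> Red (0, 0)" for \<omega>
    unfolding M.ever_def ever_def nbhds state_mirror[OF r_pos] by simp
  have "M.pr (\<lambda>\<omega>. M.ever \<omega> Blue (0, 0)) = measure (distr (sample_space p q) (sample_space q p) mirror) ?E"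
    unfolding dist unfolding M.sample_space_eq ..
  also have "\<dots> = measure (sample_space p q) (mirror -` ?E \<inter> space (sample_space p q))"
    by (rule measure_distr[OF meas]) (use M.ever_events in \<open>simp add: M.sample_space_eq\<close>)
  also have "\<dots> = pr (\<lambda>\<omega>. ever \<omega> Red (0, 0))"
    by (simp add: sample_space_eq vimage_def ever)
  finally show ?thesis
    by (simp add: final_state_prob_eq M.final_state_prob_eq)
qed

text \<open>The middle regime is thereby reduced to two limits equal to 0, one for each
  colour.\<close>

lemma (in random_competition) final_state_prob_Empty:
  "final_state_prob blue_nbhd red_nbhd r p q Empty
    = 1 - final_state_prob blue_nbhd red_nbhd r p q Blue - final_state_prob blue_nbhd red_nbhd r p q Red"
proof -
  let ?B = "{\<omega>. ever \<omega> Blue (0, 0)}" and ?R = "{\<omega>. ever \<omega> Red (0, 0)}"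
  have "has_final_state blue_nbhd red_nbhd r \<omega> (0, 0) Empty \<longleftrightarrow> \<omega> \<in> space iid - (?B \<union> ?R)" for \<omega>
    unfolding has_final_state_Empty_iff by (auto simp: ever_def) (metis color.exhaust)
  then have "{\<omega> \<in> space iid. has_final_state blue_nbhd red_nbhd r \<omega> (0, 0) Empty}
      = space iid - (?B \<union> ?R)"
    by blast
  then have "final_state_prob blue_nbhd red_nbhd r p q Empty = P.prob (space iid - (?B \<union> ?R))"
    unfolding final_state_prob_def sample_space_eq by (simp only:)
  also have "\<dots> = 1 - P.prob (?B \<union> ?R)"
    by (rule P.prob_compl) (intro sets.Un ever_events)
  also have "P.prob (?B \<union> ?R) = P.prob ?B + P.prob ?R"
    by (rule P.finite_measure_Union) (use ever_events ever_unique in \<open>auto, blast\<close>)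
  finally show ?thesis by (simp add: final_state_prob_eq)
qed

section \<open>The exponents and the conclusion\<close>

lemma exponent_product_gt_1:
  fixes \<rho> \<tau> :: real
  assumes "\<rho> > 0" "\<tau> > 0"
  shows "(1 / \<tau> + \<rho> / (\<rho> + 1)) * (1 / \<rho> + \<tau> / (\<tau> + 1)) > 1"
proof -
  \<comment> \<open>The positive excess over 1 is what separates \<open>p powr \<gamma>\<close> from
    \<open>p powr (1 / \<gamma>')\<close> and so leaves room for the empty regime.\<close>
  have "(1 / \<tau> + \<rho> / (\<rho> + 1)) * (1 / \<rho> + \<tau> / (\<tau> + 1))
      = 1 + (1 / (\<rho> * \<tau>) + 1 / ((\<rho> + 1) * (\<tau> + 1)))"
    using assms by (simp add: divide_simps) (simp add: algebra_simps)
  then show ?thesis using assms by (simp add: add_pos_pos)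
qed

text \<open>After the exchange of colours the relevant comparison is between \<open>p\<close> and
  \<open>q powr \<gamma>'\<close>. Raising the ratios with \<open>p powr (1 / \<gamma>')\<close> to
  the power \<open>\<gamma>'\<close> produces exactly that, and positive powers preserve convergence
  to 0.\<close>

lemma powr_ratio_swap:
  fixes p q \<gamma> :: real
  assumes "p > 0" "q > 0" "\<gamma> > 0"
  shows "(p powr (1 / \<gamma>) / q) powr \<gamma> = p / q powr \<gamma>"
    and "(q / p powr (1 / \<gamma>)) powr \<gamma> = q powr \<gamma> / p"
  using assms by (simp_all add: powr_divide powr_powr)

theorem corollary1p2:
  fixes \<rho> \<tau> :: nat and r \<gamma> \<gamma>' :: real and B R :: "vertex set"
  assumes "\<rho> \<ge> 1" and "\<tau> \<ge> 1" and "r > 0"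
    and "R = {0} \<times> {- int \<rho>..int \<rho>}"
    and "B = {- int \<tau>..int \<tau>} \<times> {0}"
    and "\<gamma> = 1 / real \<tau> + real \<rho> / (real \<rho> + 1)"
    and "\<gamma>' = 1 / real \<rho> + real \<tau> / (real \<tau> + 1)"
  shows "\<gamma> * \<gamma>' > 1 \<and>
    (\<forall>(F :: 'i filter) (p :: 'i \<Rightarrow> real) (q :: 'i \<Rightarrow> real).
      (\<forall>\<^sub>F i in F. p i > 0 \<and> q i > 0) \<and> (p \<longlongrightarrow> 0) F \<and> (q \<longlongrightarrow> 0) F \<longrightarrow>
        (((\<lambda>i. q i / p i powr \<gamma>) \<longlongrightarrow> 0) F \<longrightarrow>
          ((\<lambda>i. final_state_prob B R r (p i) (q i) Blue) \<longlongrightarrow> 1) F) \<and>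
        (((\<lambda>i. p i powr \<gamma> / q i) \<longlongrightarrow> 0) F \<and> ((\<lambda>i. q i / p i powr (1 / \<gamma>')) \<longlongrightarrow> 0) F \<longrightarrow>
          ((\<lambda>i. final_state_prob B R r (p i) (q i) Empty) \<longlongrightarrow> 1) F) \<and>
        (((\<lambda>i. p i powr (1 / \<gamma>') / q i) \<longlongrightarrow> 0) F \<longrightarrow>
          ((\<lambda>i. final_state_prob B R r (p i) (q i) Red) \<longlongrightarrow> 1) F))"
proof -
  interpret competition \<rho> \<tau> r using assms by unfold_locales auto
  interpret M: competition \<tau> \<rho> "1 / r" using assms by unfold_locales auto
  have R: "R = red_nbhd" and B: "B = blue_nbhd"
    using assms by (simp_all add: red_nbhd_def blue_nbhd_def)
  have "\<gamma> * \<gamma>' > 1" unfolding assms(6,7) using assms(1,2) by (intro exponent_product_gt_1) auto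
  have \<gamma>': "\<gamma>' > 0" unfolding assms(7) using assms(1,2) by (intro add_pos_nonneg) auto
  have "(((\<lambda>i. q i / p i powr \<gamma>) \<longlongrightarrow> 0) F \<longrightarrow>
          ((\<lambda>i. final_state_prob B R r (p i) (q i) Blue) \<longlongrightarrow> 1) F) \<and>
        (((\<lambda>i. p i powr \<gamma> / q i) \<longlongrightarrow> 0) F \<and> ((\<lambda>i. q i / p i powr (1 / \<gamma>')) \<longlongrightarrow> 0) F \<longrightarrow>
          ((\<lambda>i. final_state_prob B R r (p i) (q i) Empty) \<longlongrightarrow> 1) F) \<and>
        (((\<lambda>i. p i powr (1 / \<gamma>') / q i) \<longlongrightarrow> 0) F \<longrightarrow>
          ((\<lambda>i. final_state_prob B R r (p i) (q i) Red) \<longlongrightarrow> 1) F)"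
    if asm: "(\<forall>\<^sub>F i in F. p i > 0 \<and> q i > 0) \<and> (p \<longlongrightarrow> 0) F \<and> (q \<longlongrightarrow> 0) F"
    for F :: "'i filter" and p q :: "'i \<Rightarrow> real"
  proof -
    have pos: "\<forall>\<^sub>F i in F. p i > 0 \<and> q i > 0" and lim: "(p \<longlongrightarrow> 0) F" "(q \<longlongrightarrow> 0) F"
      using asm by auto
    have pos': "\<forall>\<^sub>F i in F. q i > 0 \<and> p i > 0" using pos by eventually_elim simp
    note rc = eventually_random_competition[OF pos lim]
    have mirror: "\<forall>\<^sub>F i in F. final_state_prob M.blue_nbhd M.red_nbhd (1 / r) (q i) (p i) Blue
        = final_state_prob B R r (p i) (q i) Red"
      using rc by eventually_elim
        (simp only: R B random_competition.final_state_prob_Red_eq_mirror)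
    have red: "((\<lambda>i. final_state_prob B R r (p i) (q i) Red) \<longlongrightarrow> l) F"
      if "((\<lambda>i. final_state_prob M.blue_nbhd M.red_nbhd (1 / r) (q i) (p i) Blue) \<longlongrightarrow> l) F" for l
      using that mirror by (rule Lim_transform_eventually)
    have to_powr: "((\<lambda>i. f i powr \<gamma>') \<longlongrightarrow> 0) F" if "(f \<longlongrightarrow> 0) F" "\<forall>\<^sub>F i in F. 0 \<le> f i"
      for f :: "'i \<Rightarrow> real"
      using that(1) tendsto_const that(2) \<gamma>' by (rule tendsto_zero_powrI)
    have 1: "((\<lambda>i. final_state_prob B R r (p i) (q i) Blue) \<longlongrightarrow> 1) F"
      if "((\<lambda>i. q i / p i powr \<gamma>) \<longlongrightarrow> 0) F"
      unfolding R B by (rule blue_wins[OF pos lim assms(6) that])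
    have 3: "((\<lambda>i. final_state_prob B R r (p i) (q i) Red) \<longlongrightarrow> 1) F"
      if "((\<lambda>i. p i powr (1 / \<gamma>') / q i) \<longlongrightarrow> 0) F"
    proof (rule red, rule M.blue_wins[OF pos' lim(2,1) assms(7)])
      have "((\<lambda>i. (p i powr (1 / \<gamma>') / q i) powr \<gamma>') \<longlongrightarrow> 0) F"
        by (rule to_powr[OF that]) (use pos in eventually_elim, simp)
      then show "((\<lambda>i. p i / q i powr \<gamma>') \<longlongrightarrow> 0) F"
        by (rule Lim_transform_eventually) (use pos in eventually_elim, simp add: powr_ratio_swap \<gamma>')
    qed
    have 2: "((\<lambda>i. final_state_prob B R r (p i) (q i) Empty) \<longlongrightarrow> 1) F"
      if "((\<lambda>i. p i powr \<gamma> / q i) \<longlongrightarrow> 0) F" "((\<lambda>i. q i / p i powr (1 / \<gamma>')) \<longlongrightarrow> 0) F"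
    proof -
      have b: "((\<lambda>i. final_state_prob B R r (p i) (q i) Blue) \<longlongrightarrow> 0) F"
        unfolding R B by (rule blue_blocked[OF pos lim assms(6) that(1)])
      have "((\<lambda>i. (q i / p i powr (1 / \<gamma>')) powr \<gamma>') \<longlongrightarrow> 0) F"
        by (rule to_powr[OF that(2)]) (use pos in eventually_elim, simp)
      then have "((\<lambda>i. q i powr \<gamma>' / p i) \<longlongrightarrow> 0) F"
        by (rule Lim_transform_eventually) (use pos in eventually_elim, simp add: powr_ratio_swap \<gamma>')
      then have "((\<lambda>i. final_state_prob B R r (p i) (q i) Red) \<longlongrightarrow> 0) F"
        by (intro red M.blue_blocked[OF pos' lim(2,1) assms(7)])
      then have "((\<lambda>i. 1 - final_state_prob B R r (p i) (q i) Blue - final_state_prob B R r (p i) (q i) Red)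
          \<longlongrightarrow> 1 - 0 - 0) F"
        by (intro tendsto_intros b)
      then have "((\<lambda>i. 1 - final_state_prob B R r (p i) (q i) Blue - final_state_prob B R r (p i) (q i) Red)
          \<longlongrightarrow> 1) F" by simp
      then show ?thesis
        unfolding R B
        by (rule Lim_transform_eventually)
          (use rc in eventually_elim, simp add: random_competition.final_state_prob_Empty)
    qed
    show ?thesis using 1 2 3 by blast
  qed
  then show ?thesis using \<open>\<gamma> * \<gamma>' > 1\<close> by blast
qed

end
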